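(* Let $n\ge1$ be odd. The magnitude of the closed Euclidean ball of radius $R>0$ in $\mathbb{R}^n$ is a rational function of $R$ with rational coefficients; that is, there exist polynomials $P,Q$ with rational coefficients such that for every $R>0$ the magnitude equals $P(R)/Q(R)$.
   Context: Subsets of $\mathbb{R}^n$ carry the Euclidean metric; $\omega_n$ is the volume of the unit ball in $\mathbb{R}^n$. Magnitude: for a finite metric space $(\Xi,d)$, if $w:\Xi\to\mathbb{R}$ satisfies $\sum_{y\in \Xi}e^{-d(x,y)}w(y)=1$ for all $x\in \Xi$, then $|\Xi|:=\sum_{x\in \Xi}w(x)$ (independent of the choice of $w$; such $w$ exists for every finite subset of a Euclidean space). For a compact set $X\subseteq\mathbb{R}^n$, the magnitude is $|X|:=\sup\{|\Xi| : \Xi \text{ a finite subset of } X\}$. By a known theorem of Meckes, for compact $X\subseteq\mathbb{R}^n$ this equals $$|X|=\frac{1}{n!\,\omega_n}\inf\left\{\|f\|^2_{H^{(n+1)/2}(\mathbb{R}^n)} : f\in H^{(n+1)/2}(\mathbb{R}^n),\ f\equiv 1\text{ on }X\right\},$$ where $\|f\|^2_{H^{m}(\mathbb{R}^n)}=\|(I-\Delta)^{m/2}f\|^2_{L^2(\mathbb{R}^n)}$. *)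

theory Defs
  imports "HOL-Analysis.Analysis" "HOL-Computational_Algebra.Polynomial"
begin

definition weighting :: "'a::metric_space set \<Rightarrow> ('a \<Rightarrow> real) \<Rightarrow> bool" where
  "weighting A w \<longleftrightarrow> (\<forall>x\<in>A. (\<Sum>y\<in>A. exp (- dist x y) * w y) = 1)"

(* Meaningful for finite A admitting a weighting, which every finite subset of a
   Euclidean space does; the value does not depend on the weighting, see finite_magnitude_eq. *)
definition finite_magnitude :: "'a::metric_space set \<Rightarrow> real" where
  "finite_magnitude A = (THE m. \<exists>w. weighting A w \<and> m = (\<Sum>x\<in>A. w x))"

lemma weighting_sum_unique:
  assumes "weighting A v" "weighting A w"
  shows "sum v A = sum w A"
proof -
  have "sum v A = (\<Sum>x\<in>A. v x * (\<Sum>y\<in>A. exp (- dist x y) * w y))"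
    using assms(2) by (simp add: weighting_def)
  also have "\<dots> = (\<Sum>y\<in>A. \<Sum>x\<in>A. v x * (exp (- dist x y) * w y))"
    by (simp add: sum_distrib_left) (rule sum.swap)
  also have "\<dots> = (\<Sum>y\<in>A. w y * (\<Sum>x\<in>A. exp (- dist y x) * v x))"
    by (simp add: sum_distrib_left dist_commute mult_ac)
  also have "\<dots> = sum w A"
    using assms(1) by (simp add: weighting_def)
  finally show ?thesis .
qed

lemma finite_magnitude_eq:
  assumes "weighting A w"
  shows "finite_magnitude A = (\<Sum>x\<in>A. w x)"
  unfolding finite_magnitude_def
  using assms weighting_sum_unique by (intro the_equality) blast+

(* Extended-real supremum: an equation with a real number then includes boundedness,
   whereas Sup on real is unspecified for unbounded sets. *)
definition magnitude :: "'a::metric_space set \<Rightarrow> ereal" where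
  "magnitude X = (SUP A\<in>{A. finite A \<and> A \<subseteq> X}. ereal (finite_magnitude A))"

end

theory Submission
  imports Defs "Jordan_Normal_Form.Char_Poly"
begin

text \<open>
  Write \<open>n = 2 q + 1\<close>. Averaging over directions \<open>\<theta>\<close> of the unit sphere,
  \<open>exp (- norm z)\<close> is the mean of \<open>k (\<theta> \<bullet> z)\<close> for a kernel \<open>k t = p \<bar>t\<bar> * exp (- \<bar>t\<bar>)\<close> on the line,
  where \<open>p\<close> is a polynomial of degree \<open>q\<close> with rational coefficients. Moreover
  \<open>k (x - y) = \<kappa> * \<integral> \<phi> (u - x) * \<phi> (u - y) du\<close> with \<open>\<phi>\<close> a polynomial times \<open>exp (- t)\<close> on the positive half
  line (a Laguerre function), so \<open>k\<close> is positive definite.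

  On \<open>{-R..R}\<close> there is a weight \<open>w\<close>, an even polynomial density of degree \<open>2 q\<close> together with two equal point
  masses at the endpoints, whose potential \<open>k * w\<close> is \<open>1\<close> on \<open>{-R..R}\<close>; its coefficients solve a linear system
  with entries in the rational polynomials in \<open>R\<close>, which is nonsingular for every \<open>R > 0\<close> because \<open>k\<close> is strictly
  definite. The total mass of \<open>w\<close> is the magnitude of the ball. The upper bound is the Cauchy-Schwarz
  inequality in every direction. For the lower bound, \<open>w\<close> is a limit, in energy, of densities
  \<open>(R\<^sup>2 - t\<^sup>2) ^ q * poly p (R\<^sup>2 - t\<^sup>2)\<close>, and these are exactly the one-dimensional marginals of radial
  polynomial densities on the ball, which are in turn approximated by finite sets.
\<close>

text \<open>In Fourier terms \<open>exp (- norm z)\<close> on a space of dimension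
  \<open>2 * q + 1\<close> has transform proportional to
  \<open>1 / (1 + |\<xi>|^2) ^ (q + 1)\<close>. Polar coordinates contribute
  \<open>|\<xi>| ^ (2 * q)\<close>, so the kernel \<open>k\<close> on the line must have transform
  proportional to \<open>\<xi> ^ (2 * q) / (1 + \<xi>^2) ^ (q + 1)\<close>. This is the squared
  modulus of \<open>(i \<xi>) ^ q / (1 + i \<xi>) ^ (q + 1)\<close>, the transform of the Laguerre
  function \<open>\<phi>\<close>. The proof obtains these facts from polynomial identities instead,
  which also keep all coefficients rational. The zero of order \<open>2 * q\<close> at \<xi> = 0 is
  the reason why an even polynomial density of degree \<open>2 * q\<close> can have a constant
  potential. The obstacle is the lower bound. For \<open>q \<ge> 1\<close> no finite signed measure
  on the ball has a marginal with the same nonzero atom at \<open>R\<close> in every direction,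
  since it would charge every point of the sphere. So \<open>w\<close> with nonzero endpoint masses
  is not itself a marginal and can only be approached in energy, by densities with a zero of order
  \<open>q\<close> at both endpoints.\<close>

hide_const (open) Module.smult

no_notation scalar_prod (infix "\<bullet>" 70)


section \<open>Radial polynomials and their factorization\<close>

text \<open>For \<open>k\<^sub>q t = radial_poly q t * exp (- t)\<close> the recursion reads
  \<open>(2 q + 1) * k\<^sub>q\<^sub>+\<^sub>1 t = (2 q + 1) * k\<^sub>q t + t * k\<^sub>q' t\<close>; it compensates for raising the dimension
  \<open>2 q + 1\<close> by two in the average over directions.\<close>

primrec radial_poly :: "nat \<Rightarrow> 'a::field_char_0 poly" where
  "radial_poly 0 = 1"
| "radial_poly (Suc q) = radial_poly q
     + smult (1 / of_nat (2 * q + 1)) (pCons 0 (pderiv (radial_poly q) - radial_poly q))"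

text \<open>Multiplied by \<open>exp (- t)\<close>, \<open>exp_deriv p\<close> is the derivative of \<open>p t * exp (- t)\<close>.\<close>

definition exp_deriv :: "'a::field_char_0 poly \<Rightarrow> 'a poly" where
  "exp_deriv p = pderiv p - p"

lemma exp_deriv_add: "exp_deriv (p + r) = exp_deriv p + exp_deriv r"
  and exp_deriv_diff: "exp_deriv (p - r) = exp_deriv p - exp_deriv r"
  and exp_deriv_smult: "exp_deriv (smult c p) = smult c (exp_deriv p)"
  and exp_deriv_pCons: "exp_deriv (pCons 0 p) = p + pCons 0 (exp_deriv p)"
  and exp_deriv_0: "exp_deriv 0 = 0"
  by (simp_all add: exp_deriv_def pderiv_add pderiv_diff pderiv_smult smult_diff_right pderiv_pCons
      algebra_simps)

text \<open>For \<open>k t = radial_poly q t * exp (- t)\<close> and \<open>c = 2 * q + 1\<close>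
  this is the equation \<open>c k + t (k' - k''') - k'' = 0\<close>. With \<open>L_c k\<close> for
  its left side, the induction rests on the identity
  \<open>L_{c+2} (c k + t k') = (c + 2) L_c k + t (L_c k)'\<close>, by which the recursion carries a
  solution for \<open>c\<close> to one for \<open>c + 2\<close>.\<close>

lemma radial_poly_ode:
  "smult (of_nat (2 * q + 1)) (radial_poly q) +
   pCons 0 (exp_deriv (radial_poly q) - exp_deriv (exp_deriv (exp_deriv (radial_poly q))))
   - exp_deriv (exp_deriv (radial_poly q)) = (0 :: 'a::field_char_0 poly)"
proof (induction q)
  case 0
  show ?case by (simp add: exp_deriv_def one_pCons pderiv_pCons)
next
  case (Suc q)
  define c :: 'a where "c = of_nat (2 * q + 1)"
  have c0: "c \<noteq> 0" unfolding c_def by (metis Suc_eq_plus1 of_nat_neq_0)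
  have c2: "of_nat (2 * Suc q + 1) = c + 2" unfolding c_def by simp
  define P :: "'a poly" where "P = radial_poly q"
  define P1 where "P1 = exp_deriv P"
  define P2 where "P2 = exp_deriv P1"
  define P3 where "P3 = exp_deriv P2"
  define P4 where "P4 = exp_deriv P3"
  \<comment> \<open>Multiplication by \<open>X\<close> and by the constant \<open>C\<close> replaces
    \<open>pCons\<close> and \<open>smult\<close>, so that the claim becomes an identity in a
    commutative ring.\<close>
  define X :: "'a poly" where "X = [:0, 1:]"
  have pc: "pCons 0 r = X * r" for r by (simp add: X_def)
  have sm: "smult a r = [:a:] * r" for a and r :: "'a poly" by simp
  define C where "C = [:c:]"
  have IH: "C * P + X * (P1 - P3) - P2 = 0"
    using Suc unfolding c_def[symmetric] P_def[symmetric] P1_def[symmetric] P2_def[symmetric]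
      P3_def[symmetric] pc sm C_def .
  have dX: "exp_deriv (X * r) = r + X * exp_deriv r" for r
    using exp_deriv_pCons[of r] by (simp add: pc)
  have dC: "exp_deriv (C * r) = C * exp_deriv r" for r
    using exp_deriv_smult[of c r] by (simp add: C_def)
  note ds = exp_deriv_add exp_deriv_diff dX dC P1_def[symmetric] P2_def[symmetric] P3_def[symmetric]
    P4_def[symmetric] exp_deriv_0
  have dIH: "C * P1 + (P1 - P3) + X * (P2 - P4) - P3 = 0"
    using arg_cong[OF IH, of exp_deriv] by (simp only: ds add.assoc)
  define Y where "Y = C * P + X * P1"
  have Y: "smult c (radial_poly (Suc q)) = Y"
    using c0 unfolding Y_def C_def X_def P1_def P_def exp_deriv_def
    by (simp add: smult_add_right c_def add.commute)
  define Y1 where "Y1 = exp_deriv Y"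
  define Y2 where "Y2 = exp_deriv Y1"
  define Y3 where "Y3 = exp_deriv Y2"
  have y1: "Y1 = C * P1 + (P1 + X * P2)" unfolding Y1_def Y_def by (simp only: ds)
  have y2: "Y2 = C * P2 + (P2 + (P2 + X * P3))" unfolding Y2_def y1 by (simp only: ds)
  have y3: "Y3 = C * P3 + (P3 + (P3 + (P3 + X * P4)))" unfolding Y3_def y2 by (simp only: ds)
  have main: "(C + 2) * Y + X * (Y1 - Y3) - Y2 = 0"
  proof -
    have "(C + 2) * Y + X * (Y1 - Y3) - Y2 = (C + 2) * (C * P + X * (P1 - P3) - P2)
        + X * (C * P1 + (P1 - P3) + X * (P2 - P4) - P3)"
      unfolding y1 y2 y3 unfolding Y_def by (simp add: algebra_simps)
    then show ?thesis unfolding IH dIH by simp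
  qed
  have C2: "[:c + 2:] = C + 2" unfolding C_def by (simp add: numeral_poly)
  define L where "L r = smult (c + 2) r + pCons 0 (exp_deriv r - exp_deriv (exp_deriv (exp_deriv r)))
   - exp_deriv (exp_deriv r)" for r
  have Lc: "L (smult c r) = smult c (L r)" for r
    unfolding L_def by (simp add: exp_deriv_smult smult_diff_right smult_add_right mult.commute)
  have "L Y = 0" unfolding L_def pc sm C2
    using main unfolding Y1_def Y2_def Y3_def .
  then have "L (radial_poly (Suc q)) = 0" using Lc[of "radial_poly (Suc q)"] c0 unfolding Y by simp
  then show ?case unfolding L_def c2 .
qed

text \<open>For the even extensions of the kernels to the line this says that one step of the
  recursion multiplies the Fourier transform by a constant times
  \<open>\<xi>^2 / (1 + \<xi>^2)\<close>. It follows from \<open>radial_poly_ode\<close> by using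
  the recursion to eliminate the factor \<open>t\<close>.\<close>

lemma radial_poly_Suc_ode:
  "radial_poly (Suc q) - exp_deriv (exp_deriv (radial_poly (Suc q))) =
   - smult (of_nat (2 * q + 2) / of_nat (2 * q + 1)) (exp_deriv (exp_deriv (radial_poly q)) :: 'a::field_char_0 poly)"
proof -
  define c :: 'a where "c = of_nat (2 * q + 1)"
  have c0: "c \<noteq> 0" unfolding c_def by (metis Suc_eq_plus1 of_nat_neq_0)
  have c1: "of_nat (2 * q + 2) = c + 1" unfolding c_def by simp
  define P :: "'a poly" where "P = radial_poly q"
  have ode: "smult c P + pCons 0 (exp_deriv P - exp_deriv (exp_deriv (exp_deriv P))) - exp_deriv (exp_deriv P) = 0"
    using radial_poly_ode[of q] by (simp add: c_def P_def)
  have S: "radial_poly (Suc q) = P + smult (1/c) (pCons 0 (exp_deriv P))"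
    by (simp add: P_def c_def exp_deriv_def)
  have "smult c (radial_poly (Suc q) - exp_deriv (exp_deriv (radial_poly (Suc q)))) =
     smult c P + pCons 0 (exp_deriv P) - smult c (exp_deriv (exp_deriv P))
      - (exp_deriv (exp_deriv P) + (exp_deriv (exp_deriv P) + pCons 0 (exp_deriv (exp_deriv (exp_deriv P)))))"
    using c0 unfolding S exp_deriv_add exp_deriv_smult exp_deriv_pCons
    by (simp add: smult_add_right smult_diff_right algebra_simps)
  also have "\<dots> = (smult c P + pCons 0 (exp_deriv P - exp_deriv (exp_deriv (exp_deriv P))) - exp_deriv (exp_deriv P))
      - smult (c + 1) (exp_deriv (exp_deriv P))"
    by (simp add: smult_add_left algebra_simps) 
  also have "\<dots> = smult c (- smult ((c+1)/c) (exp_deriv (exp_deriv P)))"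
    unfolding ode using c0 by simp
  finally have "smult c (radial_poly (Suc q) - exp_deriv (exp_deriv (radial_poly (Suc q)))) = smult c (- smult ((c+1)/c) (exp_deriv (exp_deriv P)))" .
  then have "radial_poly (Suc q) - exp_deriv (exp_deriv (radial_poly (Suc q))) = - smult ((c+1)/c) (exp_deriv (exp_deriv P))"
    using c0 by (metis smult_eq_iff divide_self smult_1_left smult_smult mult.commute left_inverse)
  then show ?thesis by (simp only: P_def c1 c_def)
qed

section \<open>Integrals of polynomials against decaying exponentials\<close>

lemma abs_poly_le_exp:
  assumes "a > 0"
  shows "\<exists>C\<ge>0. \<forall>s\<ge>0. \<bar>poly p s\<bar> \<le> C * exp (a * s :: real)"
  using assms
proof (induction p arbitrary: a)
  case 0
  then show ?case by (intro exI[of _ 0]) auto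
next
  case (pCons c p)
  \<comment> \<open>Half of the rate pays for the remaining polynomial, the other half for the extra
    factor \<open>s\<close>.\<close>
  from pCons.IH[of "a/2"] pCons.prems obtain C where C: "C \<ge> 0" "\<And>s. s \<ge> 0 \<Longrightarrow> \<bar>poly p s\<bar> \<le> C * exp (a / 2 * s)"
    by auto
  show ?case
  proof (intro exI[of _ "\<bar>c\<bar> + 2 / a * C"] conjI allI impI)
    show "0 \<le> \<bar>c\<bar> + 2 / a * C" using C(1) pCons.prems by simp
    fix s :: real assume s: "0 \<le> s"
    have "a / 2 * s \<le> exp (a / 2 * s)" using exp_ge_add_one_self[of "a / 2 * s"] by linarith
    then have s1: "s \<le> 2 / a * exp (a / 2 * s)" using pCons.prems by (simp add: field_simps)
    have "\<bar>s * poly p s\<bar> \<le> (2 / a * exp (a / 2 * s)) * (C * exp (a / 2 * s))"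
      unfolding abs_mult using C s s1 by (intro mult_mono) auto
    also have "\<dots> = 2 / a * C * exp (a * s)" by (simp add: exp_add[symmetric])
    finally have "\<bar>s * poly p s\<bar> \<le> 2 / a * C * exp (a * s)" .
    moreover have "\<bar>c\<bar> \<le> \<bar>c\<bar> * exp (a * s)" using s pCons.prems by (simp add: mult_le_cancel_left1)
    ultimately show "\<bar>poly (pCons c p) s\<bar> \<le> (\<bar>c\<bar> + 2 / a * C) * exp (a * s)"
      by (simp add: algebra_simps)
  qed
qed

lemma set_integrable_exp_minus:
  assumes "a > 0"
  shows "set_integrable lborel {0..} (\<lambda>x::real. exp (- a * x))"
proof -
  have "set_integrable lebesgue {0..} (\<lambda>x::real. exp (- a * x))"
    unfolding absolutely_integrable_on_iff_nonneg[symmetric]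
    using nonnegative_absolutely_integrable_1[OF integrable_on_exp_minus_to_infinity[OF assms, of 0]] by simp
  then show ?thesis unfolding set_integrable_def
    by (subst (asm) integrable_completion) (auto intro!: borel_measurable_continuous_on_indicator continuous_intros)
qed

lemma set_integrable_poly_exp:
  assumes "a > 0"
  shows "set_integrable lborel {0..} (\<lambda>x::real. poly p x * exp (- a * x))"
proof -
  obtain C where C: "C \<ge> 0" "\<And>s. s \<ge> 0 \<Longrightarrow> \<bar>poly p s\<bar> \<le> C * exp (a / 2 * s)"
    using abs_poly_le_exp[of "a/2" p] assms by auto
  have "set_integrable lborel {0..} (\<lambda>x::real. C * exp (- (a / 2) * x))"
    using set_integrable_exp_minus[of "a/2"] assms by simp
  then show ?thesis
  proof (rule set_integrable_bound)
    show "set_borel_measurable lborel {0..} (\<lambda>x. poly p x * exp (- a * x))"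
      unfolding set_borel_measurable_def 
      by (simp, intro borel_measurable_continuous_onI borel_measurable_times borel_measurable_indicator continuous_intros) auto
    show "AE x in lborel. x \<in> {0..} \<longrightarrow> norm (poly p x * exp (- a * x)) \<le> norm (C * exp (- (a / 2) * x))"
    proof (intro AE_I2 impI)
      fix x :: real assume "x \<in> {0..}"
      then have "\<bar>poly p x\<bar> * exp (- a * x) \<le> C * exp (a / 2 * x) * exp (- a * x)"
        using C(2)[of x] by (intro mult_right_mono) auto
      then show "norm (poly p x * exp (- a * x)) \<le> norm (C * exp (- (a / 2) * x))"
        using C(1) by (simp add: abs_mult mult.assoc exp_add[symmetric])
    qed
  qed
qed

text \<open>The rate is 2 because both factors in a correlation of functions of the form
  \<open>p t * exp (- t)\<close> contribute \<open>exp (- s)\<close>.\<close>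

definition laplace2 :: "real poly \<Rightarrow> real" where
  "laplace2 p = (LINT s:{0..}|lborel. poly p s * exp (- 2 * s))"

lemma laplace2_add: "laplace2 (p + r) = laplace2 p + laplace2 r"
  unfolding laplace2_def
  using set_integral_add(2)[OF set_integrable_poly_exp[of 2 p] set_integrable_poly_exp[of 2 r]]
  by (simp add: algebra_simps)

lemma laplace2_smult: "laplace2 (smult c p) = c * laplace2 p"
  unfolding laplace2_def by (simp add: mult.assoc)

lemma laplace2_diff: "laplace2 (p - r) = laplace2 p - laplace2 r"
  using laplace2_add[of "p - r" r] by simp

lemma poly_exp_tendsto_0:
  assumes "a > 0"
  shows "((\<lambda>x::real. poly p x * exp (- a * x)) \<longlongrightarrow> 0) at_top"
proof -
  obtain C where C: "C \<ge> 0" "\<And>s. s \<ge> 0 \<Longrightarrow> \<bar>poly p s\<bar> \<le> C * exp (a / 2 * s)"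
    using abs_poly_le_exp[of "a/2" p] assms by auto
  have "filterlim (\<lambda>x. (a/2) * x) at_top at_top"
    using assms by (intro filterlim_tendsto_pos_mult_at_top[OF tendsto_const]) (auto intro: filterlim_ident)
  then have "filterlim (\<lambda>x. - ((a/2) * x)) at_bot at_top" by (rule filterlim_uminus_at_bot_at_top[THEN filterlim_compose])
  then have "((\<lambda>x. exp (- ((a/2) * x))) \<longlongrightarrow> 0) at_top" by (rule exp_at_bot[THEN filterlim_compose])
  then have "((\<lambda>x. C * exp (- ((a/2) * x))) \<longlongrightarrow> 0) at_top" by (rule tendsto_mult_right_zero)
  then show ?thesis
  proof (rule Lim_null_comparison[rotated])
    show "\<forall>\<^sub>F x in at_top. norm (poly p x * exp (- a * x)) \<le> C * exp (- ((a/2) * x))"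
      using eventually_ge_at_top[of 0]
    proof eventually_elim
      case (elim x)
      then have "\<bar>poly p x\<bar> * exp (- a * x) \<le> C * exp (a / 2 * x) * exp (- a * x)"
        using C(2)[of x] by (intro mult_right_mono) auto
      then show ?case by (simp add: abs_mult mult.assoc exp_add[symmetric])
    qed
  qed
qed

lemma laplace2_pderiv: "laplace2 (pderiv p) = 2 * laplace2 p - coeff p 0"
proof -
  have "(LBINT x=ereal 0..\<infinity>. poly (pderiv p - smult 2 p) x * exp (- 2 * x)) = 0 - poly p 0"
  proof (rule interval_integral_FTC_integrable[where F = "\<lambda>x. poly p x * exp (- 2 * x)"])
    show "((\<lambda>x. poly p x * exp (- 2 * x)) has_vector_derivative poly (pderiv p - smult 2 p) x * exp (- 2 * x)) (at x)" for x
      unfolding has_real_derivative_iff_has_vector_derivative[symmetric]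
      by (auto intro!: derivative_eq_intros simp: algebra_simps)
    show "isCont (\<lambda>x. poly (pderiv p - smult 2 p) x * exp (- 2 * x)) x" for x
      by (intro continuous_intros)
    show "set_integrable lborel (einterval (ereal 0) \<infinity>) (\<lambda>x. poly (pderiv p - smult 2 p) x * exp (- 2 * x))"
      by (rule set_integrable_subset[OF set_integrable_poly_exp[of 2]]) (auto simp: einterval_def)
    show "(((\<lambda>x. poly p x * exp (- 2 * x)) \<circ> real_of_ereal) \<longlongrightarrow> poly p 0) (at_right (ereal 0))"
      unfolding comp_def ereal_tendsto_simps(2)[unfolded comp_def]
      by (rule tendsto_eq_intros filterlim_mono[OF _ order_refl] | simp add: filterlim_at_within_If)+
    show "(((\<lambda>x. poly p x * exp (- 2 * x)) \<circ> real_of_ereal) \<longlongrightarrow> 0) (at_left \<infinity>)"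
      unfolding ereal_tendsto_simps by (rule poly_exp_tendsto_0) simp
  qed auto
  moreover have "(LBINT x=ereal 0..\<infinity>. poly (pderiv p - smult 2 p) x * exp (- 2 * x)) = laplace2 (pderiv p - smult 2 p)"
  proof -
    have "AE x in lborel. x \<noteq> (0::real)" by (rule AE_lborel_singleton)
    then have "AE x in lborel. indicat_real {0<..} x = indicat_real {0::real..} x"
      by (rule eventually_mono) (auto simp: indicator_def)
    then show ?thesis
      unfolding laplace2_def by (subst interval_integral_Ioi, simp) (unfold set_lebesgue_integral_def, 
       intro integral_cong_AE borel_measurable_scaleR, auto intro!: borel_measurable_continuous_onI continuous_intros)
  qed
  ultimately show ?thesis by (simp add: laplace2_diff laplace2_smult poly_0_coeff_0)
qed

section \<open>Correlations of polynomials times exponentials\<close>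

lemma higher_pderiv_degree_less: "degree m < k \<Longrightarrow> (pderiv ^^ k) m = (0 :: real poly)"
  by (rule poly_eqI) (simp add: coeff_higher_pderiv coeff_eq_0)

lemma poly_taylor:
  fixes m :: "real poly"
  assumes "degree m < N"
  shows "poly m (s + t) = (\<Sum>k<N. t ^ k / fact k * poly ((pderiv ^^ k) m) s)"
proof -
  have "\<exists>u. poly m (s + t) = (\<Sum>k<N. poly ((pderiv ^^ k) m) (s + 0) / fact k * t ^ k)
      + poly ((pderiv ^^ N) m) (s + u) / fact N * t ^ N"
  \<comment> \<open>\<open>Maclaurin_all_lt\<close> requires \<open>t \<noteq> 0\<close>. In both
    cases the remainder vanishes, as \<open>N\<close> exceeds the degree.\<close>
  proof (cases "t = 0")
    case True
    obtain M where "N = Suc M" using assms by (cases N) auto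
    then show ?thesis using True by (intro exI[of _ 0]) (simp add: sum.lessThan_Suc_shift)
  next
    case False
    have "\<exists>u. 0 < \<bar>u\<bar> \<and> \<bar>u\<bar> < \<bar>t\<bar> \<and> poly m (s + t) = (\<Sum>k<N. poly ((pderiv ^^ k) m) (s + 0) / fact k * t ^ k)
      + poly ((pderiv ^^ N) m) (s + u) / fact N * t ^ N"
    proof (rule Maclaurin_all_lt[where f = "\<lambda>t. poly m (s + t)" and diff = "\<lambda>k t. poly ((pderiv ^^ k) m) (s + t)"])
      show "\<forall>k x. ((\<lambda>t. poly ((pderiv ^^ k) m) (s + t)) has_real_derivative poly ((pderiv ^^ Suc k) m) (s + x)) (at x)"
        by (auto intro!: derivative_eq_intros)
    qed (use False assms in auto)
    then show ?thesis by blast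
  qed
  moreover have "(pderiv ^^ N) m = 0" by (rule higher_pderiv_degree_less[OF assms])
  ultimately show ?thesis by (simp add: mult.commute)
qed

text \<open>As a function of \<open>t\<close> this is the integral of
  \<open>l s * m (s + t) * exp (- 2 * s)\<close> over \<open>s \<ge> 0\<close>, expanded in powers
  of \<open>t\<close> by Taylor's formula. Hence \<open>exp (- t)\<close> times it is the
  correlation at lag \<open>t \<ge> 0\<close> of \<open>l s * exp (- s)\<close> and
  \<open>m s * exp (- s)\<close>. The form as a polynomial lets \<open>exp_deriv\<close> act on
  it.\<close>

definition laplace_corr :: "real poly \<Rightarrow> real poly \<Rightarrow> real poly" where
  "laplace_corr l m = (\<Sum>k\<le>degree m. monom (laplace2 (l * (pderiv ^^ k) m) / fact k) k)"

lemma laplace2_0: "laplace2 0 = 0"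
  by (simp add: laplace2_def)

lemma coeff_laplace_corr: "coeff (laplace_corr l m) k = laplace2 (l * (pderiv ^^ k) m) / fact k"
proof (cases "k \<le> degree m")
  case True
  then show ?thesis by (simp add: laplace_corr_def coeff_sum)
next
  case False
  then show ?thesis by (simp add: laplace_corr_def coeff_sum higher_pderiv_degree_less laplace2_0)
qed

lemma higher_pderiv_coeff_0: "coeff ((pderiv ^^ k) m) 0 = fact k * coeff (m :: real poly) k"
  by (simp add: coeff_higher_pderiv pochhammer_fact)

lemma laplace_corr_add_right: "laplace_corr l (m + r) = laplace_corr l m + laplace_corr l r"
  by (rule poly_eqI) (simp add: coeff_laplace_corr higher_pderiv_add distrib_left laplace2_add add_divide_distrib)

lemma laplace_corr_add_left: "laplace_corr (l + r) m = laplace_corr l m + laplace_corr r m"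
  by (rule poly_eqI) (simp add: coeff_laplace_corr distrib_right laplace2_add add_divide_distrib)

lemma laplace_corr_diff_right: "laplace_corr l (m - r) = laplace_corr l m - laplace_corr l r"
  using laplace_corr_add_right[of l "m - r" r] by simp

lemma laplace_corr_diff_left: "laplace_corr (l - r) m = laplace_corr l m - laplace_corr r m"
  using laplace_corr_add_left[of "l - r" r m] by simp

lemma pderiv_laplace_corr: "pderiv (laplace_corr l m) = laplace_corr l (pderiv m)"
  by (rule poly_eqI) (simp add: coeff_laplace_corr coeff_pderiv funpow_swap1 del: of_nat_Suc)

lemma exp_deriv_laplace_corr: "exp_deriv (laplace_corr l m) = laplace_corr l (exp_deriv m)"
  by (simp add: exp_deriv_def pderiv_laplace_corr laplace_corr_diff_right)

text \<open>Integrate the \<open>s\<close>-derivative of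
  \<open>l s * m (s + t) * exp (- 2 * s)\<close>: each factor takes one of the two exponentials, and
  the lower limit contributes \<open>- l 0 * m t\<close>.\<close>

lemma laplace_corr_by_parts:
  "laplace_corr l (exp_deriv m) + laplace_corr (exp_deriv l) m = - smult (coeff l 0) m"
proof (rule poly_eqI)
  fix k
  define r where "r = (pderiv ^^ k) m"
  have "laplace2 (l * pderiv r + pderiv l * r) = 2 * laplace2 (l * r) - coeff l 0 * (fact k * coeff m k)"
    using laplace2_pderiv[of "l * r"]
    by (simp add: pderiv_mult coeff_mult_0 r_def higher_pderiv_coeff_0 mult.commute)
  moreover have "coeff (laplace_corr l (exp_deriv m) + laplace_corr (exp_deriv l) m) k =
    (laplace2 (l * pderiv r) - laplace2 (l * r) + (laplace2 (pderiv l * r) - laplace2 (l * r))) / fact k"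
    unfolding exp_deriv_def laplace_corr_diff_left laplace_corr_diff_right coeff_add coeff_diff
      coeff_laplace_corr r_def by (simp add: funpow_swap1[symmetric] field_simps)
  ultimately show "coeff (laplace_corr l (exp_deriv m) + laplace_corr (exp_deriv l) m) k = coeff (- smult (coeff l 0) m) k"
    by (simp add: laplace2_add)
qed

lemma pderiv_surj: "\<exists>p. pderiv p = (r :: real poly) \<and> coeff p 0 = c"
proof (intro exI conjI)
  define p where "p = pCons c (\<Sum>k\<le>degree r. monom (coeff r k / (k + 1)) k)"
  have "coeff (\<Sum>k\<le>degree r. monom (coeff r k / (k + 1)) k) n = coeff r n / (n + 1)" for n
    by (simp add: coeff_sum) (simp add: coeff_eq_0)
  then show "pderiv p = r"
    by (intro poly_eqI) (simp add: p_def coeff_pderiv field_simps)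
  show "coeff p 0 = c" by (simp add: p_def)
qed

text \<open>In the induction step the difference \<open>D\<close> of both sides satisfies \<open>D'' = 2 D'\<close>, hence is constant, and
  comparing \<open>exp_deriv\<close> at \<open>0\<close> shows that it vanishes.\<close>

lemma radial_poly_factorization:
  "\<exists>l \<kappa>. \<kappa> > 0 \<and> coeff l 0 = 1 \<and> smult \<kappa> (laplace_corr l l) = (radial_poly q :: real poly)"
proof (induction q)
  case 0
  have "laplace2 1 = 1/2" using laplace2_pderiv[of 1] by (simp add: pderiv_1 laplace2_0)
  then have "smult 2 (laplace_corr 1 1) = 1"
    by (simp add: laplace_corr_def one_pCons[symmetric]) (simp add: one_pCons monom_0)
  then show ?case by (intro exI[of _ 1] exI[of _ 2]) auto
next
  case (Suc q)
  then obtain l \<kappa> where l: "\<kappa> > 0" "coeff l 0 = 1" "smult \<kappa> (laplace_corr l l) = (radial_poly q :: real poly)"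
    by blast
  \<comment> \<open>This is the recursion \<open>L_{q+1}' = L_q' - L_q\<close> of the Laguerre
    polynomials, with value 1 at 0. For the functions \<open>l t * exp (- t)\<close> extended by 0
    it reads \<open>\<phi>_{q+1} + \<phi>_{q+1}' = \<phi>_q'\<close> in the sense of distributions,
    which is the factor \<open>i \<xi> / (1 + i \<xi>)\<close> on the Fourier side.\<close>
  obtain l1 where l1: "pderiv l1 = exp_deriv l" "coeff l1 0 = 1" using pderiv_surj by blast
  define c where "c = real (2 * q + 2) / real (2 * q + 1)"
  have c: "c > 0" by (simp add: c_def)
  define G where "G = exp_deriv l"
  have G: "l1 + exp_deriv l1 = G" by (simp add: exp_deriv_def l1 G_def)
  \<comment> \<open>The old and the new correlation both lead to
    \<open>laplace_corr G G + G\<close>; the boundary terms agree because \<open>l\<close> and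
    \<open>l1\<close> are both 1 at 0.\<close>
  have A: "- exp_deriv (exp_deriv (laplace_corr l l)) = laplace_corr G G + G"
    using laplace_corr_by_parts[of l "exp_deriv l"] l(2)
    by (simp add: exp_deriv_laplace_corr G_def algebra_simps)
  have "l1 - exp_deriv (exp_deriv l1) = G - exp_deriv G"
    unfolding G[symmetric] exp_deriv_add by simp
  then have "laplace_corr l1 l1 - exp_deriv (exp_deriv (laplace_corr l1 l1)) = laplace_corr l1 G - laplace_corr l1 (exp_deriv G)"
    by (metis exp_deriv_laplace_corr laplace_corr_diff_right)
  also have "\<dots> = laplace_corr G G + G"
    using laplace_corr_by_parts[of l1 G] l1(2) laplace_corr_add_left[of l1 "exp_deriv l1" G] 
    unfolding G by (simp add: algebra_simps)
  finally have B: "laplace_corr l1 l1 - exp_deriv (exp_deriv (laplace_corr l1 l1)) = - exp_deriv (exp_deriv (laplace_corr l l))"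
    using A by simp
  define D where "D = smult (c * \<kappa>) (laplace_corr l1 l1) - radial_poly (Suc q)"
  \<comment> \<open>At lag 0 the two terms of the integration by parts coincide, so their common
    value depends on \<open>r 0\<close> only.\<close>
  have d0: "coeff (exp_deriv (laplace_corr r r)) 0 = - 1/2" if "coeff r 0 = 1" for r
  proof -
    have "laplace2 (r * exp_deriv r) + laplace2 (exp_deriv r * r) = -1"
      using arg_cong[OF laplace_corr_by_parts[of r r], of "\<lambda>p. coeff p 0"] that
      by (simp add: coeff_laplace_corr)
    then show ?thesis by (simp add: exp_deriv_laplace_corr coeff_laplace_corr mult.commute)
  qed
  have P0: "coeff (exp_deriv (radial_poly q :: real poly)) 0 = - \<kappa> / 2"
    unfolding l(3)[symmetric] exp_deriv_smult using d0[OF l(2)] by simp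
  have P1: "coeff (exp_deriv (radial_poly (Suc q) :: real poly)) 0 = c * (- \<kappa> / 2)"
  proof -
    have S: "radial_poly (Suc q) = radial_poly q + smult (1/(2 * q + 1)) (pCons 0 (exp_deriv (radial_poly q :: real poly)))"
      by (simp add: exp_deriv_def)
    show ?thesis unfolding S exp_deriv_add exp_deriv_smult exp_deriv_pCons coeff_add coeff_smult P0
      by (simp add: c_def field_simps)
  qed
  have D0: "coeff (exp_deriv D) 0 = 0"
    unfolding D_def exp_deriv_diff exp_deriv_smult coeff_diff coeff_smult P1 d0[OF l1(2)] by simp
  have "D - exp_deriv (exp_deriv D) = smult (c * \<kappa>) (laplace_corr l1 l1 - exp_deriv (exp_deriv (laplace_corr l1 l1)))
     - (radial_poly (Suc q) - exp_deriv (exp_deriv (radial_poly (Suc q))))"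
    unfolding D_def exp_deriv_diff exp_deriv_smult by (simp add: smult_diff_right)
  also have "\<dots> = 0"
    unfolding B radial_poly_Suc_ode l(3)[symmetric] exp_deriv_smult by (simp add: c_def mult.commute)
  finally have "pderiv (pderiv D) = smult 2 (pderiv D)"
    by (simp add: exp_deriv_def pderiv_diff algebra_simps numeral_poly)
  \<comment> \<open>A derivative lowers a positive degree, so \<open>pderiv D\<close> is constant;
    its derivative, twice itself, is then 0.\<close>
  then have "degree (pderiv D) = degree (pderiv (pderiv D)) \<and> (pderiv (pderiv D) = 0 \<longrightarrow> pderiv D = 0)"
    by simp
  then have "pderiv D = 0"
    by (metis degree_pderiv diff_is_0_eq' pderiv_eq_0_iff diff_self_eq_0 diff_le_self le_zero_eq nat_less_le not_less_eq_eq zero_less_diff Suc_diff_1 lessI less_irrefl)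
  then have "D = 0" using D0 by (metis exp_deriv_def diff_0 coeff_minus degree_eq_zeroE pderiv_eq_0_iff coeff_pCons_0 neg_equal_0_iff_equal pCons_0_0)
  then show ?case using l(1) c l1(2) by (intro exI[of _ l1] exI[of _ "c * \<kappa>"]) (simp add: D_def)
qed

section \<open>Marginals of radial densities\<close>

lemma nn_integral_lborel_translate:
  fixes f :: "'a::euclidean_space \<Rightarrow> ennreal"
  assumes [measurable]: "f \<in> borel_measurable borel"
  shows "(\<integral>\<^sup>+x. f (x + c) \<partial>lborel) = (\<integral>\<^sup>+x. f x \<partial>lborel)"
proof -
  have "(\<integral>\<^sup>+x. f x \<partial>lborel) = (\<integral>\<^sup>+x. f x \<partial>distr lborel borel ((+) c))"
    by (simp add: lborel_distr_plus)
  also have "\<dots> = (\<integral>\<^sup>+x. f (x + c) \<partial>lborel)"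
    by (subst nn_integral_distr) (auto simp: add.commute)
  finally show ?thesis by simp
qed

(* The usual uniqueness argument for Haar measure: both sides are translation invariant and
   agree on the unit ball. *)
lemma nn_integral_lborel_orthogonal:
  fixes T :: "'a::euclidean_space \<Rightarrow> 'a"
  assumes T: "orthogonal_transformation T" and [measurable]: "f \<in> borel_measurable borel"
  shows "(\<integral>\<^sup>+x. f (T x) \<partial>lborel) = (\<integral>\<^sup>+x. f x \<partial>lborel)"
proof -
  have lin: "linear T" using T by (rule orthogonal_transformation_linear)
  have [measurable]: "T \<in> borel_measurable borel"
    using lin by (intro borel_measurable_continuous_onI linear_continuous_on linear_conv_bounded_linear[THEN iffD1])
  obtain S where S: "\<And>y. T (S y) = y"
    using orthogonal_transformation_surj[OF T] by (metis surjD)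
  define g :: "'a \<Rightarrow> ennreal" where "g = indicator (ball 0 1)"
  define v where "v = emeasure lborel (ball (0::'a) 1)"
  have [measurable]: "g \<in> borel_measurable borel" unfolding g_def by (intro borel_measurable_indicator) simp
  have gv: "(\<integral>\<^sup>+x. g x \<partial>lborel) = v" by (simp add: g_def v_def)
  have v0: "v \<noteq> 0" "v \<noteq> \<infinity>"
    using emeasure_lborel_ball_finite[of "0::'a" 1] content_ball_pos[of 1 "0::'a"]
    by (auto simp: v_def measure_def)
  have tr: "(\<integral>\<^sup>+x. f (T x) \<partial>lborel) = (\<integral>\<^sup>+x. f (T x + y) \<partial>lborel)" for y
  proof -
    have "(\<integral>\<^sup>+x. f (T x + y) \<partial>lborel) = (\<integral>\<^sup>+x. f (T (x + S y)) \<partial>lborel)"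
      using lin by (simp add: linear_add S)
    also have "\<dots> = (\<integral>\<^sup>+x. f (T x) \<partial>lborel)"
      by (rule nn_integral_lborel_translate) measurable
    finally show ?thesis by simp
  qed
  have inner: "(\<integral>\<^sup>+x. g (y - T x) \<partial>lborel) = v" for y
  proof -
    have "g (y - T x) = g (x + (- S y))" for x
    proof -
      have "y - T x = T (S y - x)" using lin by (simp add: linear_diff S)
      then have "norm (y - T x) = norm (S y - x)" using T by (simp add: orthogonal_transformation_norm)
      then show ?thesis by (simp add: g_def indicator_def norm_minus_commute)
    qed
    then show ?thesis by (simp add: nn_integral_lborel_translate gv del: add_uminus_conv_diff)
  qed
  have "(\<integral>\<^sup>+x. f (T x) \<partial>lborel) * v = (\<integral>\<^sup>+y. (\<integral>\<^sup>+x. f (T x + y) \<partial>lborel) * g y \<partial>lborel)"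
    unfolding tr[symmetric] by (subst nn_integral_cmult) (auto simp: gv)
  also have "\<dots> = (\<integral>\<^sup>+y. (\<integral>\<^sup>+x. f (T x + y) * g y \<partial>lborel) \<partial>lborel)"
    by (simp add: nn_integral_multc)
  also have "\<dots> = (\<integral>\<^sup>+x. (\<integral>\<^sup>+y. f (T x + y) * g y \<partial>lborel) \<partial>lborel)"
    by (rule lborel_pair.Fubini') measurable
  also have "\<dots> = (\<integral>\<^sup>+x. (\<integral>\<^sup>+y. f y * g (y - T x) \<partial>lborel) \<partial>lborel)"
  proof (rule nn_integral_cong)
    fix x
    have "(\<integral>\<^sup>+y. (\<lambda>y. f y * g (y - T x)) (y + T x) \<partial>lborel) = (\<integral>\<^sup>+y. (\<lambda>y. f y * g (y - T x)) y \<partial>lborel)"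
      by (rule nn_integral_lborel_translate) measurable
    then show "(\<integral>\<^sup>+y. f (T x + y) * g y \<partial>lborel) = (\<integral>\<^sup>+y. f y * g (y - T x) \<partial>lborel)"
      by (simp add: add.commute)
  qed
  also have "\<dots> = (\<integral>\<^sup>+y. (\<integral>\<^sup>+x. f y * g (y - T x) \<partial>lborel) \<partial>lborel)"
    by (rule lborel_pair.Fubini') measurable
  also have "\<dots> = (\<integral>\<^sup>+y. f y * v \<partial>lborel)"
    by (simp add: nn_integral_cmult inner)
  also have "\<dots> = (\<integral>\<^sup>+y. f y \<partial>lborel) * v"
    by (simp add: nn_integral_multc)
  finally have "(\<integral>\<^sup>+x. f (T x) \<partial>lborel) * v / v = (\<integral>\<^sup>+y. f y \<partial>lborel) * v / v" by simp
  then show ?thesis using v0 by (simp add: ennreal_mult_divide_eq)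
qed

lemma nn_integral_power_Icc:
  assumes "z \<le> (\<rho>::real)"
  shows "(\<integral>\<^sup>+\<tau>. ennreal ((\<tau> - z) ^ a) * indicator {z..\<rho>} \<tau> \<partial>lborel) = ennreal ((\<rho> - z) ^ Suc a / Suc a)"
proof -
  have "(\<integral>\<^sup>+\<tau>. ennreal ((\<tau> - z) ^ a) * indicator {z..\<rho>} \<tau> \<partial>lborel)
     = ennreal ((\<rho> - z) ^ Suc a / Suc a - (z - z) ^ Suc a / Suc a)"
  proof (rule nn_integral_FTC_Icc)
    show "((\<lambda>\<tau>. (\<tau> - z) ^ Suc a / Suc a) has_real_derivative (x - z) ^ a) (at x)" for x
      by (auto intro!: derivative_eq_intros simp del: of_nat_Suc power_Suc) 
  qed (use assms in auto)
  then show ?thesis by simp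
qed

text \<open>For exponent 0 this is the volume of a ball of radius \<open>sqrt \<rho>\<close> in the
  even dimension \<open>2 * q\<close>, a multiple of \<open>\<rho> ^ q\<close>. The step writes
  \<open>(\<rho> - Z) ^ (a + 1)\<close> as \<open>a + 1\<close> times the integral of
  \<open>(\<tau> - Z) ^ a\<close> over \<open>Z \<le> \<tau> \<le> \<rho>\<close> and exchanges the
  integrals.\<close>

lemma ball_power_integral_PiM:
  assumes D: "finite D" "card D = 2 * q"
  shows "\<exists>c>0. \<forall>\<rho>>0. (\<integral>\<^sup>+y. ennreal ((\<rho> - (\<Sum>b\<in>D. (y b)\<^sup>2)) ^ a) * indicator {..\<rho>} (\<Sum>b\<in>D. (y b)\<^sup>2) \<partial>Pi\<^sub>M D (\<lambda>_. lborel))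
     = ennreal (c * \<rho> ^ (a + q))"
proof (induction a)
  case 0
  define c where "c = unit_ball_vol (real (card D))"
  have "(\<integral>\<^sup>+y. ennreal ((\<rho> - (\<Sum>b\<in>D. (y b)\<^sup>2)) ^ 0) * indicator {..\<rho>} (\<Sum>b\<in>D. (y b)\<^sup>2) \<partial>Pi\<^sub>M D (\<lambda>_. lborel))
     = ennreal (c * \<rho> ^ (0 + q))" if \<rho>: "\<rho> > 0" for \<rho>
  proof -
    let ?S = "{f. sqrt (\<Sum>i\<in>D. (f i)\<^sup>2) \<le> sqrt \<rho>} \<inter> space (Pi\<^sub>M D (\<lambda>_. lborel))"
    have m: "?S \<in> sets (Pi\<^sub>M D (\<lambda>_. lborel))"
    proof -
      have "(\<lambda>f. sqrt (\<Sum>i\<in>D. (f i)\<^sup>2)) \<in> borel_measurable (Pi\<^sub>M D (\<lambda>_. lborel))"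
        by measurable
      then have "(\<lambda>f. sqrt (\<Sum>i\<in>D. (f i)\<^sup>2)) -` {..sqrt \<rho>} \<inter> space (Pi\<^sub>M D (\<lambda>_. lborel)) \<in> sets (Pi\<^sub>M D (\<lambda>_. lborel))"
        by (rule measurable_sets) simp
      then show ?thesis by (simp add: vimage_def)
    qed
    have "(\<integral>\<^sup>+y. ennreal ((\<rho> - (\<Sum>b\<in>D. (y b)\<^sup>2)) ^ 0) * indicator {..\<rho>} (\<Sum>b\<in>D. (y b)\<^sup>2) \<partial>Pi\<^sub>M D (\<lambda>_. lborel))
       = (\<integral>\<^sup>+y. indicator ?S y \<partial>Pi\<^sub>M D (\<lambda>_. lborel))"
      by (rule nn_integral_cong) (auto simp: indicator_def)
    also have "\<dots> = emeasure (Pi\<^sub>M D (\<lambda>_. lborel)) ?S" using m by simp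
    also have "\<dots> = ennreal (c * sqrt \<rho> ^ card D)"
      using emeasure_cball_aux[OF D(1), of "sqrt \<rho>"] \<rho> by (simp add: c_def)
    also have "sqrt \<rho> ^ card D = \<rho> ^ q" using \<rho> by (simp add: D(2) power_mult)
    finally show ?thesis by simp
  qed
  moreover have "c > 0" by (simp add: c_def)
  ultimately show ?case by blast
next
  case (Suc a)
  then obtain c where c: "c > 0" "\<And>\<rho>. \<rho> > 0 \<Longrightarrow> (\<integral>\<^sup>+y. ennreal ((\<rho> - (\<Sum>b\<in>D. (y b)\<^sup>2)) ^ a) * indicator {..\<rho>} (\<Sum>b\<in>D. (y b)\<^sup>2) \<partial>Pi\<^sub>M D (\<lambda>_. lborel))
     = ennreal (c * \<rho> ^ (a + q))" by blast
  define Z where "Z y = (\<Sum>b\<in>D. (y b :: real)\<^sup>2)" for y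
  interpret product_sigma_finite "\<lambda>_. lborel :: real measure" by standard
  interpret P: sigma_finite_measure "Pi\<^sub>M D (\<lambda>_. lborel :: real measure)"
    by (rule sigma_finite) (rule D)
  interpret Q: pair_sigma_finite "Pi\<^sub>M D (\<lambda>_. lborel :: real measure)" "lborel :: real measure" ..
  have Zm [measurable]: "Z \<in> borel_measurable (Pi\<^sub>M D (\<lambda>_. lborel))" unfolding Z_def by measurable
  have Z0: "Z y \<ge> 0" for y by (simp add: Z_def sum_nonneg)
  show ?case
  proof (intro exI[of _ "c * Suc a / Suc (a + q)"] conjI allI impI)
    show "0 < c * Suc a / Suc (a + q)" using c by simp
    fix \<rho> :: real assume \<rho>: "\<rho> > 0"
    have "(\<integral>\<^sup>+y. ennreal ((\<rho> - Z y) ^ Suc a) * indicator {..\<rho>} (Z y) \<partial>Pi\<^sub>M D (\<lambda>_. lborel))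
       = (\<integral>\<^sup>+y. (\<integral>\<^sup>+\<tau>. ennreal (Suc a) * (ennreal ((\<tau> - Z y) ^ a) * indicator {..\<tau>} (Z y) * indicator {0..\<rho>} \<tau>) \<partial>lborel) \<partial>Pi\<^sub>M D (\<lambda>_. lborel))"
    proof (rule nn_integral_cong)
      fix y
      have "(\<integral>\<^sup>+\<tau>. ennreal (Suc a) * (ennreal ((\<tau> - Z y) ^ a) * indicator {..\<tau>} (Z y) * indicator {0..\<rho>} \<tau>) \<partial>lborel)
        = ennreal (Suc a) * (\<integral>\<^sup>+\<tau>. (ennreal ((\<tau> - Z y) ^ a) * indicator {Z y..\<rho>} \<tau>) \<partial>lborel)"
        using Z0[of y] by (subst nn_integral_cmult[symmetric]) (auto intro!: nn_integral_cong simp: indicator_def)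
      also have "\<dots> = ennreal ((\<rho> - Z y) ^ Suc a) * indicator {..\<rho>} (Z y)"
      proof (cases "Z y \<le> \<rho>")
        case True
        then show ?thesis
          by (simp add: nn_integral_power_Icc ennreal_mult'[symmetric] del: power_Suc of_nat_Suc)
      qed (auto simp: indicator_def)
      finally show "ennreal ((\<rho> - Z y) ^ Suc a) * indicator {..\<rho>} (Z y) =
         (\<integral>\<^sup>+\<tau>. ennreal (Suc a) * (ennreal ((\<tau> - Z y) ^ a) * indicator {..\<tau>} (Z y) * indicator {0..\<rho>} \<tau>) \<partial>lborel)" by simp
    qed
    also have "\<dots> = (\<integral>\<^sup>+\<tau>. (\<integral>\<^sup>+y. ennreal (Suc a) * (ennreal ((\<tau> - Z y) ^ a) * indicator {..\<tau>} (Z y) * indicator {0..\<rho>} \<tau>) \<partial>Pi\<^sub>M D (\<lambda>_. lborel)) \<partial>lborel)"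
    proof (rule Q.Fubini'[symmetric])
      have [measurable]: "(\<lambda>x. indicator {..snd x} (Z (fst x)) :: ennreal) \<in> borel_measurable (Pi\<^sub>M D (\<lambda>_. lborel) \<Otimes>\<^sub>M lborel)"
        unfolding indicator_def atMost_iff by measurable
      show "case_prod (\<lambda>y \<tau>. ennreal (Suc a) * (ennreal ((\<tau> - Z y) ^ a) * indicator {..\<tau>} (Z y) * indicator {0..\<rho>} \<tau>)) \<in> borel_measurable (Pi\<^sub>M D (\<lambda>_. lborel) \<Otimes>\<^sub>M lborel)"
        unfolding case_prod_beta by measurable
    qed
    also have "\<dots> = (\<integral>\<^sup>+\<tau>. ennreal (Suc a * c) * (ennreal ((\<tau> - 0) ^ (a + q)) * indicator {0..\<rho>} \<tau>) \<partial>lborel)"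
    proof (rule nn_integral_cong_AE)
      \<comment> \<open>The induction hypothesis covers positive radii only, so \<tau> = 0 is
        discarded as a null set.\<close>
      have "AE \<tau> in lborel. \<tau> \<noteq> (0::real)" by (rule AE_lborel_singleton)
      then show "AE \<tau> in lborel. (\<integral>\<^sup>+y. ennreal (Suc a) * (ennreal ((\<tau> - Z y) ^ a) * indicator {..\<tau>} (Z y) * indicator {0..\<rho>} \<tau>) \<partial>Pi\<^sub>M D (\<lambda>_. lborel))
          = ennreal (Suc a * c) * (ennreal ((\<tau> - 0) ^ (a + q)) * indicator {0..\<rho>} \<tau>)"
      proof eventually_elim
        case (elim \<tau>)
        show ?case
        proof (cases "\<tau> \<in> {0..\<rho>}")
          case True
          then have t: "\<tau> > 0" using elim by auto
          have [measurable]: "(\<lambda>y. ennreal ((\<tau> - Z y) ^ a) * indicator {..\<tau>} (Z y)) \<in> borel_measurable (Pi\<^sub>M D (\<lambda>_. lborel))"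
            by measurable
          have "(\<integral>\<^sup>+y. ennreal (Suc a) * (ennreal ((\<tau> - Z y) ^ a) * indicator {..\<tau>} (Z y) * indicator {0..\<rho>} \<tau>) \<partial>Pi\<^sub>M D (\<lambda>_. lborel))
             = ennreal (Suc a) * (\<integral>\<^sup>+y. ennreal ((\<tau> - Z y) ^ a) * indicator {..\<tau>} (Z y) \<partial>Pi\<^sub>M D (\<lambda>_. lborel))"
            using True by (subst nn_integral_cmult[symmetric]) auto
          also have "\<dots> = ennreal (Suc a) * ennreal (c * \<tau> ^ (a + q))"
            using c(2)[OF t] by (simp add: Z_def)
          finally show ?thesis using True t c(1) by (simp add: ennreal_mult'[symmetric] mult.assoc del: of_nat_Suc)
        qed auto
      qed
    qed
    also have "\<dots> = ennreal (Suc a * c) * ennreal ((\<rho> - 0) ^ Suc (a + q) / Suc (a + q))"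
      using \<rho> nn_integral_power_Icc[of 0 \<rho> "a+q"] by (subst nn_integral_cmult) auto
    also have "\<dots> = ennreal (c * Suc a / Suc (a + q) * \<rho> ^ (Suc a + q))"
      using c(1) \<rho> by (subst ennreal_mult'[symmetric]) (auto simp: field_simps simp del: of_nat_Suc)
    finally show "(\<integral>\<^sup>+y. ennreal ((\<rho> - (\<Sum>b\<in>D. (y b)\<^sup>2)) ^ Suc a) * indicator {..\<rho>} (\<Sum>b\<in>D. (y b)\<^sup>2) \<partial>Pi\<^sub>M D (\<lambda>_. lborel))
      = ennreal (c * Suc a / Suc (a + q) * \<rho> ^ (Suc a + q))" by (simp add: Z_def)
  qed
qed

lemma nn_integral_split_Basis:
  fixes e :: "'a::euclidean_space" and f :: "real \<times> real \<Rightarrow> ennreal"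
  assumes e: "e \<in> Basis" and [measurable]: "f \<in> borel_measurable borel"
  shows "(\<integral>\<^sup>+x. f (e \<bullet> x, (norm x)\<^sup>2) \<partial>(lborel :: 'a measure)) =
    (\<integral>\<^sup>+t. (\<integral>\<^sup>+y. f (t, t\<^sup>2 + (\<Sum>b\<in>Basis - {e}. (y b)\<^sup>2)) \<partial>Pi\<^sub>M (Basis - {e}) (\<lambda>_. lborel)) \<partial>lborel)"
proof -
  interpret product_sigma_finite "\<lambda>_ :: 'a. lborel :: real measure" by standard
  have B: "insert e (Basis - {e}) = (Basis :: 'a set)" using e by auto
  have [measurable]: "f \<in> borel_measurable (borel \<Otimes>\<^sub>M borel)" by (simp add: borel_prod)
  have *: "e \<bullet> (\<Sum>b\<in>Basis. y b *\<^sub>R b) = y e" for y :: "'a \<Rightarrow> real"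
    using e by (simp add: inner_sum_right inner_Basis if_distrib cong: if_cong)
  have n: "(norm (\<Sum>b\<in>Basis. y b *\<^sub>R b))\<^sup>2 = (\<Sum>b\<in>Basis. (y b)\<^sup>2)" for y :: "'a \<Rightarrow> real"
  proof -
    have "(\<Sum>b\<in>Basis. y b *\<^sub>R b) \<bullet> u = y u" if "u \<in> Basis" for u
      using that by (simp add: inner_sum_left inner_Basis if_distrib cong: if_cong)
    then show ?thesis
      by (subst power2_norm_eq_inner, subst euclidean_inner, intro sum.cong) (simp_all add: power2_eq_square)
  qed
  have "(\<integral>\<^sup>+x. f (e \<bullet> x, (norm x)\<^sup>2) \<partial>(lborel :: 'a measure)) =
     (\<integral>\<^sup>+y. f (y e, \<Sum>b\<in>Basis. (y b)\<^sup>2) \<partial>Pi\<^sub>M Basis (\<lambda>_::'a. lborel))"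
    by (subst lborel_eq, subst nn_integral_distr) (simp_all add: * n)
  also have "\<dots> = (\<integral>\<^sup>+y. f (y e, \<Sum>b\<in>Basis. (y b)\<^sup>2) \<partial>Pi\<^sub>M (insert e (Basis - {e})) (\<lambda>_::'a. lborel))"
    by (simp only: B)
  also have "\<dots> = (\<integral>\<^sup>+t. (\<integral>\<^sup>+y. f ((y(e := t)) e, \<Sum>b\<in>Basis. ((y(e := t)) b)\<^sup>2) \<partial>Pi\<^sub>M (Basis - {e}) (\<lambda>_. lborel)) \<partial>lborel)"
  proof (rule product_nn_integral_insert_rev)
    have comp: "(\<lambda>y. y b) \<in> borel_measurable (Pi\<^sub>M Basis (\<lambda>_::'a. lborel :: real measure))" if "b \<in> Basis" for b
      using measurable_component_singleton[OF that, of "\<lambda>_. lborel :: real measure"] by simp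
    have [measurable]: "(\<lambda>y. y e) \<in> borel_measurable (Pi\<^sub>M Basis (\<lambda>_::'a. lborel :: real measure))"
      "(\<lambda>y. \<Sum>b\<in>Basis. (y b)\<^sup>2) \<in> borel_measurable (Pi\<^sub>M Basis (\<lambda>_::'a. lborel :: real measure))"
      by (intro borel_measurable_sum borel_measurable_power comp e; assumption)+
    show "(\<lambda>y. f (y e, \<Sum>b\<in>Basis. (y b)\<^sup>2)) \<in> borel_measurable (Pi\<^sub>M (insert e (Basis - {e})) (\<lambda>_. lborel))"
      unfolding B by measurable
  qed simp_all
  also have "\<dots> = (\<integral>\<^sup>+t. (\<integral>\<^sup>+y. f (t, t\<^sup>2 + (\<Sum>b\<in>Basis - {e}. (y b)\<^sup>2)) \<partial>Pi\<^sub>M (Basis - {e}) (\<lambda>_. lborel)) \<partial>lborel)"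
  proof (intro nn_integral_cong)
    fix t :: real and y :: "'a \<Rightarrow> real"
    have "(\<Sum>b\<in>Basis. ((y(e := t)) b)\<^sup>2) = (\<Sum>b\<in>insert e (Basis - {e}). ((y(e := t)) b)\<^sup>2)"
      by (simp only: B)
    also have "\<dots> = t\<^sup>2 + (\<Sum>b\<in>Basis - {e}. ((y(e := t)) b)\<^sup>2)"
      by (subst sum.insert) auto
    also have "(\<Sum>b\<in>Basis - {e}. ((y(e := t)) b)\<^sup>2) = (\<Sum>b\<in>Basis - {e}. (y b)\<^sup>2)"
      by (rule sum.cong) auto
    finally show "f ((y(e := t)) e, \<Sum>b\<in>Basis. ((y(e := t)) b)\<^sup>2) = f (t, t\<^sup>2 + (\<Sum>b\<in>Basis - {e}. (y b)\<^sup>2))"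
      by simp
  qed
  finally show ?thesis .
qed

text \<open>An orthogonal map carries a coordinate vector to \<theta>. The slice at height
  \<open>t\<close> is then a ball of squared radius \<open>R\<^sup>2 - t\<^sup>2\<close> in
  dimension \<open>2 * q\<close>, and integrating over it raises the exponent \<open>a\<close> to
  \<open>a + q\<close>. The constant depends neither on \<open>R\<close> nor on \<theta>, which
  later allows the coefficients of a radial polynomial to be divided by it.\<close>

lemma ball_marginal:
  assumes n: "CARD('n::finite) = 2 * q + 1"
  shows "\<exists>c>0. \<forall>R>0. \<forall>\<theta>::real^'n. norm \<theta> = 1 \<longrightarrow>
    distr (density lborel (\<lambda>x. ennreal ((R\<^sup>2 - (norm x)\<^sup>2) ^ a) * indicator (cball 0 R) x)) borel (\<lambda>x. \<theta> \<bullet> x)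
    = density lborel (\<lambda>t. ennreal (c * (R\<^sup>2 - t\<^sup>2) ^ (a + q)) * indicator {-R..R} t)"
proof -
  obtain e :: "real^'n" where e: "e \<in> Basis" using nonempty_Basis by blast
  define D where "D = Basis - {e}"
  have D: "finite D" "card D = 2 * q" using e n by (auto simp: D_def)
  obtain c where c: "c > 0" "\<And>\<rho>. \<rho> > 0 \<Longrightarrow> (\<integral>\<^sup>+y. ennreal ((\<rho> - (\<Sum>b\<in>D. (y b)\<^sup>2)) ^ a) * indicator {..\<rho>} (\<Sum>b\<in>D. (y b)\<^sup>2) \<partial>Pi\<^sub>M D (\<lambda>_. lborel))
     = ennreal (c * \<rho> ^ (a + q))" using ball_power_integral_PiM[OF D, of a] by blast
  show ?thesis
  proof (intro exI[of _ c] conjI allI impI)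
    fix R :: real and \<theta> :: "real^'n"
    assume R: "R > 0" and th: "norm \<theta> = 1"
    obtain T where T: "orthogonal_transformation T" "T e = \<theta>"
      using orthogonal_transformation_exists_1[of e \<theta>] th e by auto
    let ?\<mu> = "density lborel (\<lambda>x::real^'n. ennreal ((R\<^sup>2 - (norm x)\<^sup>2) ^ a) * indicator (cball 0 R) x)"
    have [measurable]: "cball (0::real^'n) R \<in> sets borel" by simp
    show "distr ?\<mu> borel (\<lambda>x. \<theta> \<bullet> x) = density lborel (\<lambda>t. ennreal (c * (R\<^sup>2 - t\<^sup>2) ^ (a + q)) * indicator {-R..R} t)"
    proof (rule measure_eqI)
      fix A assume "A \<in> sets (distr ?\<mu> borel (\<lambda>x. \<theta> \<bullet> x))"
      then have A [measurable]: "A \<in> sets borel" by simp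
      define F :: "real \<times> real \<Rightarrow> ennreal" where
        "F p = ennreal ((R\<^sup>2 - snd p) ^ a) * indicator {..R\<^sup>2} (snd p) * indicator A (fst p)" for p
      have F [measurable]: "F \<in> borel_measurable borel"
        unfolding F_def borel_prod[symmetric] by measurable
      have "emeasure (distr ?\<mu> borel (\<lambda>x. \<theta> \<bullet> x)) A = emeasure ?\<mu> ((\<lambda>x. \<theta> \<bullet> x) -` A)"
        by (subst emeasure_distr) auto
      also have "\<dots> = (\<integral>\<^sup>+x. ennreal ((R\<^sup>2 - (norm x)\<^sup>2) ^ a) * indicator (cball 0 R) x * indicator ((\<lambda>x. \<theta> \<bullet> x) -` A) x \<partial>lborel)"
      proof (rule emeasure_density)
        have "(\<lambda>x. \<theta> \<bullet> x) -` A \<inter> space borel \<in> sets borel" by (rule measurable_sets[OF _ A]) simp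
        then show "(\<lambda>x. \<theta> \<bullet> x) -` A \<in> sets lborel" by simp
      qed measurable
      also have "\<dots> = (\<integral>\<^sup>+x. F (\<theta> \<bullet> x, (norm x)\<^sup>2) \<partial>lborel)"
      proof (rule nn_integral_cong)
        fix x :: "real^'n"
        have "norm x \<le> R \<longleftrightarrow> (norm x)\<^sup>2 \<le> R\<^sup>2" using R by (simp add: power2_le_iff_abs_le)
        then show "ennreal ((R\<^sup>2 - (norm x)\<^sup>2) ^ a) * indicator (cball 0 R) x * indicator ((\<lambda>x. \<theta> \<bullet> x) -` A) x = F (\<theta> \<bullet> x, (norm x)\<^sup>2)"
          by (auto simp: F_def indicator_def)
      qed
      also have "\<dots> = (\<integral>\<^sup>+x. F (\<theta> \<bullet> T x, (norm (T x))\<^sup>2) \<partial>lborel)"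
        by (rule nn_integral_lborel_orthogonal[OF T(1), symmetric]) measurable
      also have "\<dots> = (\<integral>\<^sup>+x. F (e \<bullet> x, (norm x)\<^sup>2) \<partial>lborel)"
        using T(1) unfolding T(2)[symmetric]
        by (simp add: orthogonal_transformation_norm orthogonal_transformation_def)
      also have "\<dots> = (\<integral>\<^sup>+t. (\<integral>\<^sup>+y. F (t, t\<^sup>2 + (\<Sum>b\<in>D. (y b)\<^sup>2)) \<partial>Pi\<^sub>M D (\<lambda>_. lborel)) \<partial>lborel)"
        unfolding D_def by (rule nn_integral_split_Basis[OF e F])
      also have "\<dots> = (\<integral>\<^sup>+t. ennreal (c * (R\<^sup>2 - t\<^sup>2) ^ (a + q)) * indicator {-R..R} t * indicator A t \<partial>lborel)"
      proof (rule nn_integral_cong_AE)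
        have "AE t in lborel. t \<noteq> R \<and> t \<noteq> -R"
          using AE_lborel_singleton[of R] AE_lborel_singleton[of "-R"] by eventually_elim auto
        then show "AE t in lborel. (\<integral>\<^sup>+y. F (t, t\<^sup>2 + (\<Sum>b\<in>D. (y b)\<^sup>2)) \<partial>Pi\<^sub>M D (\<lambda>_. lborel)) =
           ennreal (c * (R\<^sup>2 - t\<^sup>2) ^ (a + q)) * indicator {-R..R} t * indicator A t"
        proof eventually_elim
          case (elim t)
          have eq: "F (t, t\<^sup>2 + z) = indicator A t * (ennreal ((R\<^sup>2 - t\<^sup>2 - z) ^ a) * indicator {..R\<^sup>2 - t\<^sup>2} z)" for z
            by (auto simp: F_def indicator_def algebra_simps)
          show ?case
          proof (cases "t \<in> {-R..R}")
            case True
            then have "\<bar>t\<bar> < R" using elim by auto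
            then have "\<bar>t\<bar>\<^sup>2 < R\<^sup>2" by (intro power_strict_mono) auto
            then have p: "R\<^sup>2 - t\<^sup>2 > 0" unfolding power2_abs by linarith
            have "(\<integral>\<^sup>+y. F (t, t\<^sup>2 + (\<Sum>b\<in>D. (y b)\<^sup>2)) \<partial>Pi\<^sub>M D (\<lambda>_. lborel)) = indicator A t * ennreal (c * (R\<^sup>2 - t\<^sup>2) ^ (a + q))"
              unfolding eq by (subst nn_integral_cmult) (auto simp: c(2)[OF p])
            then show ?thesis using True by (simp add: mult.commute)
          next
            case False
            then have "R < \<bar>t\<bar>" by auto
            then have "R\<^sup>2 < \<bar>t\<bar>\<^sup>2" using R by (intro power_strict_mono) auto
            then have "R\<^sup>2 < t\<^sup>2" unfolding power2_abs .
            then have "F (t, t\<^sup>2 + (\<Sum>b\<in>D. (y b)\<^sup>2)) = 0" for y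
              using sum_nonneg[of D "\<lambda>b. (y b)\<^sup>2"] by (auto simp: F_def indicator_def)
            then show ?thesis using False by simp
          qed
        qed
      qed
      also have "\<dots> = emeasure (density lborel (\<lambda>t. ennreal (c * (R\<^sup>2 - t\<^sup>2) ^ (a + q)) * indicator {-R..R} t)) A"
        by (subst emeasure_density) auto
      finally show "emeasure (distr ?\<mu> borel (\<lambda>x. \<theta> \<bullet> x)) A = emeasure (density lborel (\<lambda>t. ennreal (c * (R\<^sup>2 - t\<^sup>2) ^ (a + q)) * indicator {-R..R} t)) A" .
    qed simp
  qed (rule c(1))
qed

text \<open>Equality of the measures serves all measurable test functions at once: where one side is
  not integrable, neither is the other, and both take the default value 0.\<close>

lemma ball_marginal_integral:
  assumes n: "CARD('n::finite) = 2 * q + 1"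
  shows "\<exists>c>0. \<forall>R>0. \<forall>\<theta>::real^'n. norm \<theta> = 1 \<longrightarrow> (\<forall>h::real \<Rightarrow> real. h \<in> borel_measurable borel \<longrightarrow>
    (LINT x:cball 0 R|lborel. (R\<^sup>2 - (norm x)\<^sup>2) ^ a * h (\<theta> \<bullet> x))
    = c * (LINT t:{-R..R}|lborel. (R\<^sup>2 - t\<^sup>2) ^ (a + q) * h t))"
proof -
  obtain c where c: "c > 0" "\<And>R \<theta>::real^'n. R > 0 \<Longrightarrow> norm \<theta> = 1 \<Longrightarrow>
    distr (density lborel (\<lambda>x. ennreal ((R\<^sup>2 - (norm x)\<^sup>2) ^ a) * indicator (cball 0 R) x)) borel (\<lambda>x. \<theta> \<bullet> x)
    = density lborel (\<lambda>t. ennreal (c * (R\<^sup>2 - t\<^sup>2) ^ (a + q)) * indicator {-R..R} t)"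
    using ball_marginal[OF n, of a] by blast
  show ?thesis
  proof (intro exI[of _ c] conjI allI impI)
    fix R :: real and \<theta> :: "real^'n" and h :: "real \<Rightarrow> real"
    assume R: "R > 0" and th: "norm \<theta> = 1" and [measurable]: "h \<in> borel_measurable borel"
    have [measurable]: "cball (0::real^'n) R \<in> sets borel" by simp
    have w0: "0 \<le> (R\<^sup>2 - (norm x)\<^sup>2) ^ a * indicator (cball 0 R) x" for x :: "real^'n"
      using R by (auto simp: indicator_def power2_le_iff_abs_le intro!: zero_le_power)
    have w1: "0 \<le> c * (R\<^sup>2 - t\<^sup>2) ^ (a + q) * indicator {-R..R} t" for t :: real
      using R c(1) by (auto simp: indicator_def power2_le_iff_abs_le intro!: mult_nonneg_nonneg zero_le_power)
    have "(LINT x|lborel. ((R\<^sup>2 - (norm x)\<^sup>2) ^ a * indicator (cball 0 R) x) *\<^sub>R h (\<theta> \<bullet> x))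
      = (LINT x|density lborel (\<lambda>x. ennreal ((R\<^sup>2 - (norm x)\<^sup>2) ^ a * indicator (cball 0 R) x)). h (\<theta> \<bullet> x))"
      using w0 by (intro integral_density[symmetric]) auto
    also have "(\<lambda>x::real^'n. ennreal ((R\<^sup>2 - (norm x)\<^sup>2) ^ a * indicator (cball 0 R) x)) = (\<lambda>x. ennreal ((R\<^sup>2 - (norm x)\<^sup>2) ^ a) * indicator (cball 0 R) x)"
      by (auto simp: indicator_def)
    also have "(LINT x|density lborel \<dots>. h (\<theta> \<bullet> x)) =
       (LINT t|distr (density lborel (\<lambda>x. ennreal ((R\<^sup>2 - (norm x)\<^sup>2) ^ a) * indicator (cball 0 R) x)) borel (\<lambda>x. \<theta> \<bullet> x). h t)"
      by (subst integral_distr) auto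
    also have "\<dots> = (LINT t|density lborel (\<lambda>t. ennreal (c * (R\<^sup>2 - t\<^sup>2) ^ (a + q)) * indicator {-R..R} t). h t)"
      using c(2)[OF R th] by simp
    also have "(\<lambda>t. ennreal (c * (R\<^sup>2 - t\<^sup>2) ^ (a + q)) * indicator {-R..R} t) = (\<lambda>t. ennreal (c * (R\<^sup>2 - t\<^sup>2) ^ (a + q) * indicator {-R..R} t))"
      by (auto simp: indicator_def)
    also have "(LINT t|density lborel \<dots>. h t) = (LINT t|lborel. (c * (R\<^sup>2 - t\<^sup>2) ^ (a + q) * indicator {-R..R} t) *\<^sub>R h t)"
      using w1 by (intro integral_density) auto
    finally show "(LINT x:cball 0 R|lborel. (R\<^sup>2 - (norm x)\<^sup>2) ^ a * h (\<theta> \<bullet> x))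
      = c * (LINT t:{-R..R}|lborel. (R\<^sup>2 - t\<^sup>2) ^ (a + q) * h t)"
      unfolding set_lebesgue_integral_def
      by (subst integral_mult_right_zero[symmetric]) (simp add: mult_ac)
  qed (rule c(1))
qed

section \<open>One-dimensional potentials\<close>

lemma discriminant_le:
  fixes a b c :: real
  assumes pos: "\<And>x y. 0 \<le> x\<^sup>2 * a + 2 * x * y * b + y\<^sup>2 * c"
  shows "b\<^sup>2 \<le> a * c"
proof (cases "a = 0")
  case True
  have "b = 0"
  proof (rule ccontr)
    assume "b \<noteq> 0"
    \<comment> \<open>At this point, with \<open>a = 0\<close> and \<open>y = 1\<close>, the
      quadratic form equals \<open>-1\<close>.\<close>
    then show False using pos[of "- (c + 1) / (2 * b)" 1] True by (simp add: field_simps)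
  qed
  then show ?thesis using True by simp
next
  case False
  have "a \<ge> 0" using pos[of 1 0] by simp
  with False have "a > 0" by simp
  have "0 \<le> a * (a * c - b\<^sup>2)" using pos[of "-b" a] by (simp add: power2_eq_square algebra_simps)
  then show ?thesis using \<open>a > 0\<close> by (simp add: zero_le_mult_iff)
qed

definition radial_kernel :: "nat \<Rightarrow> real \<Rightarrow> real" where
  "radial_kernel q t = poly (radial_poly q) \<bar>t\<bar> * exp (- \<bar>t\<bar>)"

lemma continuous_on_radial_kernel [continuous_intros]:
  "continuous_on A f \<Longrightarrow> continuous_on A (\<lambda>x. radial_kernel q (f x))"
  unfolding radial_kernel_def by (intro continuous_intros)

lemma borel_measurable_radial_kernel [measurable]: "radial_kernel q \<in> borel_measurable borel"
  by (intro borel_measurable_continuous_onI continuous_on_radial_kernel continuous_on_id)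

lemma radial_kernel_minus_commute: "radial_kernel q (x - y) = radial_kernel q (y - x)"
  by (simp add: radial_kernel_def abs_minus_commute)

lemma radial_kernel_bounded: "\<exists>C\<ge>0. \<forall>t. \<bar>radial_kernel q t\<bar> \<le> C"
proof -
  obtain C :: real where C: "C \<ge> 0" "\<And>s. s \<ge> 0 \<Longrightarrow> \<bar>poly (radial_poly q) s\<bar> \<le> C * exp s"
    using abs_poly_le_exp[of 1 "radial_poly q"] by auto
  have "\<bar>radial_kernel q t\<bar> \<le> C" for t
  proof -
    have "\<bar>poly (radial_poly q) \<bar>t\<bar>\<bar> * exp (- \<bar>t\<bar>) \<le> C * exp \<bar>t\<bar> * exp (- \<bar>t\<bar>)"
      using C(2)[of "\<bar>t\<bar>"] by (intro mult_right_mono) auto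
    then show ?thesis by (simp add: radial_kernel_def abs_mult mult.assoc exp_add[symmetric])
  qed
  then show ?thesis using C(1) by blast
qed

lemma laplace2_sum: "laplace2 (\<Sum>k\<in>A. f k) = (\<Sum>k\<in>A. laplace2 (f k))"
  by (induction A rule: infinite_finite_induct) (auto simp: laplace2_add laplace2_0)

lemma poly_laplace_corr: "poly (laplace_corr l m) t = laplace2 (l * pcompose m [:t, 1:])"
proof -
  have "pcompose m [:t, 1:] = (\<Sum>k\<le>degree m. smult (t ^ k / fact k) ((pderiv ^^ k) m))"
    by (rule poly_eq_poly_eq_iff[THEN iffD1], rule ext)
      (use poly_taylor[of m "Suc (degree m)"] in \<open>simp add: poly_pcompose poly_sum lessThan_Suc_atMost add.commute\<close>)
  then show ?thesis
    by (simp add: laplace_corr_def poly_sum poly_monom sum_distrib_left laplace2_sum laplace2_smult)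
      (simp add: mult_ac)
qed

text \<open>The factorization is only known to exist, so the locale fixes one; \<kappa> is the scale
  left over by the normalization \<open>l 0 = 1\<close>. The kernel itself does not depend on the
  choice.\<close>

locale radial_feature =
  fixes q :: nat and l :: "real poly" and \<kappa> :: real
  assumes kpos: "\<kappa> > 0" and l0: "coeff l 0 = 1"
    and factorization: "smult \<kappa> (laplace_corr l l) = radial_poly q"
begin

definition \<phi> :: "real \<Rightarrow> real" where
  "\<phi> t = (if t \<ge> 0 then poly l t * exp (- t) else 0)"

lemma measurable_phi [measurable]: "\<phi> \<in> borel_measurable borel"
  unfolding \<phi>_def by (intro measurable_If borel_measurable_continuous_onI continuous_intros) auto

lemma phi_bound: "\<exists>C\<ge>0. \<forall>t. \<bar>\<phi> t\<bar> \<le> C * exp (- (t / 2)) \<and> \<bar>\<phi> t\<bar> \<le> C"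
proof -
  obtain C where C: "C \<ge> 0" "\<And>s. s \<ge> 0 \<Longrightarrow> \<bar>poly l s\<bar> \<le> C * exp (1/2 * s)"
    using abs_poly_le_exp[of "1/2" l] by auto
  have "\<bar>\<phi> t\<bar> \<le> C * exp (- (t / 2)) \<and> \<bar>\<phi> t\<bar> \<le> C" for t
  proof (cases "t \<ge> 0")
    case True
    have "\<bar>poly l t\<bar> * exp (- t) \<le> C * exp (1/2 * t) * exp (- t)"
      using C(2)[OF True] by (intro mult_right_mono) auto
    also have "\<dots> = C * exp (- (t / 2))" by (simp add: mult.assoc exp_add[symmetric])
    finally have 1: "\<bar>\<phi> t\<bar> \<le> C * exp (- (t / 2))" using True by (simp add: \<phi>_def abs_mult)
    also have "\<dots> \<le> C * 1" using True C(1) by (intro mult_left_mono) auto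
    finally show ?thesis using 1 by simp
  qed (use C(1) in \<open>simp add: \<phi>_def\<close>)
  then show ?thesis using C(1) by blast
qed

lemma integrable_exp_tail: "integrable lborel (\<lambda>u. exp (- (u / 2)) * indicator {- B..} u :: real)"
proof -
  have "integrable lborel (\<lambda>s. indicator {0..} s *\<^sub>R exp (- (1/2) * s) :: real)"
    using set_integrable_exp_minus[of "1/2"] by (simp add: set_integrable_def)
  then have "integrable lborel (\<lambda>u. indicator {0..} (B + 1 * u) *\<^sub>R exp (- (1/2) * (B + 1 * u)) :: real)"
    by (rule lborel_integrable_real_affine) simp
  then have "integrable lborel (\<lambda>u. exp (B / 2) * (indicator {0..} (B + 1 * u) *\<^sub>R exp (- (1/2) * (B + 1 * u)) :: real))"
    by (rule integrable_mult_right)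
  moreover have "(\<lambda>u. exp (B / 2) * (indicator {0..} (B + 1 * u) *\<^sub>R exp (- (1/2) * (B + 1 * u)) :: real)) = (\<lambda>u. exp (- (u / 2)) * indicator {- B..} u)"
    by (rule ext) (auto simp: indicator_def exp_add[symmetric] field_simps)
  ultimately show ?thesis by (simp only:)
qed

lemma phi_translate_bound:
  assumes "\<And>t. \<bar>\<phi> t\<bar> \<le> C * exp (- (t / 2))" "\<bar>x\<bar> \<le> B" "C \<ge> 0"
  shows "\<bar>\<phi> (u - x)\<bar> \<le> C * exp (B / 2) * (exp (- (u / 2)) * indicator {- B..} u)"
proof (cases "u \<ge> - B")
  case True
  have "\<bar>\<phi> (u - x)\<bar> \<le> C * exp (- ((u - x) / 2))" by (rule assms(1))
  also have "\<dots> \<le> C * exp (B / 2 - u / 2)" using assms by (intro mult_left_mono) (auto simp: field_simps)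
  finally show ?thesis using True by (simp add: mult.assoc exp_add[symmetric])
next
  case False
  then have "u - x < 0" using assms(2) by auto
  then show ?thesis by (simp add: \<phi>_def assms(3))
qed

lemma integrable_phi_translate: "integrable lborel (\<lambda>u. \<phi> (u - x))"
proof -
  obtain C where C: "C \<ge> 0" "\<And>t. \<bar>\<phi> t\<bar> \<le> C * exp (- (t / 2))" using phi_bound by blast
  show ?thesis
    by (rule Bochner_Integration.integrable_bound[OF integrable_mult_right[OF integrable_exp_tail[of "\<bar>x\<bar>"], of "C * exp (\<bar>x\<bar> / 2)"]])
      (use phi_translate_bound[OF C(2) order_refl C(1)] in \<open>auto intro!: AE_I2 order_trans[OF _ abs_ge_self]\<close>)
qed

lemma phi_correlation_aux:
  assumes "x \<le> y"
  shows "\<kappa> * (LINT u|lborel. \<phi> (u - x) * \<phi> (u - y)) = radial_kernel q (x - y)"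
proof -
  \<comment> \<open>For \<open>x \<le> y\<close> the product lives on \<open>u \<ge> y\<close>, and
    \<open>u = y + s\<close> turns it into a correlation at lag \<open>y - x\<close>.\<close>
  have "(LINT u|lborel. \<phi> (u - x) * \<phi> (u - y)) = (LINT s|lborel. \<phi> (y + 1 * s - x) * \<phi> (y + 1 * s - y))"
    by (subst lborel_integral_real_affine[of 1 _ y]) auto
  also have "\<dots> = (LINT s|lborel. indicator {0..} s *\<^sub>R (exp (- (y - x)) * (poly (l * pcompose l [:y - x, 1:]) s * exp (- 2 * s))))"
    by (rule Bochner_Integration.integral_cong)
      (use assms in \<open>auto simp: \<phi>_def indicator_def poly_pcompose exp_add[symmetric] exp_diff exp_minus field_simps mult_exp_exp\<close>)
  also have "\<dots> = exp (- (y - x)) * laplace2 (l * pcompose l [:y - x, 1:])"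
    by (simp add: laplace2_def set_lebesgue_integral_def mult.left_commute[of _ "exp (x - y)"])
  also have "\<kappa> * \<dots> = exp (- (y - x)) * poly (smult \<kappa> (laplace_corr l l)) (y - x)"
    by (simp add: poly_laplace_corr)
  also have "\<dots> = radial_kernel q (x - y)"
    using assms by (simp add: factorization radial_kernel_def)
  finally show ?thesis .
qed

lemma phi_correlation: "\<kappa> * (LINT u|lborel. \<phi> (u - x) * \<phi> (u - y)) = radial_kernel q (x - y)"
proof (cases "x \<le> y")
  case False
  then have "\<kappa> * (LINT u|lborel. \<phi> (u - y) * \<phi> (u - x)) = radial_kernel q (y - x)"
    by (intro phi_correlation_aux) auto
  then show ?thesis by (simp add: mult.commute[of "\<phi> (_ - y)"] radial_kernel_minus_commute)
qed (rule phi_correlation_aux)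

text \<open>A signed measure on the line is encoded as the image under \<open>X\<close> of the
  density \<open>f\<close> on \<open>M\<close>. One format thus covers a finite set projected to a
  direction (\<open>count_space\<close>), the weight with endpoint masses
  (\<open>weight_space\<close>) and a radial density projected from the ball. The potential is the
  convolution of this image with \<open>\<phi>\<close>.\<close>

definition potential :: "'s measure \<Rightarrow> ('s \<Rightarrow> real) \<Rightarrow> ('s \<Rightarrow> real) \<Rightarrow> real \<Rightarrow> real" where
  "potential M X f u = (LINT s|M. f s * \<phi> (u - X s))"

definition signed_density :: "'s measure \<Rightarrow> ('s \<Rightarrow> real) \<Rightarrow> ('s \<Rightarrow> real) \<Rightarrow> bool" where
  "signed_density M X f \<longleftrightarrow> finite_measure M \<and> X \<in> borel_measurable M \<and> f \<in> borel_measurable M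
     \<and> (\<exists>B\<ge>0. \<forall>s\<in>space M. \<bar>X s\<bar> \<le> B \<and> \<bar>f s\<bar> \<le> B)"

lemma potential_measurable:
  assumes "signed_density M X f"
  shows "potential M X f \<in> borel_measurable borel"
proof -
  interpret finite_measure M using assms by (simp add: signed_density_def)
  have [measurable]: "X \<in> borel_measurable M" "f \<in> borel_measurable M" using assms by (auto simp: signed_density_def)
  show ?thesis unfolding potential_def[abs_def] by measurable
qed

lemma potential_bound:
  assumes "signed_density M X f"
  shows "\<exists>D\<ge>0. \<exists>B\<ge>0. \<forall>u. \<bar>potential M X f u\<bar> \<le> D * (exp (- (u / 2)) * indicator {- B..} u) \<and> \<bar>potential M X f u\<bar> \<le> D"
proof -
  interpret finite_measure M using assms by (simp add: signed_density_def)
  have [measurable]: "X \<in> borel_measurable M" "f \<in> borel_measurable M" using assms by (auto simp: signed_density_def)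
  obtain B where B: "B \<ge> 0" "\<And>s. s \<in> space M \<Longrightarrow> \<bar>X s\<bar> \<le> B" "\<And>s. s \<in> space M \<Longrightarrow> \<bar>f s\<bar> \<le> B"
    using assms by (auto simp: signed_density_def)
  obtain C where C: "C \<ge> 0" "\<And>t. \<bar>\<phi> t\<bar> \<le> C * exp (- (t / 2))" "\<And>t. \<bar>\<phi> t\<bar> \<le> C" using phi_bound by blast
  define m where "m = measure M (space M)"
  have bd: "\<bar>potential M X f u\<bar> \<le> B * K * m" if K: "K \<ge> 0" "\<And>s. s \<in> space M \<Longrightarrow> \<bar>\<phi> (u - X s)\<bar> \<le> K" for K u
  proof -
    have 1: "norm (f s * \<phi> (u - X s)) \<le> B * K" if "s \<in> space M" for s
      using B(3)[OF that] K(2)[OF that] B(1) by (simp add: abs_mult mult_mono)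
    have 2: "integrable M (\<lambda>s. f s * \<phi> (u - X s))"
      by (rule integrable_const_bound[of _ "B * K"]) (use 1 in \<open>auto intro!: AE_I2\<close>)
    have "norm (potential M X f u) \<le> (LINT s|M. norm (f s * \<phi> (u - X s)))"
      unfolding potential_def by (rule integral_norm_bound)
    also have "\<dots> \<le> (LINT s|M. B * K)"
      by (rule integral_mono) (use 1 2 in auto)
    finally have "norm (potential M X f u) \<le> (LINT s|M. B * K)" .
    then show ?thesis by (simp add: m_def mult_ac)
  qed
  have m0: "m \<ge> 0" by (simp add: m_def)
  define D where "D = B * C * exp (B / 2) * m + B * C * m"
  have D0: "D \<ge> 0" unfolding D_def using B(1) C(1) m0 by simp
  have "\<bar>potential M X f u\<bar> \<le> D * (exp (- (u / 2)) * indicator {- B..} u)" for u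
  proof -
    have "\<bar>potential M X f u\<bar> \<le> B * (C * exp (B / 2) * (exp (- (u / 2)) * indicator {- B..} u)) * m"
      by (rule bd) (use C(1) phi_translate_bound[OF C(2) _ C(1)] B(2) in auto)
    also have "\<dots> = (B * C * exp (B / 2) * m) * (exp (- (u / 2)) * indicator {- B..} u)" by simp
    also have "\<dots> \<le> D * (exp (- (u / 2)) * indicator {- B..} u)"
      unfolding D_def using B(1) C(1) m0 by (intro mult_right_mono) auto
    finally show ?thesis .
  qed
  moreover have "\<bar>potential M X f u\<bar> \<le> D" for u
  proof -
    have "\<bar>potential M X f u\<bar> \<le> B * C * m"
      by (rule bd) (use C in auto)
    also have "\<dots> \<le> D" unfolding D_def using B(1) C(1) m0 by simp
    finally show ?thesis .
  qed
  ultimately show ?thesis using D0 B(1) by blast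
qed

lemma integrable_potential:
  assumes "signed_density M X f"
  shows "integrable lborel (potential M X f)"
proof -
  obtain D B where D: "D \<ge> 0" "\<And>u. \<bar>potential M X f u\<bar> \<le> D * (exp (- (u / 2)) * indicator {- B..} u)"
    using potential_bound[OF assms] by blast
  show ?thesis
    by (rule Bochner_Integration.integrable_bound[OF integrable_mult_right[OF integrable_exp_tail[of B], of D]])
      (use D(2) potential_measurable[OF assms] in \<open>auto intro!: AE_I2 order_trans[OF _ abs_ge_self]\<close>)
qed

lemma integrable_potential_mult:
  assumes "signed_density M X f" "signed_density N Y g"
  shows "integrable lborel (\<lambda>u. potential M X f u * potential N Y g u)"
proof -
  obtain D where D: "D \<ge> 0" "\<And>u. \<bar>potential M X f u\<bar> \<le> D"
    using potential_bound[OF assms(1)] by blast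
  show ?thesis
    by (rule Bochner_Integration.integrable_bound[OF integrable_mult_right[OF integrable_potential[OF assms(2)], of D]])
      (use D potential_measurable[OF assms(1)] potential_measurable[OF assms(2)] in \<open>auto intro!: AE_I2 mult_mono simp: abs_mult\<close>)
qed

lemma potential_pairing:
  assumes sd: "signed_density M X f" and G: "integrable lborel G"
  shows "(LINT u|lborel. potential M X f u * G u) = (LINT s|M. f s * (LINT u|lborel. \<phi> (u - X s) * G u))"
proof -
  interpret M: finite_measure M using sd by (simp add: signed_density_def)
  interpret P: pair_sigma_finite M "lborel :: real measure" ..
  have [measurable]: "X \<in> borel_measurable M" "f \<in> borel_measurable M" "G \<in> borel_measurable borel"
    using sd G by (auto simp: signed_density_def)
  obtain B where B: "B \<ge> 0" "\<And>s. s \<in> space M \<Longrightarrow> \<bar>f s\<bar> \<le> B"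
    using sd by (auto simp: signed_density_def)
  obtain C where C: "C \<ge> 0" "\<And>t. \<bar>\<phi> t\<bar> \<le> C" using phi_bound by blast
  have I: "integrable (M \<Otimes>\<^sub>M lborel) (\<lambda>(s, u). f s * \<phi> (u - X s) * G u)"
  proof (rule Bochner_Integration.integrable_bound)
    show "integrable (M \<Otimes>\<^sub>M lborel) (\<lambda>(s, u). B * C * G u)"
    proof (rule P.Fubini_integrable)
      show "integrable M (\<lambda>x. LINT y|lborel. norm (case (x, y) of (s, u) \<Rightarrow> B * C * G u))" by simp
      show "AE x in M. integrable lborel (\<lambda>y. case (x, y) of (s, u) \<Rightarrow> B * C * G u)" using G by simp
    qed measurable
    show "AE x in M \<Otimes>\<^sub>M lborel. norm (case x of (s, u) \<Rightarrow> f s * \<phi> (u - X s) * G u) \<le> norm (case x of (s, u) \<Rightarrow> B * C * G u)"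
      using B C by (intro AE_I2) (auto simp: abs_mult space_pair_measure intro!: mult_right_mono mult_mono)
  qed measurable
  have "(LINT u|lborel. potential M X f u * G u) = (LINT u|lborel. (LINT s|M. f s * \<phi> (u - X s) * G u))"
    by (simp add: potential_def)
  also have "\<dots> = (LINT s|M. (LINT u|lborel. f s * \<phi> (u - X s) * G u))"
    by (rule P.Fubini_integral[OF I])
  finally show ?thesis by (simp add: mult.assoc)
qed

text \<open>As the kernel is the correlation of \<open>\<phi>\<close> with itself, the energy
  pairing of two signed measures is an \<open>L2\<close> inner product of their potentials.
  Positivity of the kernel and the Cauchy-Schwarz inequality for it come from here.\<close>

lemma potential_inner:
  assumes "signed_density M X f" "signed_density N Y g"
  shows "\<kappa> * (LINT u|lborel. potential M X f u * potential N Y g u)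
    = (LINT s|M. f s * (LINT t|N. g t * radial_kernel q (X s - Y t)))"
proof -
  have "(LINT u|lborel. \<phi> (u - x) * potential N Y g u) = (LINT t|N. g t * (radial_kernel q (x - Y t) / \<kappa>))" for x
  proof -
    have "(LINT u|lborel. potential N Y g u * \<phi> (u - x)) = (LINT t|N. g t * (LINT u|lborel. \<phi> (u - Y t) * \<phi> (u - x)))"
      by (rule potential_pairing[OF assms(2) integrable_phi_translate])
    moreover have "(LINT u|lborel. \<phi> (u - Y t) * \<phi> (u - x)) = radial_kernel q (x - Y t) / \<kappa>" for t
      using phi_correlation[of "Y t" x] kpos by (simp add: field_simps radial_kernel_minus_commute)
    ultimately show ?thesis by (simp add: mult.commute)
  qed
  then show ?thesis
    using potential_pairing[OF assms(1) integrable_potential[OF assms(2)]] kpos by simp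
qed

lemma potential_Cauchy_Schwarz:
  assumes "signed_density M X f" "signed_density N Y g"
  shows "(LINT u|lborel. potential M X f u * potential N Y g u)\<^sup>2
    \<le> (LINT u|lborel. (potential M X f u)\<^sup>2) * (LINT u|lborel. (potential N Y g u)\<^sup>2)"
proof -
  define a where "a = (LINT u|lborel. (potential M X f u)\<^sup>2)"
  define b where "b = (LINT u|lborel. potential M X f u * potential N Y g u)"
  define c where "c = (LINT u|lborel. (potential N Y g u)\<^sup>2)"
  have I: "integrable lborel (\<lambda>u. (potential M X f u)\<^sup>2)" "integrable lborel (\<lambda>u. (potential N Y g u)\<^sup>2)"
    "integrable lborel (\<lambda>u. potential M X f u * potential N Y g u)"
    using assms by (auto simp: power2_eq_square intro: integrable_potential_mult)
  have "0 \<le> x\<^sup>2 * a + 2 * x * y * b + y\<^sup>2 * c" for x y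
  proof -
    have "0 \<le> (LINT u|lborel. (x * potential M X f u + y * potential N Y g u)\<^sup>2)"
      by (rule integral_nonneg_AE) simp
    also have "\<dots> = (LINT u|lborel. x\<^sup>2 * (potential M X f u)\<^sup>2 + 2 * x * y * (potential M X f u * potential N Y g u) + y\<^sup>2 * (potential N Y g u)\<^sup>2)"
      by (simp add: power2_sum power_mult_distrib algebra_simps)
    also have "\<dots> = x\<^sup>2 * a + 2 * x * y * b + y\<^sup>2 * c"
      using I by (simp add: a_def b_def c_def)
    finally show ?thesis .
  qed
  then have "b\<^sup>2 \<le> a * c" by (rule discriminant_le)
  then show ?thesis by (simp add: a_def b_def c_def)
qed

end

section \<open>The exponential kernel as a spherical average\<close>

lemma emeasure_density_indicator_space:
  assumes "A \<in> sets M"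
  shows "emeasure (density M (indicator A)) (space (density M (indicator A))) = emeasure M A"
proof -
  have "emeasure (density M (indicator A)) (space M) = (\<integral>\<^sup>+x. indicator A x * indicator (space M) x \<partial>M)"
    using assms by (intro emeasure_density) auto
  also have "\<dots> = (\<integral>\<^sup>+x. indicator A x \<partial>M)" by (rule nn_integral_cong) (auto simp: indicator_def)
  finally show ?thesis using assms by simp
qed

lemma integral_density_indicator:
  fixes f :: "'a \<Rightarrow> real"
  assumes "A \<in> sets M" "f \<in> borel_measurable M"
  shows "(LINT x|density M (indicator A). f x) = (LINT x:A|M. f x)"
proof -
  have "(LINT x|density M (\<lambda>x. ennreal (indicator A x)). f x) = (LINT x|M. indicator A x *\<^sub>R f x)"
    using assms by (intro integral_density) auto
  then show ?thesis by (simp add: set_lebesgue_integral_def ennreal_indicator)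
qed

definition ball_measure :: "real \<Rightarrow> 'a::euclidean_space measure" where
  "ball_measure R = density lborel (indicator (cball 0 R))"

lemma sets_ball_measure [measurable_cong, simp]: "sets (ball_measure R) = sets borel"
  and space_ball_measure [simp]: "space (ball_measure R) = UNIV"
  by (simp_all add: ball_measure_def)

lemma finite_measure_ball_measure: "finite_measure (ball_measure R :: 'a::euclidean_space measure)"
  unfolding ball_measure_def
  by (rule finite_measureI, subst emeasure_density_indicator_space)
    (use emeasure_lborel_cball_finite[of "0::'a" R] in auto)

lemma integral_ball_measure:
  fixes f :: "'a::euclidean_space \<Rightarrow> real"
  assumes "f \<in> borel_measurable borel"
  shows "(LINT x|ball_measure R. f x) = (LINT x:cball 0 R|lborel. f x)"
  unfolding ball_measure_def using assms by (intro integral_density_indicator) auto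

lemma AE_ball_measure: "AE x in ball_measure R. norm (x :: 'a::euclidean_space) \<le> R"
proof -
  have [measurable]: "cball (0::'a) R \<in> sets borel" by simp
  show ?thesis unfolding ball_measure_def by (subst AE_density) (measurable, auto simp: indicator_def)
qed

lemma measure_ball_measure: "measure (ball_measure R) (UNIV :: 'a::euclidean_space set) = measure lborel (cball (0::'a) R)"
  using emeasure_density_indicator_space[of "cball (0::'a) R" lborel]
  by (simp add: measure_def ball_measure_def)

lemma Fubini_bounded:
  fixes f :: "'a \<Rightarrow> 'b \<Rightarrow> real"
  assumes "finite_measure M" "finite_measure N" "(\<lambda>(x, y). f x y) \<in> borel_measurable (M \<Otimes>\<^sub>M N)"
    "AE x in M. AE y in N. \<bar>f x y\<bar> \<le> B"
  shows "(LINT x|M. (LINT y|N. f x y)) = (LINT y|N. (LINT x|M. f x y))"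
proof -
  interpret M: finite_measure M by fact
  interpret N: finite_measure N by fact
  interpret P: pair_sigma_finite M N ..
  note [measurable] = assms(3)
  have "integrable (M \<Otimes>\<^sub>M N) (\<lambda>(x, y). f x y)"
  proof (rule Bochner_Integration.integrable_bound)
    show "integrable (M \<Otimes>\<^sub>M N) (\<lambda>(x, y). B)"
      by (rule P.Fubini_integrable) auto
    show "AE p in M \<Otimes>\<^sub>M N. norm (case p of (x, y) \<Rightarrow> f x y) \<le> norm (case p of (x, y) \<Rightarrow> B)"
    proof (rule P.AE_pair_measure)
      show "{p \<in> space (M \<Otimes>\<^sub>M N). norm (case p of (x, y) \<Rightarrow> f x y) \<le> norm (case p of (x, y) \<Rightarrow> B)} \<in> sets (M \<Otimes>\<^sub>M N)"
        by measurable
      show "AE x in M. AE y in N. norm (case (x, y) of (x, y) \<Rightarrow> f x y) \<le> norm (case (x, y) of (x, y) \<Rightarrow> B)"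
        using assms(4) by eventually_elim (auto elim!: eventually_mono)
    qed
  qed fact
  from P.Fubini_integral[OF this] show ?thesis by simp
qed

lemma integral_lborel_scale:
  fixes f :: "'a::euclidean_space \<Rightarrow> real"
  assumes "s > 0" and [measurable]: "f \<in> borel_measurable borel"
  shows "(LINT x|lborel. f x) = s ^ DIM('a) * (LINT x|lborel. f (s *\<^sub>R x))"
proof -
  have "(LINT x|lborel. f x) = (LINT x|density (distr lborel borel (\<lambda>x. 0 + s *\<^sub>R x)) (\<lambda>_. ennreal (\<bar>s\<bar> ^ DIM('a))). f x)"
    using lborel_affine[of s "0::'a"] assms(1) by simp
  also have "\<dots> = (LINT x|distr lborel borel (\<lambda>x. 0 + s *\<^sub>R x). \<bar>s\<bar> ^ DIM('a) *\<^sub>R f x)"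
    by (rule integral_density) auto
  also have "\<dots> = s ^ DIM('a) * (LINT x|lborel. f (s *\<^sub>R x))"
    using assms(1) by (subst integral_distr) auto
  finally show ?thesis .
qed

section \<open>Averages of the radial kernel over the solid ball and over directions\<close>

definition pexp :: "real poly \<Rightarrow> real \<Rightarrow> real" where
  "pexp p t = poly p t * exp (- t)"

lemma pexp_scaled_derivative:
  "((\<lambda>s. pexp p (s * c)) has_real_derivative c * pexp (exp_deriv p) (s * c)) (at s within S)"
  unfolding exp_deriv_def pexp_def by (auto intro!: derivative_eq_intros simp: algebra_simps)

lemma continuous_on_pexp [continuous_intros]:
  "continuous_on A f \<Longrightarrow> continuous_on A (\<lambda>x. pexp p (f x))"
  unfolding pexp_def by (intro continuous_intros)

lemma borel_measurable_pexp [measurable]: "pexp p \<in> borel_measurable borel"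
  by (intro borel_measurable_continuous_onI continuous_on_pexp continuous_on_id)

lemma radial_kernel_eq_pexp: "radial_kernel q t = pexp (radial_poly q) \<bar>t\<bar>"
  by (simp add: radial_kernel_def pexp_def)

lemma pexp_radial_poly_Suc:
  "(2 * q + 1) * pexp (radial_poly (Suc q)) t = (2 * q + 1) * pexp (radial_poly q) t + t * pexp (exp_deriv (radial_poly q)) t"
proof -
  have "(2 * real q + 1) * poly (radial_poly (Suc q)) t = (2 * q + 1) * poly (radial_poly q) t + t * poly (exp_deriv (radial_poly q)) t"
    by (simp add: exp_deriv_def field_simps)
  then have "((2 * real q + 1) * poly (radial_poly (Suc q)) t) * exp (- t) = ((2 * q + 1) * poly (radial_poly q) t + t * poly (exp_deriv (radial_poly q)) t) * exp (- t)" 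
    by simp
  then show ?thesis by (simp add: pexp_def algebra_simps)
qed

text \<open>With \<open>m = q + 1\<close>, integrate the derivative of
  \<open>t * (1 - t\<^sup>2) ^ m * k (t * r)\<close>. The boundary values vanish, at 0 by the factor
  \<open>t\<close> and at 1 because \<open>m \<ge> 1\<close>, and the recursion combines
  \<open>(2 * m + 1) k + (t * r) k'\<close> into a multiple of the next kernel.\<close>

lemma slice_integral_Suc:
  "integral {0..1} (\<lambda>t. (1 - t\<^sup>2) ^ Suc q * pexp (radial_poly (Suc (Suc q))) (t * r))
    = 2 * (q + 1) / (2 * q + 3) * integral {0..1} (\<lambda>t. (1 - t\<^sup>2) ^ q * pexp (radial_poly (Suc q)) (t * r))"
proof -
  let ?P = "radial_poly (Suc q) :: real poly"
  define m where "m = Suc q"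
  have "((\<lambda>t. (2 * m + 1) * ((1 - t\<^sup>2) ^ Suc q * pexp (radial_poly (Suc (Suc q))) (t * r)) - 2 * m * ((1 - t\<^sup>2) ^ q * pexp ?P (t * r)))
    has_integral (1 * ((1 - 1\<^sup>2) ^ m * pexp ?P (1 * r)) - 0 * ((1 - 0\<^sup>2) ^ m * pexp ?P (0 * r)))) {0..1}"
  proof (rule fundamental_theorem_of_calculus)
    fix t :: real
    have "((\<lambda>t. t * ((1 - t\<^sup>2) ^ m * pexp ?P (t * r))) has_real_derivative
      (1 - t\<^sup>2) ^ m * pexp ?P (t * r) + t * (m * (1 - t\<^sup>2) ^ q * (- 2 * t) * pexp ?P (t * r) + (1 - t\<^sup>2) ^ m * (r * pexp (exp_deriv ?P) (t * r)))) (at t within {0..1})"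
      by (rule derivative_eq_intros pexp_scaled_derivative refl | simp add: m_def)+
    also have "(1 - t\<^sup>2) ^ m * pexp ?P (t * r) + t * (m * (1 - t\<^sup>2) ^ q * (- 2 * t) * pexp ?P (t * r) + (1 - t\<^sup>2) ^ m * (r * pexp (exp_deriv ?P) (t * r)))
      = (1 - t\<^sup>2) ^ m * ((2 * m + 1) * pexp ?P (t * r) + (t * r) * pexp (exp_deriv ?P) (t * r)) - 2 * m * (1 - t\<^sup>2) ^ q * pexp ?P (t * r)"
      by (simp add: m_def power2_eq_square algebra_simps)
    also have "(2 * m + 1) * pexp ?P (t * r) + (t * r) * pexp (exp_deriv ?P) (t * r) = (2 * m + 1) * pexp (radial_poly (Suc (Suc q))) (t * r)"
      using pexp_radial_poly_Suc[of "Suc q" "t * r"] by (simp add: m_def algebra_simps del: radial_poly.simps)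
    finally show "((\<lambda>t. t * ((1 - t\<^sup>2) ^ m * pexp ?P (t * r))) has_vector_derivative
       (2 * m + 1) * ((1 - t\<^sup>2) ^ Suc q * pexp (radial_poly (Suc (Suc q))) (t * r)) - 2 * m * ((1 - t\<^sup>2) ^ q * pexp ?P (t * r))) (at t within {0..1})"
      unfolding has_real_derivative_iff_has_vector_derivative[symmetric] by (simp add: m_def mult_ac)
  qed simp
  then have "integral {0..1} (\<lambda>t. (2 * m + 1) * ((1 - t\<^sup>2) ^ Suc q * pexp (radial_poly (Suc (Suc q))) (t * r)) - 2 * m * ((1 - t\<^sup>2) ^ q * pexp ?P (t * r))) = 0"
    by (intro integral_unique) (simp add: m_def)
  moreover have "integral {0..1} (\<lambda>t. (2 * m + 1) * ((1 - t\<^sup>2) ^ Suc q * pexp (radial_poly (Suc (Suc q))) (t * r)) - 2 * m * ((1 - t\<^sup>2) ^ q * pexp ?P (t * r)))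
    = (2 * m + 1) * integral {0..1} (\<lambda>t. (1 - t\<^sup>2) ^ Suc q * pexp (radial_poly (Suc (Suc q))) (t * r)) - 2 * m * integral {0..1} (\<lambda>t. (1 - t\<^sup>2) ^ q * pexp ?P (t * r))"
    by (subst integral_diff) (auto intro!: integrable_continuous_interval continuous_intros simp del: radial_poly.simps)
  ultimately show ?thesis by (simp add: m_def field_simps del: radial_poly.simps)
qed

lemma slice_integral:
  "\<exists>d>0. \<forall>r. integral {0..1} (\<lambda>t. (1 - t\<^sup>2) ^ q * pexp (radial_poly (Suc q)) (t * r)) = d * exp (- r)"
proof (induction q)
  case 0
  have "integral {0..1} (\<lambda>t. (1 - t\<^sup>2) ^ 0 * pexp (radial_poly (Suc 0)) (t * r)) = 1 * exp (- r)" for r :: real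
  proof (rule integral_unique)
    have "((\<lambda>t. (1 - t\<^sup>2) ^ 0 * pexp (radial_poly (Suc 0)) (t * r)) has_integral (1 * exp (- (1 * r)) - 0 * exp (- (0 * r)))) {0..1}"
    proof (rule fundamental_theorem_of_calculus)
      show "((\<lambda>t. t * exp (- (t * r))) has_vector_derivative (1 - t\<^sup>2) ^ 0 * pexp (radial_poly (Suc 0)) (t * r)) (at t within {0..1})" for t
        unfolding has_real_derivative_iff_has_vector_derivative[symmetric]
        by (auto intro!: derivative_eq_intros simp: pexp_def pderiv_1 algebra_simps)
    qed simp
    then show "((\<lambda>t. (1 - t\<^sup>2) ^ 0 * pexp (radial_poly (Suc 0)) (t * r)) has_integral 1 * exp (- r)) {0..1}" by simp
  qed
  then show ?case by (intro exI[of _ 1]) simp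
next
  case (Suc q)
  then obtain d where d: "d > 0" "\<And>r. integral {0..1} (\<lambda>t. (1 - t\<^sup>2) ^ q * pexp (radial_poly (Suc q)) (t * r)) = d * exp (- r)"
    by blast
  show ?case using d(1)
    by (intro exI[of _ "2 * (q + 1) / (2 * q + 3) * d"]) (simp add: slice_integral_Suc d(2) del: radial_poly.simps power_Suc)
qed

text \<open>The average runs over the solid ball, whose marginal is a multiple of
  \<open>(1 - t\<^sup>2) ^ q\<close>; this accounts for the kernel of index \<open>Suc q\<close>.
  The constant is read off at \<open>z = 0\<close>, where the kernel and the exponential are both
  1.\<close>

lemma ball_average_radial_kernel:
  assumes n: "CARD('n::finite) = 2 * q + 1"
  shows "(LINT y|ball_measure 1. radial_kernel (Suc q) (y \<bullet> z)) = measure lborel (cball (0::real^'n) 1) * exp (- norm (z::real^'n))"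
proof -
  obtain c where c0: "\<forall>R>0. \<forall>\<theta>::real^'n. norm \<theta> = 1 \<longrightarrow> (\<forall>h::real \<Rightarrow> real. h \<in> borel_measurable borel \<longrightarrow>
    (LINT x:cball 0 R|lborel. (R\<^sup>2 - (norm x)\<^sup>2) ^ 0 * h (\<theta> \<bullet> x)) = c * (LINT t:{-R..R}|lborel. (R\<^sup>2 - t\<^sup>2) ^ (0 + q) * h t))"
    using ball_marginal_integral[OF n, of 0] by blast
  have c: "(LINT x:cball 0 1|lborel. h (\<theta> \<bullet> x)) = c * (LINT t:{-1..1}|lborel. (1 - t\<^sup>2) ^ q * h t)"
    if "norm \<theta> = 1" "h \<in> borel_measurable borel" for \<theta> :: "real^'n" and h :: "real \<Rightarrow> real"
    using c0[rule_format, of 1, OF _ that] by simp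
  obtain d where d: "\<And>r. integral {0..1} (\<lambda>t. (1 - t\<^sup>2) ^ q * pexp (radial_poly (Suc q)) (t * r)) = d * exp (- r)"
    using slice_integral by blast
  have avg: "(LINT y|ball_measure 1. radial_kernel (Suc q) (y \<bullet> z)) = c * (2 * d) * exp (- norm z)" for z :: "real^'n"
  proof -
    obtain e :: "real^'n" where e: "norm e = 1" using vector_choose_size[of 1] by auto
    define r where "r = norm z"
    define \<theta> where "\<theta> = (if z = 0 then e else z /\<^sub>R r)"
    have th: "norm \<theta> = 1" "z = r *\<^sub>R \<theta>" using e by (auto simp: \<theta>_def r_def)
    let ?g = "\<lambda>t. (1 - t\<^sup>2) ^ q * radial_kernel (Suc q) (r * t)"
    have "(LINT y|ball_measure 1. radial_kernel (Suc q) (y \<bullet> z)) = (LINT y:cball 0 1|lborel. radial_kernel (Suc q) (r * (\<theta> \<bullet> y)))"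
      by (subst integral_ball_measure) (simp_all add: th(2) inner_commute)
    also have "\<dots> = c * (LINT t:{-1..1}|lborel. ?g t)"
      by (rule c[OF th(1)]) measurable
    also have "(LINT t:{-1..1}|lborel. ?g t) = integral {-1..1} ?g"
      by (intro set_borel_integral_eq_integral borel_integrable_atLeastAtMost') (intro continuous_intros)
    also have "\<dots> = integral {-1..0} ?g + integral {0..1} ?g"
      by (rule Henstock_Kurzweil_Integration.integral_combine[symmetric]) (auto intro!: integrable_continuous_interval continuous_intros)
    also have "integral {-1..0} ?g = integral {0..1} ?g"
      using Henstock_Kurzweil_Integration.integral_reflect_real[of 1 0 ?g] by (simp add: radial_kernel_eq_pexp)
    also have "integral {0..1} ?g = integral {0..1} (\<lambda>t. (1 - t\<^sup>2) ^ q * pexp (radial_poly (Suc q)) (t * r))"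
      by (rule Henstock_Kurzweil_Integration.integral_cong) (simp add: radial_kernel_eq_pexp abs_mult r_def mult.commute del: radial_poly.simps)
    also have "\<dots> = d * exp (- r)" by (rule d)
    finally show ?thesis by (simp add: r_def)
  qed
  interpret finite_measure "ball_measure 1 :: (real^'n) measure" by (rule finite_measure_ball_measure)
  have r0: "poly (radial_poly m) 0 = (1::real)" for m
    by (induction m) auto
  have "measure lborel (cball (0::real^'n) 1) = c * (2 * d)"
    using avg[of 0] by (simp add: radial_kernel_def r0 measure_ball_measure del: radial_poly.simps)
  then show ?thesis using avg by simp
qed

text \<open>The passage from the ball to directions: expand \<open>k (norm y * \<tau>)\<close> around \<open>k \<tau>\<close>, where \<open>\<tau>\<close> depends on
  the direction of \<open>y\<close> only, and rescale the inner balls that arise to the unit ball.\<close>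

lemma exp_minus_norm_eq_average:
  assumes n: "CARD('n::finite) = 2 * q + 1"
  shows "(LINT y|ball_measure 1. radial_kernel q (sgn y \<bullet> z)) = measure lborel (cball (0::real^'n) 1) * exp (- norm (z::real^'n))"
proof -
  define k where "k = (radial_poly (Suc q) :: real poly)"
  define f where "f = (radial_poly q :: real poly)"
  define k' where "k' = exp_deriv k"
  define N where "N = 2 * q + 1"
  define \<tau> where "\<tau> y = \<bar>sgn y \<bullet> z\<bar>" for y :: "real^'n"
  have sgn_m [measurable]: "(sgn :: real^'n \<Rightarrow> real^'n) \<in> borel_measurable borel"
    unfolding sgn_div_norm[abs_def] by measurable
  have [measurable]: "\<tau> \<in> borel_measurable borel" unfolding \<tau>_def by measurable
  have tau: "0 \<le> \<tau> y" "\<tau> y \<le> norm z" for y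
    using Cauchy_Schwarz_ineq2[of "sgn y" z] by (auto simp: \<tau>_def norm_sgn split: if_splits)
  have scale: "\<tau> (s *\<^sub>R y) = \<tau> y" if "s > 0" for s y using that by (simp add: \<tau>_def sgn_scaleR)
  obtain C where C: "\<And>x. x \<in> {0..norm z} \<Longrightarrow> \<bar>pexp k' x\<bar> \<le> C"
  proof -
    have "bounded (pexp k' ` {0..norm z})"
      by (intro compact_imp_bounded compact_continuous_image continuous_intros) auto
    then obtain E where "\<forall>x\<in>{0..norm z}. \<bar>pexp k' x\<bar> \<le> E" by (auto simp: bounded_iff)
    then show ?thesis by (intro that) auto
  qed
  define S where "S = density lborel (indicator {0..1::real})"
  define B where "B = (ball_measure 1 :: (real^'n) measure)"
  have finS: "finite_measure S" unfolding S_def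
    by (rule finite_measureI, subst emeasure_density_indicator_space) auto
  have finB: "finite_measure B" unfolding B_def by (rule finite_measure_ball_measure)
  have [measurable_cong, simp]: "sets S = sets borel" "sets B = sets borel" by (simp_all add: S_def B_def)
  interpret B: finite_measure B by fact
  \<comment> \<open>\<open>D s y\<close> is the derivative in \<open>s\<close> of
    \<open>k (s * \<tau> y)\<close>, so it integrates from \<open>norm y\<close> to 1 to
    \<open>k (\<tau> y) - k (norm y * \<tau> y)\<close>.\<close>
  define D where "D s y = \<tau> y * pexp k' (s * \<tau> y)" for s y
  have D_bd: "\<bar>D s y\<bar> \<le> norm z * \<bar>C\<bar>" if "s \<in> {0..1}" for s y
  proof -
    have "s * \<tau> y \<in> {0..norm z}" using that tau[of y] mult_le_one[of s "\<tau> y"]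
      by (auto intro: order_trans[OF mult_left_le_one_le])
    from C[OF this] have "\<bar>pexp k' (s * \<tau> y)\<bar> \<le> \<bar>C\<bar>" by simp
    then show ?thesis using tau[of y] by (auto simp: D_def abs_mult intro!: mult_mono)
  qed
  have AES: "AE s in S. s \<in> {0..1}" unfolding S_def by (subst AE_density) (auto simp: indicator_def)
  have D_m [measurable]: "(\<lambda>(y, s). D s y) \<in> borel_measurable (borel \<Otimes>\<^sub>M borel)"
    unfolding D_def case_prod_beta by measurable
  have bnd: "integrable B (\<lambda>y. pexp p (g y))" if [measurable]: "g \<in> borel_measurable borel" and g: "\<And>y. norm y \<le> 1 \<Longrightarrow> g y \<in> {0..norm z}" for g p
  proof -
    have "bounded (pexp p ` {0..norm z})"
      by (intro compact_imp_bounded compact_continuous_image continuous_intros) auto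
    then obtain E where E: "\<forall>x\<in>{0..norm z}. \<bar>pexp p x\<bar> \<le> E" by (auto simp: bounded_iff)
    have "AE x in B. norm x \<le> 1" unfolding B_def by (rule AE_ball_measure)
    then have "AE x in B. norm (pexp p (g x)) \<le> E"
      by (rule eventually_mono) (use E g in auto)
    then show ?thesis
      by (rule B.integrable_const_bound) measurable
  qed
  have D_bd': "\<bar>indicator {norm y..1} s * D s y\<bar> \<le> norm z * \<bar>C\<bar>" "\<bar>s ^ N * D s y\<bar> \<le> norm z * \<bar>C\<bar>"
    if s: "s \<in> {0..1}" for s y
  proof -
    show "\<bar>indicator {norm y..1} s * D s y\<bar> \<le> norm z * \<bar>C\<bar>"
      using D_bd[OF s, of y] by (auto simp: indicator_def)
    have "\<bar>s ^ N * D s y\<bar> \<le> 1 * (norm z * \<bar>C\<bar>)"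
      unfolding abs_mult using s D_bd[OF s, of y] by (intro mult_mono) (auto simp: power_le_one)
    then show "\<bar>s ^ N * D s y\<bar> \<le> norm z * \<bar>C\<bar>" by simp
  qed
  have int_k: "integrable B (\<lambda>y. pexp k (\<tau> y))" "integrable B (\<lambda>y. pexp f (\<tau> y))"
    by (rule bnd; use tau in auto)+
  have int_k': "integrable B (\<lambda>y. pexp k (norm y * \<tau> y))"
  proof (rule bnd)
    show "norm y * \<tau> y \<in> {0..norm z}" if "norm y \<le> 1" for y
      using that tau[of y] mult_left_le_one_le[of "\<tau> y" "norm y"] by auto
  qed measurable
  have "(LINT y|B. (LINT s|S. indicator {norm y..1} s * D s y)) = (LINT y|B. pexp k (\<tau> y) - pexp k (norm y * \<tau> y))"
  proof (rule integral_cong_AE)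
    show "AE y in B. (LINT s|S. indicator {norm y..1} s * D s y) = pexp k (\<tau> y) - pexp k (norm y * \<tau> y)"
      using AE_ball_measure[of 1] unfolding B_def
    proof eventually_elim
      case (elim y)
      have "(LINT s|S. indicator {norm y..1} s * D s y) = (LINT s:{norm y..1}|lborel. D s y)"
      proof -
        have [measurable]: "(\<lambda>s. D s y) \<in> borel_measurable borel" unfolding D_def by measurable
        have "(LINT s|S. indicator {norm y..1} s * D s y) = (LINT s:{0..1}|lborel. indicator {norm y..1} s * D s y)"
          unfolding S_def by (rule integral_density_indicator) simp_all
        also have "\<dots> = (LINT s:{norm y..1}|lborel. D s y)"
          unfolding set_lebesgue_integral_def
          by (rule Bochner_Integration.integral_cong) (auto simp: indicator_def intro: order_trans[OF norm_ge_zero])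
        finally show ?thesis .
      qed
      also have "\<dots> = integral {norm y..1} (\<lambda>s. D s y)"
        unfolding D_def
        by (intro set_borel_integral_eq_integral borel_integrable_atLeastAtMost') (intro continuous_intros)
      also have "\<dots> = pexp k (1 * \<tau> y) - pexp k (norm y * \<tau> y)"
        unfolding D_def k'_def using elim
        by (intro integral_unique fundamental_theorem_of_calculus)
          (auto simp: has_real_derivative_iff_has_vector_derivative[symmetric] intro!: pexp_scaled_derivative)
      finally show ?case by simp
    qed
    have [measurable]: "(\<lambda>(y, s). indicator {norm y..1} s * D s y) \<in> borel_measurable (B \<Otimes>\<^sub>M S)"
      unfolding indicator_def atLeastAtMost_iff by measurable
    interpret S: finite_measure S by fact
    show "(\<lambda>y. LINT s|S. indicator {norm y..1} s * D s y) \<in> borel_measurable B" by measurable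
  qed measurable
  then have "(LINT y|B. pexp k (\<tau> y)) - (LINT y|B. pexp k (norm y * \<tau> y)) = (LINT y|B. (LINT s|S. indicator {norm y..1} s * D s y))"
    using int_k(1) int_k' by simp
  also have "(LINT y|B. (LINT s|S. indicator {norm y..1} s * D s y)) = (LINT s|S. (LINT y|B. indicator {norm y..1} s * D s y))"
  proof (rule Fubini_bounded[OF finB finS])
    show "(\<lambda>(y, s). indicator {norm y..1} s * D s y) \<in> borel_measurable (B \<Otimes>\<^sub>M S)"
      unfolding indicator_def atLeastAtMost_iff by measurable
    show "AE y in B. AE s in S. \<bar>indicator {norm y..1} s * D s y\<bar> \<le> norm z * \<bar>C\<bar>"
      by (intro AE_I2 eventually_mono[OF AES] D_bd'(1))
  qed
  also have "\<dots> = (LINT s|S. (LINT y|B. s ^ N * D s y))"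
  proof (rule integral_cong_AE)
    have "AE s in S. s \<noteq> 0" unfolding S_def by (subst AE_density) (use AE_lborel_singleton[of "0::real"] in \<open>auto elim!: eventually_mono\<close>)
    with AES show "AE s in S. (LINT y|B. indicator {norm y..1} s * D s y) = (LINT y|B. s ^ N * D s y)"
    proof eventually_elim
      case (elim s)
      then have s: "0 < s" "s \<le> 1" by auto
      have [measurable]: "(\<lambda>y. D s y) \<in> borel_measurable borel" unfolding D_def by measurable
      have [measurable]: "(\<lambda>y::real^'n. indicator {norm y..1} s :: real) \<in> borel_measurable borel"
        unfolding indicator_def atLeastAtMost_iff by measurable
      \<comment> \<open>For fixed \<open>s\<close> the constraint \<open>norm y \<le> s\<close> cuts
        out a smaller ball. Since \<open>\<tau>\<close> is constant on open rays from 0, rescaling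
        to the unit ball yields nothing but the factor \<open>s ^ N\<close>.\<close>
      have "(LINT y|B. indicator {norm y..1} s * D s y) = (LINT y|lborel. indicator (cball 0 s) y * D s y)"
        unfolding B_def using s
        by (subst integral_ball_measure) (auto simp: set_lebesgue_integral_def indicator_def intro!: Bochner_Integration.integral_cong)
      also have "\<dots> = s ^ DIM(real^'n) * (LINT y|lborel. indicator (cball 0 s) (s *\<^sub>R y) * D s (s *\<^sub>R y))"
        by (rule integral_lborel_scale[OF s(1)]) (intro borel_measurable_times borel_measurable_indicator, auto)
      also have "(\<lambda>y. indicator (cball 0 s) (s *\<^sub>R y) * D s (s *\<^sub>R y)) = (\<lambda>y. indicator (cball 0 1) y * D s y)"
        using s by (auto simp: D_def scale indicator_def fun_eq_iff)
      also have "s ^ DIM(real^'n) * (LINT y|lborel. indicator (cball 0 1) y * D s y) = (LINT y|B. s ^ N * D s y)"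
        unfolding B_def by (subst integral_ball_measure) (auto simp: set_lebesgue_integral_def N_def n mult.left_commute)
      finally show ?case .
    qed
    have [measurable]: "(\<lambda>(s, y). indicator {norm y..1} s * D s y) \<in> borel_measurable (S \<Otimes>\<^sub>M B)"
      "(\<lambda>(s, y). s ^ N * D s y) \<in> borel_measurable (S \<Otimes>\<^sub>M B)"
      unfolding indicator_def atLeastAtMost_iff D_def by measurable
    show "(\<lambda>s. LINT y|B. indicator {norm y..1} s * D s y) \<in> borel_measurable S"
      "(\<lambda>s. LINT y|B. s ^ N * D s y) \<in> borel_measurable S" by measurable
  qed
  also have "\<dots> = (LINT y|B. (LINT s|S. s ^ N * D s y))"
  proof (rule Fubini_bounded[OF finS finB])
    show "(\<lambda>(s, y). s ^ N * D s y) \<in> borel_measurable (S \<Otimes>\<^sub>M B)"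
      unfolding D_def by measurable
    show "AE s in S. AE y in B. \<bar>s ^ N * D s y\<bar> \<le> norm z * \<bar>C\<bar>"
      by (rule eventually_mono[OF AES]) (intro AE_I2 D_bd'(2))
  qed
  also have "\<dots> = (LINT y|B. pexp k (\<tau> y) - pexp f (\<tau> y))"
  proof (rule Bochner_Integration.integral_cong[OF refl])
    fix y
    have "(LINT s|S. s ^ N * D s y) = (LINT s:{0..1}|lborel. s ^ N * D s y)"
      unfolding S_def D_def by (rule integral_density_indicator) measurable
    also have "\<dots> = integral {0..1} (\<lambda>s. s ^ N * D s y)"
      unfolding D_def
      by (intro set_borel_integral_eq_integral borel_integrable_atLeastAtMost') (intro continuous_intros)
    \<comment> \<open>The antiderivative is
      \<open>s ^ N * (k (s * \<tau>) - f (s * \<tau>))\<close>; by the recursion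
      \<open>N k t = N f t + t f' t\<close> every term of its derivative except
      \<open>s ^ N * D s y\<close> cancels.\<close>
    also have "\<dots> = 1 ^ N * (pexp k (1 * \<tau> y) - pexp f (1 * \<tau> y)) - 0 ^ N * (pexp k (0 * \<tau> y) - pexp f (0 * \<tau> y))"
    proof (intro integral_unique fundamental_theorem_of_calculus)
      fix s :: real
      have N: "N * pexp k t = N * pexp f t + t * pexp (exp_deriv f) t" for t
        using pexp_radial_poly_Suc[of q t] by (simp add: N_def k_def f_def add.commute del: radial_poly.simps)
      have "((\<lambda>s. s ^ N * (pexp k (s * \<tau> y) - pexp f (s * \<tau> y))) has_real_derivative
         N * s ^ (N - 1) * (pexp k (s * \<tau> y) - pexp f (s * \<tau> y)) + s ^ N * (\<tau> y * pexp k' (s * \<tau> y) - \<tau> y * pexp (exp_deriv f) (s * \<tau> y))) (at s within {0..1})"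
        unfolding k'_def by (rule derivative_eq_intros pexp_scaled_derivative refl | simp)+
      also have "N * s ^ (N - 1) * (pexp k (s * \<tau> y) - pexp f (s * \<tau> y)) + s ^ N * (\<tau> y * pexp k' (s * \<tau> y) - \<tau> y * pexp (exp_deriv f) (s * \<tau> y))
         = s ^ (N - 1) * (N * pexp k (s * \<tau> y) - (N * pexp f (s * \<tau> y) + (s * \<tau> y) * pexp (exp_deriv f) (s * \<tau> y))) + s ^ N * D s y"
      proof -
        have "s ^ N = s * s ^ (N - 1)" by (simp add: N_def)
        then show ?thesis by (simp add: D_def algebra_simps)
      qed
      also have "\<dots> = s ^ N * D s y" by (simp add: N)
      finally show "((\<lambda>s. s ^ N * (pexp k (s * \<tau> y) - pexp f (s * \<tau> y))) has_vector_derivative s ^ N * D s y) (at s within {0..1})"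
        by (simp add: has_real_derivative_iff_has_vector_derivative)
    qed simp
    finally show "(LINT s|S. s ^ N * D s y) = pexp k (\<tau> y) - pexp f (\<tau> y)" by (simp add: N_def)
  qed
  also have "\<dots> = (LINT y|B. pexp k (\<tau> y)) - (LINT y|B. pexp f (\<tau> y))"
    using int_k by simp
  \<comment> \<open>The average of \<open>k (\<tau> y)\<close> occurs on both sides and
    cancels.\<close>
  finally have "(LINT y|B. pexp k (norm y * \<tau> y)) = (LINT y|B. pexp f (\<tau> y))" by simp
  moreover have "pexp k (norm y * \<tau> y) = radial_kernel (Suc q) (y \<bullet> z)" for y
  proof -
    have "norm y *\<^sub>R sgn y = y" by (cases "y = 0") (simp_all add: sgn_div_norm)
    then have "norm y * \<tau> y = \<bar>y \<bullet> z\<bar>" by (metis \<tau>_def abs_mult abs_norm_cancel inner_scaleR_left)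
    then show ?thesis by (simp add: radial_kernel_eq_pexp k_def del: radial_poly.simps)
  qed
  moreover have "pexp f (\<tau> y) = radial_kernel q (sgn y \<bullet> z)" for y
    by (simp add: radial_kernel_eq_pexp \<tau>_def f_def)
  ultimately show ?thesis using ball_average_radial_kernel[OF n, of z] by (simp add: B_def del: radial_poly.simps)
qed

section \<open>Finite sets\<close>

text \<open>Symmetric Gaussian elimination: the Schur complement \<open>k'\<close> of the positive
  entry \<open>k a a\<close> is again symmetric and positive definite on the remaining
  points.\<close>

lemma strictly_positive_definite_solvable:
  fixes k :: "'a \<Rightarrow> 'a \<Rightarrow> real"
  assumes "finite A" "\<And>x y. x \<in> A \<Longrightarrow> y \<in> A \<Longrightarrow> k x y = k y x"
    and "\<And>c. \<exists>x\<in>A. c x \<noteq> 0 \<Longrightarrow> 0 < (\<Sum>x\<in>A. \<Sum>y\<in>A. c x * c y * k x y)"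
  shows "\<exists>w. \<forall>x\<in>A. (\<Sum>y\<in>A. k x y * w y) = r x"
  using assms
proof (induction A arbitrary: k r rule: finite_induct)
  case (insert a B k r)
  note sym = insert.prems(1) and pd = insert.prems(2)
  have expand: "(\<Sum>x\<in>insert a B. \<Sum>y\<in>insert a B. c x * c y * k x y) =
      (c a)\<^sup>2 * k a a + 2 * c a * (\<Sum>x\<in>B. c x * k x a) + (\<Sum>x\<in>B. \<Sum>y\<in>B. c x * c y * k x y)" for c
  proof -
    have "(\<Sum>y\<in>B. c a * c y * k a y) = c a * (\<Sum>x\<in>B. c x * k x a)"
      unfolding sum_distrib_left using sym by (intro sum.cong) auto
    moreover have "(\<Sum>x\<in>B. c x * c a * k x a) = c a * (\<Sum>x\<in>B. c x * k x a)"
      unfolding sum_distrib_left by (intro sum.cong) auto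
    ultimately show ?thesis using insert.hyps by (simp add: sum.distrib power2_eq_square algebra_simps)
  qed
  have kaa: "k a a > 0"
  proof -
    have "(\<Sum>x\<in>B. (if x = a then 1 else 0) * k x a) = 0" "(\<Sum>x\<in>B. \<Sum>y\<in>B. (if x = a then 1 else 0) * (if y = a then 1 else 0) * k x y) = 0"
      using insert.hyps by (auto intro!: sum.neutral)
    then show ?thesis using pd[of "\<lambda>x. if x = a then 1 else 0"] unfolding expand by auto
  qed
  define k' where "k' x y = k x y - k x a * k a y / k a a" for x y
  have "\<exists>w. \<forall>x\<in>B. (\<Sum>y\<in>B. k' x y * w y) = r x - k x a * r a / k a a"
  proof (rule insert.IH)
    show "k' x y = k' y x" if "x \<in> B" "y \<in> B" for x y
      using that sym[of x y] sym[of x a] sym[of y a] by (simp add: k'_def)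
    fix c :: "'a \<Rightarrow> real" assume c: "\<exists>x\<in>B. c x \<noteq> 0"
    define S where "S = (\<Sum>x\<in>B. c x * k x a)"
    \<comment> \<open>This value minimizes the quadratic form in the coordinate \<open>a\<close>,
      and the minimum is the form of the Schur complement at \<open>c\<close>.\<close>
    define d where "d = c(a := - S / k a a)"
    have d: "d x = c x" if "x \<in> B" for x using that insert.hyps by (auto simp: d_def)
    have "0 < (\<Sum>x\<in>insert a B. \<Sum>y\<in>insert a B. d x * d y * k x y)"
      by (rule pd) (use c d in auto)
    also have "\<dots> = (d a)\<^sup>2 * k a a + 2 * d a * S + (\<Sum>x\<in>B. \<Sum>y\<in>B. c x * c y * k x y)"
      unfolding expand S_def by (simp add: d)
    also have "\<dots> = (\<Sum>x\<in>B. \<Sum>y\<in>B. c x * c y * k x y) - S * S / k a a"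
      using kaa by (simp add: d_def power2_eq_square field_simps)
    also have "S * S / k a a = (\<Sum>x\<in>B. \<Sum>y\<in>B. c x * c y * (k x a * k a y / k a a))"
    proof -
      have "S = (\<Sum>y\<in>B. c y * k a y)" unfolding S_def using sym by (intro sum.cong) auto
      then have "S * S / k a a = (\<Sum>x\<in>B. c x * k x a) * (\<Sum>y\<in>B. c y * k a y) / k a a"
        using S_def by simp
      then show ?thesis by (simp add: sum_product sum_divide_distrib mult_ac)
    qed
    also have "(\<Sum>x\<in>B. \<Sum>y\<in>B. c x * c y * k x y) - \<dots> = (\<Sum>x\<in>B. \<Sum>y\<in>B. c x * c y * k' x y)"
      by (simp add: k'_def sum_subtractf[symmetric] algebra_simps)
    finally show "0 < (\<Sum>x\<in>B. \<Sum>y\<in>B. c x * c y * k' x y)" .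
  qed
  then obtain w where w: "\<And>x. x \<in> B \<Longrightarrow> (\<Sum>y\<in>B. k' x y * w y) = r x - k x a * r a / k a a" by blast
  define T where "T = (\<Sum>y\<in>B. k a y * w y)"
  define v where "v = w(a := (r a - T) / k a a)"
  have v: "(\<Sum>y\<in>B. k x y * v y) = (\<Sum>y\<in>B. k x y * w y)" for x
    using insert.hyps by (intro sum.cong) (auto simp: v_def)
  have "(\<Sum>y\<in>insert a B. k x y * v y) = r x" if "x \<in> insert a B" for x
  proof -
    have s: "(\<Sum>y\<in>insert a B. k x y * v y) = k x a * ((r a - T) / k a a) + (\<Sum>y\<in>B. k x y * w y)"
      using insert.hyps by (simp add: v) (simp add: v_def)
    show ?thesis
    proof (cases "x = a")
      case True
      then show ?thesis using s kaa by (simp add: T_def)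
    next
      case False
      then have "x \<in> B" using that by auto
      have "(\<Sum>y\<in>B. k' x y * w y) = (\<Sum>y\<in>B. k x y * w y) - k x a / k a a * T"
        by (simp add: k'_def T_def sum_distrib_left sum_subtractf algebra_simps)
      with w[OF \<open>x \<in> B\<close>] have "(\<Sum>y\<in>B. k x y * w y) = r x - k x a * r a / k a a + k x a / k a a * T"
        by simp
      then show ?thesis unfolding s using kaa by (simp add: field_simps)
    qed
  qed
  then show ?case by blast
qed simp

section \<open>Magnitude of a finite set as the best constant in an energy inequality\<close>

definition exp_energy :: "'a::metric_space set \<Rightarrow> ('a \<Rightarrow> real) \<Rightarrow> real" where
  "exp_energy A c = (\<Sum>x\<in>A. \<Sum>y\<in>A. c x * c y * exp (- dist x y))"

text \<open>In the energy form a weighting represents the total mass: its pairing with any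
  \<open>c\<close> is \<open>sum c A\<close>, and in particular its own energy is the
  magnitude.\<close>

lemma exp_energy_weighting:
  assumes "weighting A w"
  shows "exp_energy A (\<lambda>x. s * c x + t * w x) = s\<^sup>2 * exp_energy A c + 2 * s * t * sum c A + t\<^sup>2 * sum w A"
proof -
  have w: "(\<Sum>y\<in>A. exp (- dist x y) * w y) = 1" if "x \<in> A" for x
    using assms that by (simp add: weighting_def)
  have 1: "(\<Sum>x\<in>A. \<Sum>y\<in>A. c x * w y * exp (- dist x y)) = sum c A" for c
  proof (rule sum.cong[OF refl])
    fix x assume "x \<in> A"
    have "(\<Sum>y\<in>A. c x * w y * exp (- dist x y)) = c x * (\<Sum>y\<in>A. exp (- dist x y) * w y)"
      by (simp add: sum_distrib_left mult_ac)
    then show "(\<Sum>y\<in>A. c x * w y * exp (- dist x y)) = c x" using w[OF \<open>x \<in> A\<close>] by simp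
  qed
  have 2: "(\<Sum>x\<in>A. \<Sum>y\<in>A. w x * c y * exp (- dist x y)) = sum c A"
    by (subst sum.swap) (use 1[of c] in \<open>simp add: dist_commute mult.commute[of "w _"]\<close>)
  have "exp_energy A (\<lambda>x. s * c x + t * w x) = s\<^sup>2 * exp_energy A c
     + s * t * (\<Sum>x\<in>A. \<Sum>y\<in>A. c x * w y * exp (- dist x y)) + s * t * (\<Sum>x\<in>A. \<Sum>y\<in>A. w x * c y * exp (- dist x y))
     + t\<^sup>2 * (\<Sum>x\<in>A. \<Sum>y\<in>A. w x * w y * exp (- dist x y))"
    unfolding exp_energy_def sum_distrib_left sum.distrib[symmetric]
    by (intro sum.cong refl) (simp add: power2_eq_square algebra_simps)
  then show ?thesis unfolding 1 2 by simp
qed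

text \<open>With the next lemma, \<open>finite_magnitude A\<close> is the least
  \<open>V \<ge> 0\<close> such that \<open>(sum c A)\<^sup>2 \<le> V * exp_energy A c\<close> for
  all \<open>c\<close>. This half bounds the magnitude from below by trial coefficients; the other
  bounds it from above without computing a weighting.\<close>

lemma sum_square_le_energy_magnitude:
  assumes w: "weighting A w" and nonneg: "\<And>c. 0 \<le> exp_energy A c"
  shows "(sum c A)\<^sup>2 \<le> exp_energy A c * finite_magnitude A"
  unfolding finite_magnitude_eq[OF w]
proof (rule discriminant_le)
  show "0 \<le> x\<^sup>2 * exp_energy A c + 2 * x * y * sum c A + y\<^sup>2 * sum w A" for x y
    unfolding exp_energy_weighting[OF w, symmetric] by (rule nonneg)
qed

lemma finite_magnitude_le:
  assumes w: "weighting A w" and V: "V \<ge> 0" "\<And>c. (sum c A)\<^sup>2 \<le> V * exp_energy A c"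
  shows "finite_magnitude A \<le> V"
proof -
  have "(sum w A)\<^sup>2 \<le> V * sum w A"
    using V(2)[of w] exp_energy_weighting[OF w, of 0 w 1] by simp
  then have "sum w A \<le> V" using V(1) by (metis mult_le_cancel_right not_le_imp_less order_le_less_trans power2_eq_square not_less)
  then show ?thesis by (simp add: finite_magnitude_eq[OF w])
qed

lemma finite_magnitude_translation:
  fixes c :: "'a::real_normed_vector"
  shows "finite_magnitude ((+) c ` A) = finite_magnitude A"
proof -
  have "(\<exists>w. weighting ((+) c ` A) w \<and> m = sum w ((+) c ` A)) \<longleftrightarrow> (\<exists>w. weighting A w \<and> m = sum w A)" for m
  proof
    assume "\<exists>w. weighting ((+) c ` A) w \<and> m = sum w ((+) c ` A)"
    then obtain w where "weighting ((+) c ` A) w" "m = sum w ((+) c ` A)" by blast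
    then show "\<exists>w. weighting A w \<and> m = sum w A"
      by (intro exI[of _ "\<lambda>x. w (c + x)"]) (simp add: weighting_def sum.reindex)
  next
    assume "\<exists>w. weighting A w \<and> m = sum w A"
    then obtain w where "weighting A w" "m = sum w A" by blast
    then show "\<exists>w. weighting ((+) c ` A) w \<and> m = sum w ((+) c ` A)"
      by (intro exI[of _ "\<lambda>x. w (x - c)"]) (simp add: weighting_def sum.reindex)
  qed
  then show ?thesis by (simp add: finite_magnitude_def)
qed

lemma magnitude_translation:
  fixes c :: "'a::real_normed_vector"
  shows "magnitude ((+) c ` X) = magnitude X"
proof -
  have "{A. finite A \<and> A \<subseteq> (+) c ` X} = (`) ((+) c) ` {A. finite A \<and> A \<subseteq> X}"
  proof (intro equalityI subsetI)
    fix A assume "A \<in> {A. finite A \<and> A \<subseteq> (+) c ` X}"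
    then have "finite A" "A \<subseteq> (+) c ` X" by auto
    then show "A \<in> (`) ((+) c) ` {A. finite A \<and> A \<subseteq> X}"
      using finite_subset_image by (metis (mono_tags, lifting) image_eqI mem_Collect_eq)
  qed auto
  then show ?thesis unfolding magnitude_def by (simp add: image_image finite_magnitude_translation)
qed

section \<open>Approximation of densities on the ball by finite sets\<close>

lemma measurable_finite_discretization:
  fixes S :: "'a::euclidean_space set"
  assumes "compact S" "S \<noteq> {}" "e > 0"
  shows "\<exists>p. p \<in> borel_measurable borel \<and> finite (range p) \<and> range p \<subseteq> S \<and> (\<forall>y\<in>S. dist y (p y) < e)"
proof -
  obtain a0 where a0: "a0 \<in> S" using assms by auto
  obtain K where K: "finite K" "K \<subseteq> S" "S \<subseteq> (\<Union>x\<in>K. ball x e)"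
    using seq_compact_imp_totally_bounded[OF compact_imp_seq_compact[OF assms(1)], rule_format, OF assms(3)] by blast
  obtain xs where xs: "set xs = K" using finite_list[OF K(1)] by blast
  \<comment> \<open>The first centre of the list within distance \<open>e\<close>: nested
    conditionals over balls are measurable. Off the cover, \<open>a0\<close> serves as a default
    inside \<open>S\<close>.\<close>
  define pr where "pr xs = foldr (\<lambda>a g y. if dist y a < e then a else g y) xs (\<lambda>_. a0)" for xs :: "'a list"
  have pr_simps: "pr [] = (\<lambda>_. a0)" "pr (a # xs) = (\<lambda>y. if dist y a < e then a else pr xs y)" for a xs
    unfolding pr_def by simp_all
  have m: "pr xs \<in> borel_measurable borel" for xs
    by (induction xs) (auto simp: pr_simps intro!: measurable_If)
  have r: "range (pr xs) \<subseteq> insert a0 (set xs)" for xs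
    by (induction xs) (auto simp: pr_simps)
  have d: "dist y (pr xs y) < e" if "\<exists>a\<in>set xs. dist y a < e" for y xs
    using that by (induction xs) (auto simp: pr_simps)
  show ?thesis
  proof (intro exI[of _ "pr xs"] conjI ballI m)
    show "finite (range (pr xs))" by (rule finite_subset[OF r]) simp
    show "range (pr xs) \<subseteq> S" using r[of xs] xs K(2) a0 by auto
    show "dist y (pr xs y) < e" if "y \<in> S" for y
    proof (rule d)
      have "\<exists>a\<in>set xs. y \<in> ball a e" using K(3) that xs by blast
      then show "\<exists>a\<in>set xs. dist y a < e" by (simp add: dist_commute)
    qed
  qed
qed

lemma abs_exp_minus_diff_le: "\<bar>exp (- a) - exp (- b)\<bar> \<le> \<bar>a - b\<bar>" if "0 \<le> a" "0 \<le> b" for a b :: real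
proof -
  have *: "exp (- a) - exp (- b) \<le> b - a" if "0 \<le> a" "a \<le> b" for a b :: real
  proof -
    have "exp (- a) - exp (- b) = exp (- a) * (1 - exp (- (b - a)))" by (simp add: algebra_simps exp_add[symmetric])
    also have "\<dots> \<le> 1 * (b - a)"
    proof (rule mult_mono)
      show "1 - exp (- (b - a)) \<le> b - a"
        using exp_ge_add_one_self[of "- (b - a)"] by linarith
    qed (use that in auto)
    finally show ?thesis by simp
  qed
  show ?thesis
  proof (cases "a \<le> b")
    case True
    then have "exp (- b) \<le> exp (- a)" by simp
    then show ?thesis using *[of a b] that True by simp
  next
    case False
    then have "exp (- a) \<le> exp (- b)" by simp
    then show ?thesis using *[of b a] that False by simp
  qed
qed

text \<open>The signed measure with density \<open>g\<close> is pushed forward along a finite-valued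
  map that moves points by less than \<open>e\<close>. This preserves the total mass exactly. As
  \<open>exp (- r)\<close> is 1-Lipschitz for \<open>r \<ge> 0\<close>, it raises the energy by at
  most \<open>2 * e * G\<^sup>2 * m\<^sup>2\<close>.\<close>

lemma energy_discretization:
  fixes g :: "'a::euclidean_space \<Rightarrow> real"
  assumes R: "R \<ge> 0" and g [measurable]: "g \<in> borel_measurable borel" and G: "\<And>x. norm x \<le> R \<Longrightarrow> \<bar>g x\<bar> \<le> G"
    and "\<epsilon> > 0"
  shows "\<exists>(A::'a set) c. finite A \<and> A \<subseteq> cball 0 R \<and> sum c A = (LINT x|ball_measure R. g x) \<and>
    exp_energy A c \<le> (LINT x|ball_measure R. LINT y|ball_measure R. g x * g y * exp (- dist x y)) + \<epsilon>"
proof -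
  define M where "M = (ball_measure R :: 'a measure)"
  have [measurable_cong, simp]: "sets M = sets borel" and [simp]: "space M = UNIV" by (simp_all add: M_def)
  have fM: "finite_measure M" unfolding M_def by (rule finite_measure_ball_measure)
  interpret M: finite_measure M by fact
  interpret P: pair_sigma_finite M M ..
  have G0: "G \<ge> 0" using G[of 0] R by auto
  have AE: "AE x in M. norm x \<le> R" unfolding M_def by (rule AE_ball_measure)
  define m where "m = measure M UNIV"
  have m0: "m \<ge> 0" by (simp add: m_def)
  \<comment> \<open>Chosen against the error \<open>2 * e * G\<^sup>2 * m\<^sup>2\<close>; the added
    1 keeps the denominator positive when \<open>G\<close> or \<open>m\<close> is 0.\<close>
  define e where "e = \<epsilon> / (2 * (G\<^sup>2 * m\<^sup>2 + 1))"
  have e: "e > 0" unfolding e_def using \<open>\<epsilon> > 0\<close> by (intro divide_pos_pos) (auto intro: add_nonneg_pos)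
  obtain p :: "'a \<Rightarrow> 'a" where p [measurable]: "p \<in> borel_measurable borel" and p': "finite (range p)" "range p \<subseteq> cball 0 R"
    "\<And>y. norm y \<le> R \<Longrightarrow> dist y (p y) < e"
    using measurable_finite_discretization[of "cball (0::'a) R" e] e R by fastforce
  define A where "A = range p"
  define c where "c a = (LINT x|M. indicator {a} (p x) * g x)" for a
  have int_bd: "integrable M h" if "h \<in> borel_measurable borel" "\<And>x. norm x \<le> R \<Longrightarrow> \<bar>h x\<bar> \<le> B" for h :: "'a \<Rightarrow> real" and B
    by (rule M.integrable_const_bound[of _ B]) (use AE that in \<open>auto elim!: eventually_mono\<close>)
  have fA: "finite A" using p' by (simp add: A_def)
  have int_c: "integrable M (\<lambda>x. indicator {a} (p x) * g x)" for a
    by (rule int_bd[of _ G]) (use G G0 in \<open>auto simp: indicator_def\<close>)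
  have pick: "(\<Sum>a\<in>A. f a * indicator {a} (p x)) = f (p x)" for f :: "'a \<Rightarrow> real" and x
  proof -
    have "(\<Sum>a\<in>A. f a * indicator {a} (p x)) = (\<Sum>a\<in>A. if a = p x then f a else 0)"
      by (rule sum.cong) (auto simp: indicator_def)
    also have "\<dots> = f (p x)" using fA by (simp add: A_def)
    finally show ?thesis .
  qed
  have "sum c A = (LINT x|M. (\<Sum>a\<in>A. indicator {a} (p x) * g x))"
    unfolding c_def by (rule Bochner_Integration.integral_sum[symmetric]) (rule int_c)
  also have "\<dots> = (LINT x|M. g x)"
    using pick[of "\<lambda>_. 1"] by (simp add: sum_distrib_right[symmetric])
  finally have sum_c: "sum c A = (LINT x|M. g x)" .
  have gf: "(\<Sum>a\<in>A. f a * c a) = (LINT x|M. f (p x) * g x)" for f :: "'a \<Rightarrow> real"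
  proof -
    have "(\<Sum>a\<in>A. f a * c a) = (\<Sum>a\<in>A. (LINT x|M. f a * (indicator {a} (p x) * g x)))"
      by (simp add: c_def)
    also have "\<dots> = (LINT x|M. (\<Sum>a\<in>A. f a * (indicator {a} (p x) * g x)))"
      by (rule Bochner_Integration.integral_sum[symmetric]) (intro integrable_mult_right int_c)
    also have "(\<lambda>x. \<Sum>a\<in>A. f a * (indicator {a} (p x) * g x)) = (\<lambda>x. f (p x) * g x)"
      using pick[of f] by (simp add: sum_distrib_right[symmetric] mult.assoc[symmetric])
    finally show ?thesis .
  qed
  have "exp_energy A c = (\<Sum>x\<in>A. (\<Sum>y\<in>A. exp (- dist x y) * c y) * c x)"
    unfolding exp_energy_def by (simp add: sum_distrib_left sum_distrib_right mult_ac)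
  also have "\<dots> = (LINT x|M. (LINT y|M. exp (- dist (p x) (p y)) * g y) * g x)"
    by (simp only: gf)
  finally have E0: "exp_energy A c = (LINT x|M. (LINT y|M. exp (- dist (p x) (p y)) * g y) * g x)" .
  have E: "exp_energy A c = (LINT x|M. LINT y|M. g x * g y * exp (- dist (p x) (p y)))"
  proof -
    have "(LINT y|M. exp (- dist (p x) (p y)) * g y) * g x = (LINT y|M. g x * g y * exp (- dist (p x) (p y)))" for x
      by (subst integral_mult_left_zero[symmetric]) (simp add: mult_ac)
    then show ?thesis using E0 by simp
  qed
  have K1: "\<bar>exp (- dist (p x) (p y)) - exp (- dist x y)\<bar> \<le> 2 * e" if "norm x \<le> R" "norm y \<le> R" for x y
  proof -
    have "\<bar>dist (p x) (p y) - dist x y\<bar> \<le> dist x (p x) + dist y (p y)"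
      using dist_triangle[of "p x" "p y" x] dist_triangle[of x "p y" y] dist_triangle[of x y "p x"] dist_triangle[of "p x" y "p y"]
      by (simp add: dist_commute abs_le_iff)
    then show ?thesis using p'(3)[OF that(1)] p'(3)[OF that(2)] abs_exp_minus_diff_le[of "dist (p x) (p y)" "dist x y"] by simp
  qed
  have inner_int: "integrable M (\<lambda>y. g x * g y * exp (- h x y))"
    if "norm x \<le> R" "\<And>x y. h x y \<ge> 0" "(\<lambda>y. h x y) \<in> borel_measurable borel" for x and h :: "'a \<Rightarrow> 'a \<Rightarrow> real"
  proof (rule int_bd[of _ "G * G * 1"])
    show "\<bar>g x * g y * exp (- h x y)\<bar> \<le> G * G * 1" if "norm y \<le> R" for y
      unfolding abs_mult using G[OF that] G[OF \<open>norm x \<le> R\<close>] G0 \<open>\<And>x y. h x y \<ge> 0\<close> by (intro mult_mono) auto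
  qed (use that in measurable)
  have outer_int: "integrable M (\<lambda>x. LINT y|M. g x * g y * exp (- h x y))"
    if h: "\<And>x y. h x y \<ge> 0" and [measurable]: "(\<lambda>(x, y). h x y) \<in> borel_measurable (borel \<Otimes>\<^sub>M borel)" for h :: "'a \<Rightarrow> 'a \<Rightarrow> real"
  proof (rule int_bd[of _ "G * G * 1 * m"])
    have [measurable]: "(\<lambda>(x, y). g x * g y * exp (- h x y)) \<in> borel_measurable (borel \<Otimes>\<^sub>M M)" by measurable
    show "(\<lambda>x. LINT y|M. g x * g y * exp (- h x y)) \<in> borel_measurable borel" by measurable
    show "\<bar>LINT y|M. g x * g y * exp (- h x y)\<bar> \<le> G * G * 1 * m" if x: "norm x \<le> R" for x
    proof -
      have "\<bar>LINT y|M. g x * g y * exp (- h x y)\<bar> \<le> (LINT y|M. \<bar>g x * g y * exp (- h x y)\<bar>)"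
        by (rule integral_abs_bound)
      also have "\<dots> \<le> (LINT y|M. G * G * 1)"
      proof (rule integral_mono_AE)
        show "integrable M (\<lambda>y. \<bar>g x * g y * exp (- h x y)\<bar>)"
          by (intro integrable_abs inner_int x h) measurable
        show "AE y in M. \<bar>g x * g y * exp (- h x y)\<bar> \<le> G * G * 1"
          using AE
        proof eventually_elim
          case (elim y)
          show ?case
            unfolding abs_mult using G[OF elim] G[OF x] G0 h by (intro mult_mono) auto
        qed
      qed simp
      finally show ?thesis by (simp add: m_def mult.commute)
    qed
  qed
  have i1: "integrable M (\<lambda>y. g x * g y * exp (- dist (p x) (p y)))" "integrable M (\<lambda>y. g x * g y * exp (- dist x y))" if "norm x \<le> R" for x
    by (rule inner_int[OF that]; simp)+
  have "exp_energy A c - (LINT x|M. LINT y|M. g x * g y * exp (- dist x y)) =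
    (LINT x|M. (LINT y|M. g x * g y * exp (- dist (p x) (p y))) - (LINT y|M. g x * g y * exp (- dist x y)))"
    unfolding E by (rule Bochner_Integration.integral_diff[symmetric]; rule outer_int) measurable
  also have "\<dots> \<le> (LINT x|M. G * G * (2 * e) * m)"
  proof (rule integral_mono_AE)
    show "integrable M (\<lambda>x. (LINT y|M. g x * g y * exp (- dist (p x) (p y))) - (LINT y|M. g x * g y * exp (- dist x y)))"
      by (rule Bochner_Integration.integrable_diff; rule outer_int) measurable
    show "AE x in M. (LINT y|M. g x * g y * exp (- dist (p x) (p y))) - (LINT y|M. g x * g y * exp (- dist x y)) \<le> G * G * (2 * e) * m"
      using AE
    proof eventually_elim
      case (elim x)
      have "(LINT y|M. g x * g y * exp (- dist (p x) (p y))) - (LINT y|M. g x * g y * exp (- dist x y))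
        = (LINT y|M. g x * g y * exp (- dist (p x) (p y)) - g x * g y * exp (- dist x y))"
        using i1[OF elim] by simp
      also have "\<dots> \<le> (LINT y|M. G * G * (2 * e))"
      proof (rule integral_mono_AE)
        show "integrable M (\<lambda>y. g x * g y * exp (- dist (p x) (p y)) - g x * g y * exp (- dist x y))"
          using i1[OF elim] by simp
        show "AE y in M. g x * g y * exp (- dist (p x) (p y)) - g x * g y * exp (- dist x y) \<le> G * G * (2 * e)"
          using AE
        proof eventually_elim
          case (elim y)
          have "g x * g y * exp (- dist (p x) (p y)) - g x * g y * exp (- dist x y) \<le> \<bar>g x * g y * (exp (- dist (p x) (p y)) - exp (- dist x y))\<bar>"
            by (simp add: right_diff_distrib)
          also have "\<dots> \<le> G * G * (2 * e)"
            unfolding abs_mult using G[OF elim] G[OF \<open>norm x \<le> R\<close>] G0 K1[OF \<open>norm x \<le> R\<close> elim] by (intro mult_mono) auto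
          finally show ?case .
        qed
      qed simp
      also have "\<dots> = G * G * (2 * e) * m" by (simp add: m_def mult.commute)
      finally show ?case .
    qed
  qed simp
  also have "\<dots> = (G\<^sup>2 * m\<^sup>2) * (2 * e)" by (simp add: m_def power2_eq_square)
  also have "\<dots> \<le> (G\<^sup>2 * m\<^sup>2 + 1) * (2 * e)" using e by (intro mult_right_mono) auto
  also have "\<dots> = \<epsilon>"
  proof -
    have "G\<^sup>2 * m\<^sup>2 + 1 > 0" by (auto intro: add_nonneg_pos)
    moreover have "d * (2 * (\<epsilon> / (2 * d))) = \<epsilon>" if "d > 0" for d :: real using that by simp
    ultimately show ?thesis unfolding e_def by blast
  qed
  finally have "exp_energy A c \<le> (LINT x|M. LINT y|M. g x * g y * exp (- dist x y)) + \<epsilon>" by simp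
  note bound = this
  have "A \<subseteq> cball 0 R" using p'(2) by (simp add: A_def)
  with fA sum_c bound have "finite A \<and> A \<subseteq> cball 0 R \<and> sum c A = (LINT x|ball_measure R. g x) \<and>
    exp_energy A c \<le> (LINT x|ball_measure R. LINT y|ball_measure R. g x * g y * exp (- dist x y)) + \<epsilon>"
    unfolding M_def by simp
  then show ?thesis by (intro exI)
qed

section \<open>Weights on an interval\<close>

text \<open>Over the reals \<open>poly (exp_antideriv p) t * exp (- t)\<close> is the integral of
  \<open>p s * exp (- s)\<close> over \<open>s \<ge> t\<close>; integrating by parts until the
  derivatives vanish produces the sum. As a finite sum it makes sense over the rationals as
  well.\<close>

definition exp_antideriv :: "'a::field_char_0 poly \<Rightarrow> 'a poly" where
  "exp_antideriv p = (\<Sum>i\<le>degree p. (pderiv ^^ i) p)"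

lemma pderiv_sum: "pderiv (\<Sum>i\<in>A. f i) = (\<Sum>i\<in>A. pderiv (f i))"
  by (induction A rule: infinite_finite_induct) (auto simp: pderiv_add)

lemma exp_deriv_antideriv: "exp_deriv (exp_antideriv p) = - p"
proof -
  have "pderiv (exp_antideriv p) = (\<Sum>i\<le>degree p. (pderiv ^^ Suc i) p)"
    by (simp add: exp_antideriv_def pderiv_sum)
  moreover have "(pderiv ^^ Suc (degree p)) p = 0"
    by (rule poly_eqI) (simp add: coeff_higher_pderiv coeff_eq_0 del: funpow.simps)
  then have "(\<Sum>i\<le>degree p. (pderiv ^^ i) p) = (\<Sum>i\<le>Suc (degree p). (pderiv ^^ i) p)"
    by simp
  then have "exp_antideriv p = p + (\<Sum>i\<le>degree p. (pderiv ^^ Suc i) p)"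
    unfolding exp_antideriv_def by (simp only: sum.atMost_Suc_shift) simp
  ultimately show ?thesis by (simp add: exp_deriv_def)
qed

lemma exp_deriv_eq_0_iff: "exp_deriv p = 0 \<longleftrightarrow> p = 0"
proof
  assume "exp_deriv p = 0"
  then have *: "pderiv p = p" by (simp add: exp_deriv_def)
  then have "degree p = degree p - 1" using degree_pderiv[of p] by simp
  then have "pderiv p = 0" by (simp add: pderiv_eq_0_iff)
  then show "p = 0" using * by simp
qed (simp add: exp_deriv_0)

text \<open>Linearity, shifts and compatibility with \<open>of_rat\<close> are all checked through
  this characterization, after applying \<open>exp_deriv\<close>, and not on the defining
  sum.\<close>

lemma exp_antideriv_unique: "exp_deriv r = - p \<Longrightarrow> exp_antideriv p = r"
  using exp_deriv_eq_0_iff[of "exp_antideriv p - r"] by (simp add: exp_deriv_diff exp_deriv_antideriv)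

lemma exp_deriv_uminus: "exp_deriv (- p) = - exp_deriv p"
  by (simp add: exp_deriv_def pderiv_minus)

lemma exp_antideriv_add: "exp_antideriv (p + r) = exp_antideriv p + exp_antideriv r"
  by (rule exp_antideriv_unique) (simp add: exp_deriv_add exp_deriv_antideriv)

lemma exp_antideriv_smult: "exp_antideriv (smult c p) = smult c (exp_antideriv p)"
  by (rule exp_antideriv_unique) (simp add: exp_deriv_smult exp_deriv_antideriv)

lemma exp_antideriv_0: "exp_antideriv 0 = 0"
  by (rule exp_antideriv_unique) (simp add: exp_deriv_0)

lemma exp_antideriv_sum: "exp_antideriv (\<Sum>i\<in>A. f i) = (\<Sum>i\<in>A. exp_antideriv (f i))"
  by (induction A rule: infinite_finite_induct) (auto simp: exp_antideriv_add exp_antideriv_0)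

lemma exp_antideriv_exp_deriv: "exp_antideriv (exp_deriv p) = - p"
  by (rule exp_antideriv_unique) (simp add: exp_deriv_uminus)

lemma exp_antideriv_shift: "exp_antideriv (pcompose p [:t, 1:]) = pcompose (exp_antideriv p) [:t, 1:]"
  by (rule exp_antideriv_unique)
    (simp add: exp_deriv_def pderiv_pcompose pderiv_pCons pcompose_diff[symmetric] exp_deriv_antideriv[unfolded exp_deriv_def] pcompose_uminus[symmetric])

text \<open>The integral of \<open>p s * exp (- s)\<close> over \<open>s \<ge> 0\<close>, in a form
  available over any field of characteristic 0.\<close>

definition exp_moment :: "'a::field_char_0 poly \<Rightarrow> 'a" where
  "exp_moment p = poly (exp_antideriv p) 0"

lemma exp_moment_add: "exp_moment (p + r) = exp_moment p + exp_moment r"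
  and exp_moment_smult: "exp_moment (smult c p) = c * exp_moment p"
  by (simp_all add: exp_moment_def exp_antideriv_add exp_antideriv_smult)

lemma exp_moment_sum: "exp_moment (\<Sum>i\<in>A. f i) = (\<Sum>i\<in>A. exp_moment (f i))"
  by (simp add: exp_moment_def exp_antideriv_sum poly_sum)

text \<open>Integration by parts in the term \<open>s * k' s * s ^ i\<close> of the recursion. For
  \<open>i = 2 * j\<close> the factor vanishes exactly at \<open>q = j\<close>; so the even moments
  of the kernel vanish below order \<open>2 * q\<close> and not from there on. This is the zero of
  order \<open>2 * q\<close> of its Fourier transform at 0.\<close>

lemma exp_moment_radial_poly_Suc:
  "exp_moment (radial_poly (Suc q) * monom 1 i) = (1 - of_nat (i + 1) / of_nat (2 * q + 1)) * exp_moment (radial_poly q * monom (1::'a::field_char_0) i)"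
proof -
  let ?P = "radial_poly q :: 'a poly"
  have "exp_deriv (?P * monom 1 (Suc i)) = pCons 0 (exp_deriv ?P) * monom 1 i + smult (of_nat (i + 1)) (?P * monom 1 i)"
  proof -
    have 1: "pCons 0 r * monom 1 i = r * monom (1::'a) (Suc i)" for r by (simp add: monom_Suc)
    have 2: "pderiv (monom (1::'a) (Suc i)) = smult (of_nat (i + 1)) (monom 1 i)"
      by (simp add: pderiv_monom smult_monom)
    show ?thesis unfolding exp_deriv_def pderiv_mult 1 2 mult_smult_right by (simp only: algebra_simps)
  qed
  then have "exp_moment (exp_deriv (?P * monom 1 (Suc i))) = exp_moment (pCons 0 (exp_deriv ?P) * monom 1 i) + of_nat (i + 1) * exp_moment (?P * monom 1 i)"
    by (simp only: exp_moment_add exp_moment_smult)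
  moreover have "exp_moment (exp_deriv (?P * monom 1 (Suc i))) = 0"
    by (simp add: exp_moment_def exp_antideriv_exp_deriv poly_monom)
  ultimately have "exp_moment (pCons 0 (exp_deriv ?P) * monom 1 i) = - of_nat (i + 1) * exp_moment (?P * monom 1 i)"
    by (metis add_eq_0_iff2 mult_minus_left)
  moreover have "radial_poly (Suc q) * monom 1 i = ?P * monom 1 i + smult (1 / of_nat (2 * q + 1)) (pCons 0 (exp_deriv ?P) * monom 1 i)"
    by (simp add: exp_deriv_def distrib_right)
  moreover have "e + 1 / d * (- c * e) = (1 - c / d) * e" for c d e :: 'a by (simp add: left_diff_distrib)
  ultimately show ?thesis by (simp only: exp_moment_add exp_moment_smult)
qed

lemma exp_moment_radial_poly_even: "j < q \<Longrightarrow> exp_moment (radial_poly q * monom (1::'a::field_char_0) (2 * j)) = 0"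
proof (induction q)
  case (Suc q)
  have "of_nat (2 * q + 1) \<noteq> (0::'a)" by (metis Suc_eq_plus1 of_nat_neq_0)
  then show ?case using Suc less_Suc_eq by (auto simp: exp_moment_radial_poly_Suc simp del: radial_poly.simps)
qed simp

lemma exp_moment_monom: "exp_moment (monom (1::'a::field_char_0) i) = fact i"
proof (induction i)
  case 0
  have "exp_antideriv (monom (1::'a) 0) = monom 1 0" by (rule exp_antideriv_unique) (simp add: exp_deriv_def pderiv_monom)
  then show ?case by (simp add: exp_moment_def poly_monom)
next
  case (Suc i)
  have "exp_deriv (monom (1::'a) (Suc i)) = smult (of_nat (Suc i)) (monom 1 i) + smult (-1) (monom 1 (Suc i))"
    by (simp add: exp_deriv_def pderiv_monom smult_monom minus_monom)
  then have "exp_moment (exp_deriv (monom (1::'a) (Suc i))) = of_nat (Suc i) * exp_moment (monom 1 i) + (-1) * exp_moment (monom 1 (Suc i))"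
    by (simp only: exp_moment_add exp_moment_smult)
  moreover have "exp_moment (exp_deriv (monom (1::'a) (Suc i))) = 0"
    by (simp add: exp_moment_def exp_antideriv_exp_deriv poly_monom)
  ultimately show ?case using Suc by simp
qed

lemma exp_moment_radial_poly_nonzero: "q \<le> j \<Longrightarrow> exp_moment (radial_poly q * monom (1::'a::field_char_0) (2 * j)) \<noteq> 0"
proof (induction q)
  case 0
  then show ?case by (simp add: exp_moment_monom)
next
  case (Suc q)
  have 1: "of_nat (2 * q + 1) \<noteq> (0::'a)" by (metis Suc_eq_plus1 of_nat_neq_0)
  have "of_nat (2 * j + 1) \<noteq> (of_nat (2 * q + 1) :: 'a)" using Suc.prems by (simp only: of_nat_eq_iff)
  then have "1 - of_nat (2 * j + 1) / of_nat (2 * q + 1) \<noteq> (0::'a)" using 1 by (simp add: field_simps)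
  then show ?case using Suc by (simp add: exp_moment_radial_poly_Suc del: radial_poly.simps)
qed

text \<open>Coefficient of \<open>t ^ k\<close> in \<open>radial_poly q (s - t)\<close>, as a polynomial in \<open>s\<close>.\<close>

definition radial_shift :: "nat \<Rightarrow> nat \<Rightarrow> 'a::field_char_0 poly" where
  "radial_shift q k = smult ((-1) ^ k / fact k) ((pderiv ^^ k) (radial_poly q))"

lemma degree_radial_poly: "degree (radial_poly q :: 'a::field_char_0 poly) \<le> q"
proof (induction q)
  case (Suc q)
  have "degree (pCons 0 (pderiv (radial_poly q) - radial_poly q) :: 'a poly) \<le> Suc q"
    by (rule order_trans[OF degree_pCons_le]) (use Suc degree_pderiv[of "radial_poly q :: 'a poly"] in \<open>auto intro!: degree_diff_le\<close>)
  then have "degree (smult (1 / of_nat (2 * q + 1)) (pCons 0 (pderiv (radial_poly q) - radial_poly q)) :: 'a poly) \<le> Suc q"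
    using degree_smult_le order_trans by blast
  then show ?case using Suc by (auto intro!: degree_add_le simp del: of_nat_Suc)
qed simp

lemma pcompose_radial_poly: "pcompose (radial_poly q) [:- t, 1:] = (\<Sum>k\<le>q. smult (t ^ k) (radial_shift q k :: real poly))"
proof (rule poly_eq_poly_eq_iff[THEN iffD1], rule ext)
  fix s
  have "poly (pcompose (radial_poly q) [:- t, 1:]) s = poly (radial_poly q) (s + (- t))"
    by (simp add: poly_pcompose)
  also have "\<dots> = (\<Sum>k<Suc q. (- t) ^ k / fact k * poly ((pderiv ^^ k) (radial_poly q)) s)"
    by (rule poly_taylor) (use degree_radial_poly[of q, where 'a = real] in auto)
  also have "\<dots> = poly (\<Sum>k\<le>q. smult (t ^ k) (radial_shift q k)) s"
    unfolding poly_sum lessThan_Suc_atMost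
    by (intro sum.cong) (auto simp: radial_shift_def power_minus[of t])
  finally show "poly (pcompose (radial_poly q) [:- t, 1:]) s = poly (\<Sum>k\<le>q. smult (t ^ k) (radial_shift q k)) s" .
qed

text \<open>For the density \<open>v\<close> on \<open>{-R..R}\<close> with point masses \<open>b\<close> at the endpoints, these equations say that the
  potential has no component of the form \<open>t ^ k * exp (\<plusminus> t)\<close> on the interval.\<close>

definition boundary_balance :: "nat \<Rightarrow> real \<Rightarrow> real poly \<Rightarrow> real \<Rightarrow> bool" where
  "boundary_balance q R v b \<longleftrightarrow>
     (\<forall>k\<le>q. poly (exp_antideriv (radial_shift q k * v)) R = b * poly (radial_shift q k) R)"

text \<open>With the polynomial \<open>v\<close> continued beyond \<open>R\<close>, the integral is
  the tail from \<open>t\<close> minus the tail from \<open>R\<close>. The shift by \<open>t\<close>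
  makes the first a moment, polynomial in \<open>t\<close>. In the second, expanding
  \<open>radial_poly q\<close> at \<open>s - t\<close> in powers of \<open>t\<close> isolates the
  quantities that \<open>boundary_balance\<close> prescribes.\<close>

lemma half_line_potential:
  assumes "t \<le> R"
  shows "integral {t..R} (\<lambda>s. radial_kernel q (t - s) * poly v s) =
    exp_moment (radial_poly q * pcompose v [:t, 1:])
     - exp (t - R) * (\<Sum>k\<le>q. t ^ k * poly (exp_antideriv (radial_shift q k * v)) R)"
proof -
  define P where "P = pcompose (radial_poly q) [:- t, 1:] * v"
  have "((\<lambda>s. radial_kernel q (t - s) * poly v s) has_integral
     (- exp t * (poly (exp_antideriv P) R * exp (- R)) - - exp t * (poly (exp_antideriv P) t * exp (- t)))) {t..R}"
  proof (rule fundamental_theorem_of_calculus[OF assms])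
    fix s assume s: "s \<in> {t..R}"
    have "((\<lambda>s. - exp t * (poly (exp_antideriv P) s * exp (- s))) has_real_derivative
       - exp t * (poly (exp_deriv (exp_antideriv P)) s * exp (- s))) (at s within {t..R})"
      unfolding exp_deriv_def by (auto intro!: derivative_eq_intros simp: algebra_simps)
    also have "- exp t * (poly (exp_deriv (exp_antideriv P)) s * exp (- s)) = radial_kernel q (t - s) * poly v s"
      using s by (simp add: exp_deriv_antideriv P_def poly_pcompose radial_kernel_def exp_diff exp_minus field_simps)
    finally show "((\<lambda>s. - exp t * (poly (exp_antideriv P) s * exp (- s))) has_vector_derivative radial_kernel q (t - s) * poly v s) (at s within {t..R})"
      by (simp add: has_real_derivative_iff_has_vector_derivative)
  qed
  then have "integral {t..R} (\<lambda>s. radial_kernel q (t - s) * poly v s) = poly (exp_antideriv P) t - exp (t - R) * poly (exp_antideriv P) R"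
    by (simp add: integral_unique exp_diff exp_minus field_simps)
  moreover have "poly (exp_antideriv P) t = exp_moment (radial_poly q * pcompose v [:t, 1:])"
  proof -
    have "pcompose P [:t, 1:] = radial_poly q * pcompose v [:t, 1:]"
      by (simp add: P_def pcompose_mult pcompose_assoc[symmetric] pcompose_pCons)
    then have "exp_moment (radial_poly q * pcompose v [:t, 1:]) = poly (pcompose (exp_antideriv P) [:t, 1:]) 0"
      by (simp add: exp_moment_def exp_antideriv_shift[symmetric])
    then show ?thesis by (simp add: poly_pcompose)
  qed
  moreover have "poly (exp_antideriv P) R = (\<Sum>k\<le>q. t ^ k * poly (exp_antideriv (radial_shift q k * v)) R)"
    by (simp add: P_def pcompose_radial_poly sum_distrib_right exp_antideriv_sum exp_antideriv_smult poly_sum)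
  ultimately show ?thesis by simp
qed

definition even_poly :: "nat \<Rightarrow> (nat \<Rightarrow> 'a::comm_ring_1) \<Rightarrow> 'a poly" where
  "even_poly q x = (\<Sum>j\<le>q. smult (x j) (monom 1 (2 * j)))"

lemma poly_even_poly: "poly (even_poly q x) s = (\<Sum>j\<le>q. x j * s ^ (2 * j))"
  by (simp add: even_poly_def poly_sum poly_monom)

text \<open>Adding the contributions of the two half lines doubles the even powers of the
  integration variable and cancels the odd ones. Among the even moments up to order
  \<open>2 * q\<close> only the last is nonzero, so the polynomial part of the potential is a
  constant governed by the top coefficient.\<close>

lemma exp_moment_even_shift:
  "exp_moment (radial_poly q * pcompose (even_poly q x) [:t, 1:]) + exp_moment (radial_poly q * pcompose (even_poly q x) [:- t, 1:])
   = 2 * exp_moment (radial_poly q * monom 1 (2 * q)) * (x q :: real)"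
proof -
  let ?P = "radial_poly q :: real poly"
  have one: "exp_moment (?P * pcompose (monom 1 (2 * j)) [:t, 1:]) + exp_moment (?P * pcompose (monom 1 (2 * j)) [:- t, 1:])
     = (if j = q then 2 * exp_moment (?P * monom 1 (2 * q)) else 0)" if "j \<le> q" for j
  proof -
    have "pcompose (monom 1 (2 * j)) [:t, 1:] + pcompose (monom 1 (2 * j)) [:- t, 1:] =
      (\<Sum>i\<le>2 * j. smult ((1 + (-1) ^ i) * of_nat (2 * j choose i) * t ^ (2 * j - i)) (monom 1 i))" (is "?L = ?R")
    proof (rule poly_eq_poly_eq_iff[THEN iffD1], rule ext)
      fix s
      have "(s + t) ^ (2 * j) = (\<Sum>i\<le>2 * j. of_nat (2 * j choose i) * s ^ i * t ^ (2 * j - i))"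
        by (rule binomial_ring)
      moreover have "(s + - t) ^ (2 * j) = (\<Sum>i\<le>2 * j. of_nat (2 * j choose i) * s ^ i * ((-1) ^ i * t ^ (2 * j - i)))"
      proof -
        have "(- t) ^ (2 * j - i) = (-1) ^ i * t ^ (2 * j - i)" if "i \<le> 2 * j" for i
          unfolding power_minus[of t] using that by (cases "even i") (auto simp: even_diff_nat)
        then show ?thesis unfolding binomial_ring by (intro sum.cong) auto
      qed
      ultimately have "(s + t) ^ (2 * j) + (s + - t) ^ (2 * j) = poly ?R s"
        by (simp add: poly_sum poly_monom sum.distrib[symmetric] algebra_simps)
      then show "poly ?L s = poly ?R s" by (simp add: poly_pcompose poly_monom add.commute)
    qed
    then have "exp_moment (?P * pcompose (monom 1 (2 * j)) [:t, 1:]) + exp_moment (?P * pcompose (monom 1 (2 * j)) [:- t, 1:])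
      = exp_moment (?P * ?R)"
      by (simp only: exp_moment_add[symmetric] distrib_left[symmetric])
    also have "\<dots> = (\<Sum>i\<le>2 * j. (1 + (-1) ^ i) * of_nat (2 * j choose i) * t ^ (2 * j - i) * exp_moment (?P * monom 1 i))"
      by (simp only: sum_distrib_left exp_moment_sum mult_smult_right exp_moment_smult)
    also have "\<dots> = (\<Sum>i\<le>2 * j. if i = 2 * j then (if j = q then 2 * exp_moment (?P * monom 1 (2 * q)) else 0) else 0)"
    proof (rule sum.cong[OF refl])
      fix i assume i: "i \<in> {..2 * j}"
      show "(1 + (-1) ^ i) * of_nat (2 * j choose i) * t ^ (2 * j - i) * exp_moment (?P * monom 1 i)
        = (if i = 2 * j then (if j = q then 2 * exp_moment (?P * monom 1 (2 * q)) else 0) else 0)"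
      proof (cases "even i")
        case True
        then obtain m where m: "i = 2 * m" by auto
        show ?thesis
        proof (cases "m < q")
          case True
          then show ?thesis using m that exp_moment_radial_poly_even[OF True, where 'a = real] by auto
        next
          case False
          then have "m = j" "j = q" using m i that by auto
          then show ?thesis using m by simp
        qed
      next
        case False
        then show ?thesis by auto
      qed
    qed
    also have "\<dots> = (if j = q then 2 * exp_moment (?P * monom 1 (2 * q)) else 0)" by simp
    finally show ?thesis .
  qed
  have "exp_moment (?P * pcompose (even_poly q x) [:t, 1:]) + exp_moment (?P * pcompose (even_poly q x) [:- t, 1:]) =
    (\<Sum>j\<le>q. x j * (exp_moment (?P * pcompose (monom 1 (2 * j)) [:t, 1:]) + exp_moment (?P * pcompose (monom 1 (2 * j)) [:- t, 1:])))"
    by (simp add: even_poly_def pcompose_sum pcompose_smult sum_distrib_left exp_moment_sum exp_moment_smult sum.distrib distrib_left)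
  also have "\<dots> = (\<Sum>j\<le>q. if j = q then x q * (2 * exp_moment (?P * monom 1 (2 * q))) else 0)"
    by (rule sum.cong) (auto simp: one)
  finally show ?thesis by simp
qed

text \<open>The integral is split at \<open>t\<close> and its left part is reflected, the density
  being even. Under \<open>boundary_balance\<close> the two exponential remainders are minus the
  potentials of point masses \<open>b\<close> at \<open>R\<close> and \<open>- R\<close>, so these
  masses cancel them.\<close>

lemma interval_potential:
  assumes t: "\<bar>t\<bar> \<le> R" and bal: "boundary_balance q R (even_poly q x) b"
  shows "integral {-R..R} (\<lambda>s. radial_kernel q (t - s) * poly (even_poly q x) s)
     + b * (radial_kernel q (t - R) + radial_kernel q (t + R))
   = 2 * exp_moment (radial_poly q * monom 1 (2 * q)) * x q"
proof -
  let ?v = "even_poly q x"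
  have bd: "(\<Sum>k\<le>q. t ^ k * poly (exp_antideriv (radial_shift q k * ?v)) R) = b * poly (radial_poly q) (R - t)" for t
  proof -
    have "poly (radial_poly q) (R - t) = poly (pcompose (radial_poly q) [:- t, 1:]) R" by (simp add: poly_pcompose)
    also have "\<dots> = (\<Sum>k\<le>q. t ^ k * poly (radial_shift q k) R)" by (simp add: pcompose_radial_poly poly_sum)
    finally show ?thesis using bal unfolding boundary_balance_def
      by (simp add: sum_distrib_left mult.left_commute)
  qed
  have half: "integral {t..R} (\<lambda>s. radial_kernel q (t - s) * poly ?v s) =
    exp_moment (radial_poly q * pcompose ?v [:t, 1:]) - b * radial_kernel q (t - R)" if "t \<le> R" for t
    unfolding half_line_potential[OF that] bd using that by (simp add: radial_kernel_def)
  have "integral {-R..R} (\<lambda>s. radial_kernel q (t - s) * poly ?v s) =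
     integral {-R..t} (\<lambda>s. radial_kernel q (t - s) * poly ?v s) + integral {t..R} (\<lambda>s. radial_kernel q (t - s) * poly ?v s)"
    using t by (intro Henstock_Kurzweil_Integration.integral_combine[symmetric] integrable_continuous_interval continuous_intros) auto
  also have "integral {-R..t} (\<lambda>s. radial_kernel q (t - s) * poly ?v s) = integral {-t..R} (\<lambda>s. radial_kernel q (t - - s) * poly ?v (- s))"
    using Henstock_Kurzweil_Integration.integral_reflect_real[of t "-R" "\<lambda>s. radial_kernel q (t - s) * poly ?v s"] by simp
  also have "\<dots> = integral {-t..R} (\<lambda>s. radial_kernel q (- t - s) * poly ?v s)"
    by (rule Henstock_Kurzweil_Integration.integral_cong) (simp add: poly_even_poly radial_kernel_def abs_minus_commute add.commute)
  also have "\<dots> = exp_moment (radial_poly q * pcompose ?v [:- t, 1:]) - b * radial_kernel q (- t - R)"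
    by (rule half) (use t in auto)
  also have "integral {t..R} (\<lambda>s. radial_kernel q (t - s) * poly ?v s) = exp_moment (radial_poly q * pcompose ?v [:t, 1:]) - b * radial_kernel q (t - R)"
    by (rule half) (use t in auto)
  also have "radial_kernel q (- t - R) = radial_kernel q (t + R)"
    using radial_kernel_minus_commute[of q "-t" R] by (simp add: add.commute)
  finally show ?thesis using exp_moment_even_shift[of q x t] by (simp add: algebra_simps)
qed

section \<open>Linear systems over the rational polynomials\<close>

lemma of_rat_poly_add: "poly (map_poly of_rat (p + r)) t = poly (map_poly of_rat p) t + poly (map_poly of_rat r) (t::real)"
  and of_rat_poly_mult: "poly (map_poly of_rat (p * r)) t = poly (map_poly of_rat p) t * poly (map_poly of_rat r) (t::real)"
proof -
  interpret h: map_poly_comm_ring_hom "of_rat :: rat \<Rightarrow> real" ..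
  show "poly (map_poly of_rat (p + r)) t = poly (map_poly of_rat p) t + poly (map_poly of_rat r) (t::real)"
    "poly (map_poly of_rat (p * r)) t = poly (map_poly of_rat p) t * poly (map_poly of_rat r) (t::real)"
    by (simp_all only: h.hom_add h.hom_mult poly_add poly_mult)
qed

lemma of_rat_poly_sum: "poly (map_poly of_rat (\<Sum>i\<in>A. f i)) t = (\<Sum>i\<in>A. poly (map_poly of_rat (f i)) (t::real))"
  by (induction A rule: infinite_finite_induct) (simp_all add: of_rat_poly_add)

lemma comm_ring_hom_eval: "comm_ring_hom (\<lambda>p. poly (map_poly of_rat p) (t::real))"
  by unfold_locales (simp_all add: of_rat_poly_add of_rat_poly_mult)

text \<open>Cramer's rule in the polynomial ring: \<open>D\<close> is the determinant and
  \<open>X\<close> the adjugate matrix applied to \<open>r\<close>, so a single denominator serves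
  all unknowns. Evaluation at \<open>t\<close> commutes with the determinant, hence injectivity of
  the evaluated matrix excludes a zero of \<open>D\<close> at \<open>t\<close>.\<close>

lemma polynomial_linear_system:
  fixes A :: "nat \<Rightarrow> nat \<Rightarrow> rat poly" and r :: "nat \<Rightarrow> rat poly" and S :: "real set"
  assumes inj: "\<And>t x. t \<in> S \<Longrightarrow> (\<And>i. i < N \<Longrightarrow> (\<Sum>j<N. poly (map_poly of_rat (A i j)) t * x j) = 0) \<Longrightarrow> \<forall>j<N. x j = 0"
  shows "\<exists>D X. \<forall>t\<in>S. poly (map_poly of_rat D) t \<noteq> 0 \<and>
    (\<forall>i<N. (\<Sum>j<N. poly (map_poly of_rat (A i j)) t * (poly (map_poly of_rat (X j)) t / poly (map_poly of_rat D) t))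
       = poly (map_poly of_rat (r i)) t)"
proof -
  define M where "M = mat N N (\<lambda>(i, j). A i j)"
  define D where "D = Determinant.det M"
  define X where "X j = (\<Sum>k<N. adj_mat M $$ (j, k) * r k)" for j
  have M: "M \<in> carrier_mat N N" by (simp add: M_def)
  have adj: "adj_mat M \<in> carrier_mat N N" by (rule adj_mat(1)[OF M])
  have *: "(\<Sum>j<N. A i j * adj_mat M $$ (j, k)) = (if i = k then D else 0)" if "i < N" "k < N" for i k
  proof -
    have "(M * adj_mat M) $$ (i, k) = (\<Sum>j<N. A i j * adj_mat M $$ (j, k))"
      using that M adj by (simp add: scalar_prod_def M_def lessThan_atLeast0)
    moreover have "(M * adj_mat M) $$ (i, k) = (D \<cdot>\<^sub>m 1\<^sub>m N) $$ (i, k)"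
      using adj_mat(2)[OF M] by (simp add: D_def)
    ultimately show ?thesis using that by (cases "i = k") simp_all
  qed
  have AX: "(\<Sum>j<N. A i j * X j) = D * r i" if i: "i < N" for i
  proof -
    have "(\<Sum>j<N. A i j * X j) = (\<Sum>j<N. \<Sum>k<N. A i j * adj_mat M $$ (j, k) * r k)"
      by (simp add: X_def sum_distrib_left mult.assoc)
    also have "\<dots> = (\<Sum>k<N. (\<Sum>j<N. A i j * adj_mat M $$ (j, k)) * r k)"
      by (subst sum.swap) (simp add: sum_distrib_right)
    also have "\<dots> = (\<Sum>k<N. if i = k then D * r k else 0)"
      using i by (intro sum.cong) (auto simp: *)
    finally show ?thesis using i by simp
  qed
  show ?thesis
  proof (intro exI[of _ D] exI[of _ X] ballI conjI allI impI)
    fix t assume t: "t \<in> S"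
    let ?e = "\<lambda>p. poly (map_poly of_rat p) t"
    interpret e: comm_ring_hom ?e by (rule comm_ring_hom_eval)
    show D0: "?e D \<noteq> 0"
    proof
      assume "?e D = 0"
      then have "Determinant.det (map_mat ?e M) = 0" by (simp add: D_def e.hom_det)
      moreover have M': "map_mat ?e M \<in> carrier_mat N N" using M by simp
      ultimately obtain v where v: "v \<in> carrier_vec N" "v \<noteq> 0\<^sub>v N" "map_mat ?e M *\<^sub>v v = 0\<^sub>v N"
        using det_0_iff_vec_prod_zero_field[OF M'] by blast
      have "(\<Sum>j<N. ?e (A i j) * vec_index v j) = 0" if i: "i < N" for i
      proof -
        have "vec_index (map_mat ?e M *\<^sub>v v) i = (\<Sum>j<N. ?e (A i j) * vec_index v j)"
          using i v(1) M by (simp add: scalar_prod_def M_def lessThan_atLeast0)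
        then show ?thesis using v(3) i by simp
      qed
      then have "\<forall>j<N. vec_index v j = 0" by (rule inj[OF t])
      then have "v = 0\<^sub>v N" using v(1) by (intro eq_vecI) auto
      then show False using v(2) by simp
    qed
    fix i assume i: "i < N"
    have "(\<Sum>j<N. ?e (A i j) * ?e (X j)) = ?e D * ?e (r i)"
      using arg_cong[OF AX[OF i], of ?e] by (simp add: of_rat_poly_sum of_rat_poly_mult)
    then show "(\<Sum>j<N. ?e (A i j) * (?e (X j) / ?e D)) = ?e (r i)"
      using D0 by (simp add: sum_divide_distrib[symmetric] field_simps)
  qed
qed

section \<open>The weight as a density, its energy and its nondegeneracy\<close>

lemma AE_lborel_interval_ex:
  assumes "AE u in lborel. P (u::real)" "a < b"
  shows "\<exists>u\<in>{a<..<b}. P u"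
proof (rule ccontr)
  assume "\<not> ?thesis"
  with assms(1) have "AE u in lborel. u \<notin> {a<..<b}" by (auto elim!: eventually_mono)
  then have "emeasure lborel {a<..<b} = 0"
    by (subst (asm) AE_iff_measurable[of "{a<..<b}"]) auto
  then show False using assms(2) by simp
qed

text \<open>Pushing Lebesgue measure on \<open>{-(R+1)..R+1}\<close> forward along \<open>clamp_real R\<close> gives Lebesgue measure on
  \<open>{-R..R}\<close> plus a unit point mass at either endpoint; so the weight is a density on this space.\<close>

definition weight_space :: "real \<Rightarrow> real measure" where
  "weight_space R = density lborel (indicator {- (R + 1)..R + 1})"

definition clamp_real :: "real \<Rightarrow> real \<Rightarrow> real" where
  "clamp_real R s = max (- R) (min R s)"

definition weight_density :: "real \<Rightarrow> real poly \<Rightarrow> real \<Rightarrow> real \<Rightarrow> real" where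
  "weight_density R v b s = (if s \<in> {-R..R} then poly v s else b)"

lemma sets_weight_space [measurable_cong, simp]: "sets (weight_space R) = sets borel"
  and space_weight_space [simp]: "space (weight_space R) = UNIV"
  by (simp_all add: weight_space_def)

lemma measurable_clamp_real [measurable]: "clamp_real R \<in> borel_measurable borel"
  unfolding clamp_real_def by measurable

lemma measurable_weight_density [measurable]: "weight_density R v b \<in> borel_measurable borel"
  unfolding weight_density_def by (intro measurable_If borel_measurable_continuous_onI continuous_intros) auto

lemma poly_bounded_interval: "\<exists>B\<ge>0. \<forall>s\<in>{a..b}. \<bar>poly v s\<bar> \<le> (B::real)"
proof -
  have "bounded (poly v ` {a..b})"
    by (intro compact_imp_bounded compact_continuous_image continuous_intros) auto
  then obtain B where B: "\<forall>s\<in>{a..b}. \<bar>poly v s\<bar> \<le> B" by (auto simp: bounded_iff)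
  have "\<bar>poly v s\<bar> \<le> \<bar>B\<bar>" if "s \<in> {a..b}" for s using B that by force
  then show ?thesis by (intro exI[of _ "\<bar>B\<bar>"]) auto
qed

lemma (in radial_feature) signed_density_weight:
  assumes "R > 0"
  shows "signed_density (weight_space R) (clamp_real R) (weight_density R v b)"
  unfolding signed_density_def
proof (intro conjI)
  show "finite_measure (weight_space R)" unfolding weight_space_def
    by (rule finite_measureI, subst emeasure_density_indicator_space) (use assms in auto)
  obtain B where B: "B \<ge> 0" "\<And>s. s \<in> {-R..R} \<Longrightarrow> \<bar>poly v s\<bar> \<le> B" using poly_bounded_interval by blast
  have "\<bar>clamp_real R s\<bar> \<le> B + \<bar>b\<bar> + R \<and> \<bar>weight_density R v b s\<bar> \<le> B + \<bar>b\<bar> + R" for s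
    using assms B(1) B(2)[of s] by (auto simp: clamp_real_def weight_density_def max_def min_def)
  then show "\<exists>B\<ge>0. \<forall>s\<in>space (weight_space R). \<bar>clamp_real R s\<bar> \<le> B \<and> \<bar>weight_density R v b s\<bar> \<le> B"
    using assms B(1) by (intro exI[of _ "B + \<bar>b\<bar> + R"]) auto
qed measurable

lemma weight_integral:
  assumes R: "R > 0" and h [measurable]: "h \<in> borel_measurable borel" and B: "\<And>s. \<bar>s\<bar> \<le> R \<Longrightarrow> \<bar>h s\<bar> \<le> B"
  shows "(LINT s|weight_space R. weight_density R v b s * h (clamp_real R s))
    = (LINT s:{-R..R}|lborel. poly v s * h s) + b * (h R + h (- R))"
proof -
  have "(LINT s|weight_space R. weight_density R v b s * h (clamp_real R s)) =
    (LINT s|lborel. indicator {-R..R} s *\<^sub>R (poly v s * h s) + (b * h R * indicator {R<..R + 1} s + b * h (- R) * indicator {- (R + 1)..<- R} s))"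
  proof -
    have "(LINT s|weight_space R. weight_density R v b s * h (clamp_real R s)) =
      (LINT s|lborel. indicator {- (R + 1)..R + 1} s *\<^sub>R (weight_density R v b s * h (clamp_real R s)))"
      unfolding weight_space_def by (subst integral_density_indicator) (auto simp: set_lebesgue_integral_def)
    also have "\<dots> = (LINT s|lborel. indicator {-R..R} s *\<^sub>R (poly v s * h s) + (b * h R * indicator {R<..R + 1} s + b * h (- R) * indicator {- (R + 1)..<- R} s))"
      by (rule Bochner_Integration.integral_cong)
        (use R in \<open>auto simp: indicator_def weight_density_def clamp_real_def\<close>)
    finally show ?thesis .
  qed
  also have "\<dots> = (LINT s:{-R..R}|lborel. poly v s * h s) + (b * h R * 1 + b * h (- R) * 1)"
  proof -
    have "integrable lborel (\<lambda>s. indicator {-R..R} s *\<^sub>R (poly v s * h s))"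
    proof -
      obtain C where C: "C \<ge> 0" "\<And>s. s \<in> {-R..R} \<Longrightarrow> \<bar>poly v s\<bar> \<le> C" using poly_bounded_interval by blast
      have B0: "B \<ge> 0" using B[of 0] R by auto
      have "integrable lborel (indicat_real {-R..R})" by (rule integrable_real_indicator) (use R in auto)
      then have "integrable lborel (\<lambda>s. indicator {-R..R} s *\<^sub>R (C * B))" by simp
      then show ?thesis
      proof (rule Bochner_Integration.integrable_bound)
        show "(\<lambda>s. indicator {-R..R} s *\<^sub>R (poly v s * h s)) \<in> borel_measurable lborel"
        proof -
          have [measurable]: "poly v \<in> borel_measurable borel"
            by (intro borel_measurable_continuous_onI continuous_intros)
          show ?thesis by measurable
        qed
        show "AE s in lborel. norm (indicator {-R..R} s *\<^sub>R (poly v s * h s)) \<le> norm (indicator {-R..R} s *\<^sub>R (C * B))"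
          using C B B0 by (intro AE_I2) (auto simp: indicator_def abs_mult intro!: mult_mono)
      qed
    qed
    then show ?thesis
      by (subst Bochner_Integration.integral_add) (auto simp: set_lebesgue_integral_def)
  qed
  finally show ?thesis by (simp add: algebra_simps)
qed

context radial_feature begin

abbreviation weight_potential :: "real \<Rightarrow> real poly \<Rightarrow> real \<Rightarrow> real \<Rightarrow> real" where
  "weight_potential R v b \<equiv> potential (weight_space R) (clamp_real R) (weight_density R v b)"

lemma weight_potential_eq:
  assumes "R > 0"
  shows "weight_potential R v b u = (LINT s:{-R..R}|lborel. poly v s * \<phi> (u - s)) + b * (\<phi> (u - R) + \<phi> (u + R))"
proof -
  obtain C where "\<And>t. \<bar>\<phi> t\<bar> \<le> C" using phi_bound by blast
  then show ?thesis
    unfolding potential_def using weight_integral[OF assms, of "\<lambda>s. \<phi> (u - s)" C v b] by simp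
qed

lemma weight_kernel_integral:
  assumes R: "R > 0" and t: "\<bar>t\<bar> \<le> R" and bal: "boundary_balance q R (even_poly q x) b"
  shows "(LINT s|weight_space R. weight_density R (even_poly q x) b s * radial_kernel q (t - clamp_real R s))
    = 2 * exp_moment (radial_poly q * monom 1 (2 * q)) * x q"
proof -
  obtain C where C: "\<And>t. \<bar>radial_kernel q t\<bar> \<le> C" using radial_kernel_bounded by blast
  have "(LINT s|weight_space R. weight_density R (even_poly q x) b s * radial_kernel q (t - clamp_real R s)) =
    (LINT s:{-R..R}|lborel. poly (even_poly q x) s * radial_kernel q (t - s)) + b * (radial_kernel q (t - R) + radial_kernel q (t - - R))"
    by (rule weight_integral[OF R, where B = C]) (use C in auto)
  also have "(LINT s:{-R..R}|lborel. poly (even_poly q x) s * radial_kernel q (t - s)) = integral {-R..R} (\<lambda>s. poly (even_poly q x) s * radial_kernel q (t - s))"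
    by (intro set_borel_integral_eq_integral borel_integrable_atLeastAtMost') (intro continuous_intros)
  finally show ?thesis using interval_potential[OF t bal] by (simp add: mult.commute)
qed

text \<open>A constant potential makes the energy that constant times the mass. If the constant is
  1, mass and energy coincide, which is where the upper and the lower bound for the magnitude meet.
  If it is 0, the weight has zero energy.\<close>

lemma weight_energy:
  assumes R: "R > 0" and bal: "boundary_balance q R (even_poly q x) b"
  shows "\<kappa> * (LINT u|lborel. (weight_potential R (even_poly q x) b u)\<^sup>2)
    = 2 * exp_moment (radial_poly q * monom 1 (2 * q)) * x q * (LINT s|weight_space R. weight_density R (even_poly q x) b s)"
proof -
  have "\<kappa> * (LINT u|lborel. (weight_potential R (even_poly q x) b u)\<^sup>2) =
    (LINT s|weight_space R. weight_density R (even_poly q x) b s * (LINT t|weight_space R. weight_density R (even_poly q x) b t * radial_kernel q (clamp_real R s - clamp_real R t)))"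
    unfolding power2_eq_square by (rule potential_inner[OF signed_density_weight[OF R] signed_density_weight[OF R]])
  also have "\<dots> = (LINT s|weight_space R. weight_density R (even_poly q x) b s * (2 * exp_moment (radial_poly q * monom 1 (2 * q)) * x q))"
  proof -
    have "(LINT t|weight_space R. weight_density R (even_poly q x) b t * radial_kernel q (clamp_real R s - clamp_real R t))
      = 2 * exp_moment (radial_poly q * monom 1 (2 * q)) * x q" for s
      by (rule weight_kernel_integral[OF R _ bal]) (use R in \<open>auto simp: clamp_real_def\<close>)
    then show ?thesis by simp
  qed
  finally show ?thesis by (simp add: mult.commute)
qed

text \<open>Just to the right of \<open>-R\<close> the potential is \<open>b\<close> up to a small error, and if \<open>b = 0\<close> it is the integral of a
  function of constant sign, as \<open>\<phi>\<close> is close to \<open>1\<close> and \<open>v\<close> has no roots there.\<close>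

lemma weight_injective:
  assumes R: "R > 0" and zero: "(LINT u|lborel. (weight_potential R v b u)\<^sup>2) = 0"
  shows "b = 0 \<and> v = 0"
proof -
  have sd: "signed_density (weight_space R) (clamp_real R) (weight_density R v b)" by (rule signed_density_weight[OF R])
  have "AE u in lborel. (weight_potential R v b u)\<^sup>2 = 0"
    using zero integrable_potential_mult[OF sd sd] by (subst (asm) integral_nonneg_eq_0_iff_AE) (auto simp: power2_eq_square)
  then have AE0: "AE u in lborel. weight_potential R v b u = 0" by simp
  \<comment> \<open>For \<open>u < R\<close> the mass at \<open>R\<close> and the density beyond
    \<open>u\<close> do not act yet, because \<open>\<phi>\<close> vanishes at negative
    arguments.\<close>
  have F: "weight_potential R v b u = integral {-R..u} (\<lambda>s. poly v s * pexp l (u - s)) + b * pexp l (u + R)"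
    if u: "u \<in> {-R<..<R}" for u
  proof -
    have "(LINT s:{-R..R}|lborel. poly v s * \<phi> (u - s)) = (LINT s:{-R..u}|lborel. poly v s * pexp l (u - s))"
      unfolding set_lebesgue_integral_def
      by (rule Bochner_Integration.integral_cong) (use u in \<open>auto simp: indicator_def \<phi>_def pexp_def\<close>)
    also have "\<dots> = integral {-R..u} (\<lambda>s. poly v s * pexp l (u - s))"
      by (intro set_borel_integral_eq_integral borel_integrable_atLeastAtMost') (intro continuous_intros)
    finally show ?thesis unfolding weight_potential_eq[OF R] using u by (simp add: \<phi>_def pexp_def)
  qed
  have "isCont (pexp l) 0" using continuous_on_pexp[OF continuous_on_id, of UNIV l]
    by (simp add: continuous_on_eq_continuous_at)
  then have "\<forall>e>0. \<exists>d>0. \<forall>x. dist x 0 < d \<longrightarrow> dist (pexp l x) (pexp l 0) < e"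
    by (simp add: continuous_at_eps_delta dist_norm)
  moreover have "pexp l 0 = 1" using l0 by (simp add: pexp_def poly_0_coeff_0)
  ultimately obtain d where d: "d > 0" "\<And>t. \<bar>t\<bar> < d \<Longrightarrow> \<bar>pexp l t - 1\<bar> < 1/2"
    by (metis diff_zero dist_real_def half_gt_zero_iff Rings.zero_less_one_class.zero_less_one)
  have pos: "pexp l t > 1/2" if "\<bar>t\<bar> < d" for t using d(2)[OF that] unfolding abs_less_iff by linarith
  obtain C where C: "\<And>t. \<bar>\<phi> t\<bar> \<le> C" using phi_bound by blast
  obtain B where B: "B \<ge> 0" "\<And>s. s \<in> {-R..R} \<Longrightarrow> \<bar>poly v s\<bar> \<le> B" using poly_bounded_interval by blast
  have C0: "C \<ge> 0" using C[of 0] by linarith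
  have b0: "b = 0"
  proof (rule ccontr)
    assume b: "b \<noteq> 0"
    \<comment> \<open>The bound \<open>d\<close> keeps \<open>\<phi> (u + R)\<close> above
      \<open>1/2\<close>, \<open>2 * R\<close> keeps \<open>u\<close> below \<open>R\<close>, and
      the quotient makes the density contribute less than \<open>\<bar>b\<bar> / 2\<close>; the 1
      covers the case \<open>B * C = 0\<close>.\<close>
    define e where "e = min (min d (2 * R)) (\<bar>b\<bar> / (2 * (B * C + 1)))"
    have "B * C \<ge> 0" using B C0 by simp
    then have e: "e > 0" using d R b by (simp add: e_def)
    obtain u where u: "u \<in> {-R<..<-R + e}" "weight_potential R v b u = 0"
      using AE_lborel_interval_ex[OF AE0, of "-R" "-R + e"] e by auto
    then have uR: "u \<in> {-R<..<R}" and ud: "\<bar>u + R\<bar> < d" by (auto simp: e_def)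
    have "norm (integral {-R..u} (\<lambda>s. poly v s * pexp l (u - s))) \<le> B * C * (u - - R)"
    proof (rule integral_bound)
      show "norm (poly v s * pexp l (u - s)) \<le> B * C" if "s \<in> {-R..u}" for s
        using B(2)[of s] C[of "u - s"] that uR B(1) C0 by (auto simp: abs_mult \<phi>_def pexp_def intro!: mult_mono)
    qed (use uR in \<open>auto intro!: continuous_intros\<close>)
    moreover have "\<bar>b\<bar> * (1/2) \<le> \<bar>b * pexp l (u + R)\<bar>"
      unfolding abs_mult using pos[OF ud] by (intro mult_left_mono) auto
    moreover have "B * C * (u - - R) < \<bar>b\<bar> * (1/2)"
    proof -
      have "B * C * (u - - R) \<le> B * C * e" using u \<open>B * C \<ge> 0\<close> by (intro mult_left_mono) auto
      also have "\<dots> \<le> B * C * (\<bar>b\<bar> / (2 * (B * C + 1)))" using \<open>B * C \<ge> 0\<close> by (intro mult_left_mono) (auto simp: e_def)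
      also have "\<dots> < (B * C + 1) * (\<bar>b\<bar> / (2 * (B * C + 1)))" using \<open>B * C \<ge> 0\<close> b by (intro mult_strict_right_mono) auto
      also have "\<dots> = \<bar>b\<bar> * (1/2)"
      proof -
        have *: "x * (y / (2 * x)) = y * (1/2)" if "x > 0" for x y :: real using that by simp
        show ?thesis by (rule *) (use \<open>B * C \<ge> 0\<close> in linarith)
      qed
      finally show ?thesis .
    qed
    ultimately show False using F[OF uR] u(2) by auto
  qed
  have "v = 0"
  proof (rule ccontr)
    assume v: "v \<noteq> 0"
    \<comment> \<open>The endpoint \<open>- R\<close> may itself be a root of \<open>v\<close>; only
      the next root limits the interval of constant sign.\<close>
    have "finite {s. poly v s = 0}" using v by (rule poly_roots_finite)
    then obtain e where e: "e > 0" "\<And>s. poly v s = 0 \<Longrightarrow> s \<noteq> -R \<Longrightarrow> e \<le> dist (-R) s"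
      using finite_set_avoid by (metis (mono_tags, lifting) mem_Collect_eq)
    define d' where "d' = min (min d e) (2 * R)"
    have d': "d' > 0" using d e R by (simp add: d'_def)
    have nz: "poly v s \<noteq> 0" if "s \<in> {-R<..<-R + d'}" for s
    proof
      assume "poly v s = 0"
      then have "e \<le> dist (-R) s" using e(2) that by auto
      then show False using that by (auto simp: dist_real_def d'_def)
    qed
    define s0 where "s0 = -R + d' / 2"
    have s0: "s0 \<in> {-R<..<-R + d'}" using d' by (auto simp: s0_def)
    define c where "c = sgn (poly v s0)"
    define w where "w = smult c v"
    have w0: "poly w s0 > 0" using nz[OF s0] by (auto simp: w_def c_def sgn_if)
    have c0: "c \<noteq> 0" using nz[OF s0] by (simp add: c_def sgn_0_0)
    have nz': "poly w s \<noteq> 0" if "s \<in> {-R<..<-R + d'}" for s using nz[OF that] c0 by (simp add: w_def)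
    have wpos: "poly w s \<ge> 0" if s: "s \<in> {-R..<-R + d'}" for s
    proof (rule ccontr)
      assume "\<not> poly w s \<ge> 0"
      then have neg: "poly w s < 0" by simp
      then have "s \<noteq> s0" using w0 by auto
      then consider "s < s0" | "s0 < s" by linarith
      then obtain z where "poly w z = 0" "z \<in> {-R<..<-R + d'}"
      proof cases
        case 1
        from poly_IVT_pos[OF 1 neg w0] show ?thesis using that s s0 by auto
      next
        case 2
        from poly_IVT_neg[OF 2 w0 neg] show ?thesis using that s s0 by auto
      qed
      then show False using nz' by blast
    qed
    obtain u where u: "u \<in> {-R<..<-R + d'}" "weight_potential R v b u = 0"
      using AE_lborel_interval_ex[OF AE0, of "-R" "-R + d'"] d' by auto
    then have uR: "u \<in> {-R<..<R}" by (auto simp: d'_def)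
    have "integral {-R..u} (\<lambda>s. poly v s * pexp l (u - s)) = 0" using F[OF uR] u(2) b0 by simp
    then have "integral {-R..u} (\<lambda>s. c * (poly v s * pexp l (u - s))) = 0" by simp
    then have I0: "integral {-R..u} (\<lambda>s. poly w s * pexp l (u - s)) = 0" by (simp add: w_def mult.assoc)
    have lpos: "pexp l (u - s) > 1/2" if "s \<in> {-R..u}" for s
      by (rule pos) (use that u in \<open>auto simp: d'_def\<close>)
    have "(integral {-R..u} (\<lambda>s. poly w s * pexp l (u - s)) = 0) = (\<forall>s\<in>{-R..u}. poly w s * pexp l (u - s) = 0)"
    proof (rule integral_eq_0_iff)
      show "poly w s * pexp l (u - s) \<ge> 0" if "s \<in> {-R..u}" for s
        using lpos[OF that] wpos[of s] that u by auto
    qed (use u in \<open>auto intro!: continuous_intros\<close>)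
    with I0 have "poly w ((-R + u) / 2) * pexp l (u - (-R + u) / 2) = 0" using u by auto
    moreover have "poly w ((-R + u) / 2) \<noteq> 0" by (rule nz') (use u in auto)
    moreover have "pexp l (u - (-R + u) / 2) \<noteq> 0" using lpos[of "(-R + u) / 2"] u by auto
    ultimately show False by simp
  qed
  with b0 show ?thesis by simp
qed

end

section \<open>Rational dependence of the weight and of its mass on the radius\<close>

lemma even_poly_eq_0_imp: "even_poly q x = 0 \<Longrightarrow> j \<le> q \<Longrightarrow> x j = (0::real)"
proof -
  assume a: "even_poly q x = 0" "j \<le> q"
  have "coeff (even_poly q x) (2 * j) = (\<Sum>i\<le>q. if i = j then x i else 0)"
    by (simp add: even_poly_def coeff_sum if_distrib cong: if_cong)
  then show "x j = 0" using a by simp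
qed

lemma of_rat_radial_poly: "map_poly of_rat (radial_poly q :: rat poly) = (radial_poly q :: real poly)"
  and of_rat_pderiv: "map_poly of_rat (pderiv p) = pderiv (map_poly of_rat p :: real poly)"
proof -
  interpret h: map_poly_comm_ring_hom "of_rat :: rat \<Rightarrow> real" ..
  have pd: "map_poly of_rat (pderiv p) = pderiv (map_poly of_rat p :: real poly)" for p :: "rat poly"
    by (rule poly_eqI) (simp add: coeff_map_poly coeff_pderiv of_rat_mult of_rat_add)
  then show "map_poly of_rat (pderiv p) = pderiv (map_poly of_rat p :: real poly)" .
  have sm: "map_poly of_rat (Polynomial.smult c p) = Polynomial.smult (of_rat c) (map_poly of_rat p :: real poly)" for c and p :: "rat poly"
    by (rule poly_eqI) (simp add: coeff_map_poly of_rat_mult)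
  have pc: "map_poly of_rat (pCons 0 p) = pCons 0 (map_poly of_rat p :: real poly)" for p :: "rat poly"
    by (rule poly_eqI) (simp add: coeff_map_poly coeff_pCons split: nat.split)
  show "map_poly of_rat (radial_poly q :: rat poly) = (radial_poly q :: real poly)"
    by (induction q) (simp_all add: h.hom_add h.hom_minus sm pc pd of_rat_divide of_rat_add of_rat_mult)
qed

lemma of_rat_smult: "map_poly of_rat (Polynomial.smult c p) = Polynomial.smult (of_rat c) (map_poly of_rat p :: real poly)"
  by (rule poly_eqI) (simp add: coeff_map_poly of_rat_mult)

lemma of_rat_const: "map_poly of_rat [:c:] = [:of_rat c :: real:]"
  by (rule poly_eqI) (simp add: coeff_map_poly coeff_pCons split: nat.split)

lemma of_rat_exp_antideriv: "map_poly of_rat (exp_antideriv p) = exp_antideriv (map_poly of_rat p :: real poly)"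
proof -
  interpret h: map_poly_comm_ring_hom "of_rat :: rat \<Rightarrow> real" ..
  have "exp_deriv (map_poly of_rat (exp_antideriv p) :: real poly) = map_poly of_rat (exp_deriv (exp_antideriv p))"
    by (simp add: exp_deriv_def of_rat_pderiv h.hom_minus)
  also have "\<dots> = - map_poly of_rat p" by (simp add: exp_deriv_antideriv h.hom_uminus)
  finally show ?thesis by (rule exp_antideriv_unique[symmetric])
qed

lemma of_rat_radial_shift: "map_poly of_rat (radial_shift q k :: rat poly) = (radial_shift q k :: real poly)"
proof -
  have "map_poly of_rat ((pderiv ^^ k) p) = (pderiv ^^ k) (map_poly of_rat p :: real poly)" for p :: "rat poly"
    by (induction k) (simp_all add: of_rat_pderiv)
  moreover have "of_rat (fact k :: rat) = (fact k :: real)" by (metis of_rat_of_nat_eq of_nat_fact)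
  ultimately show ?thesis
    by (simp add: radial_shift_def of_rat_smult of_rat_radial_poly of_rat_divide of_rat_power of_rat_minus)
qed

lemma of_rat_exp_moment:
  "of_rat (exp_moment (radial_poly q * monom 1 i :: rat poly)) = (exp_moment (radial_poly q * monom 1 i) :: real)"
proof -
  interpret h: map_poly_comm_ring_hom "of_rat :: rat \<Rightarrow> real" ..
  have m: "map_poly of_rat (monom 1 i :: rat poly) = (monom 1 i :: real poly)"
    by (rule poly_eqI) (simp add: coeff_map_poly)
  have "of_rat (coeff (exp_antideriv (radial_poly q * monom 1 i) :: rat poly) 0) = coeff (exp_antideriv (radial_poly q * monom 1 i) :: real poly) 0"
    by (simp add: coeff_map_poly[symmetric] of_rat_exp_antideriv h.hom_mult of_rat_radial_poly m del: coeff_map_poly)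
  then show ?thesis by (simp add: exp_moment_def poly_0_coeff_0)
qed

lemma exp_antideriv_mult_even_poly:
  "exp_antideriv (p * even_poly q x) = (\<Sum>j\<le>q. Polynomial.smult (x j) (exp_antideriv (p * monom 1 (2 * j))))"
  by (simp add: even_poly_def sum_distrib_left exp_antideriv_sum exp_antideriv_smult)

text \<open>This is the nonsingularity of the linear system: if \<open>x q = 0\<close>, the
  potential is 0 on the whole interval, so the energy vanishes and with it the weight.\<close>

lemma balanced_weight_zero:
  assumes R: "R > 0" and bal: "boundary_balance q R (even_poly q x) b" and xq: "x q = 0"
  shows "b = 0 \<and> (\<forall>j\<le>q. x j = 0)"
proof -
  obtain l \<kappa> where "\<kappa> > 0" "coeff l 0 = 1" "Polynomial.smult \<kappa> (laplace_corr l l) = (radial_poly q :: real poly)"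
    using radial_poly_factorization by blast
  then interpret radial_feature q l \<kappa> by unfold_locales
  have "(LINT u|lborel. (weight_potential R (even_poly q x) b u)\<^sup>2) = 0"
    using weight_energy[OF R bal] xq kpos by simp
  then have "b = 0 \<and> even_poly q x = 0" by (rule weight_injective[OF R])
  then show ?thesis using even_poly_eq_0_imp by blast
qed

text \<open>The unknowns are the coefficients of the even density and, at index
  \<open>Suc q\<close>, the endpoint mass. The \<open>q + 2\<close> equations are the conditions of
  \<open>boundary_balance\<close> for \<open>k \<le> q\<close> and the normalization of the
  potential to 1.\<close>

lemma rational_weight:
  "\<exists>D X. \<forall>R>0. poly (map_poly of_rat D) R \<noteq> 0 \<and>
     (let x = (\<lambda>j. poly (map_poly of_rat (X j)) R / poly (map_poly of_rat D) R) in
       boundary_balance q R (even_poly q x) (x (Suc q)) \<and>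
       2 * exp_moment (radial_poly q * monom 1 (2 * q)) * x q = (1::real))"
proof -
  define N where "N = Suc (Suc q)"
  define A :: "nat \<Rightarrow> nat \<Rightarrow> rat poly" where
    "A i j = (if i \<le> q then (if j \<le> q then exp_antideriv (radial_shift q i * monom 1 (2 * j)) else - radial_shift q i)
       else if j = q then [:2 * exp_moment (radial_poly q * monom 1 (2 * q)):] else 0)" for i j
  define r :: "nat \<Rightarrow> rat poly" where "r i = (if i \<le> q then 0 else 1)" for i
  interpret h: map_poly_comm_ring_hom "of_rat :: rat \<Rightarrow> real" ..
  have m: "map_poly of_rat (monom 1 i :: rat poly) = (monom 1 i :: real poly)" for i
    by (rule poly_eqI) (simp add: coeff_map_poly)
  have row: "(\<Sum>j<N. poly (map_poly of_rat (A i j)) R * x j) =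
     poly (exp_antideriv (radial_shift q i * even_poly q x)) R - x (Suc q) * poly (radial_shift q i) R" if "i \<le> q" for i x and R :: real
  proof -
    have "(\<Sum>j<N. poly (map_poly of_rat (A i j)) R * x j) = (\<Sum>j\<le>q. poly (map_poly of_rat (A i j)) R * x j) + poly (map_poly of_rat (A i (Suc q))) R * x (Suc q)"
      by (simp add: N_def lessThan_Suc_atMost)
    also have "(\<Sum>j\<le>q. poly (map_poly of_rat (A i j)) R * x j) = poly (exp_antideriv (radial_shift q i * even_poly q x)) R"
      unfolding exp_antideriv_mult_even_poly poly_sum
      by (rule sum.cong) (use that in \<open>auto simp: A_def of_rat_exp_antideriv h.hom_mult of_rat_radial_shift m\<close>)
    finally show ?thesis using that by (simp add: A_def h.hom_uminus of_rat_radial_shift)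
  qed
  have last: "(\<Sum>j<N. poly (map_poly of_rat (A (Suc q) j)) R * x j) = 2 * exp_moment (radial_poly q * monom 1 (2 * q)) * x q" for x and R :: real
  proof -
    have "(\<Sum>j<N. poly (map_poly of_rat (A (Suc q) j)) R * x j) = (\<Sum>j<N. if j = q then 2 * exp_moment (radial_poly q * monom 1 (2 * q)) * x q else 0)"
      by (rule sum.cong) (auto simp: A_def of_rat_mult of_rat_exp_moment of_rat_const)
    then show ?thesis by (simp add: N_def)
  qed
  have "\<exists>D X. \<forall>t\<in>{0<..}. poly (map_poly of_rat D) t \<noteq> 0 \<and>
    (\<forall>i<N. (\<Sum>j<N. poly (map_poly of_rat (A i j)) t * (poly (map_poly of_rat (X j)) t / poly (map_poly of_rat D) t))
       = poly (map_poly of_rat (r i)) (t::real))"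
  proof (rule polynomial_linear_system)
    fix t :: real and x :: "nat \<Rightarrow> real"
    assume t: "t \<in> {0<..}" and z: "\<And>i. i < N \<Longrightarrow> (\<Sum>j<N. poly (map_poly of_rat (A i j)) t * x j) = 0"
    have "boundary_balance q t (even_poly q x) (x (Suc q))"
      unfolding boundary_balance_def
    proof (intro allI impI)
      fix k assume "k \<le> q"
      then show "poly (exp_antideriv (radial_shift q k * even_poly q x)) t = x (Suc q) * poly (radial_shift q k) t"
        using z[of k] row[of k t x] by (simp add: N_def)
    qed
    moreover have "x q = 0"
      using z[of "Suc q"] exp_moment_radial_poly_nonzero[of q q, where 'a = real] unfolding last by (simp add: N_def)
    ultimately have "x (Suc q) = 0 \<and> (\<forall>j\<le>q. x j = 0)" using t balanced_weight_zero by auto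
    then show "\<forall>j<N. x j = 0" by (auto simp: N_def less_Suc_eq_le le_Suc_eq)
  qed
  then obtain D X where DX: "\<forall>t\<in>{0<..}. poly (map_poly of_rat D) t \<noteq> 0 \<and>
    (\<forall>i<N. (\<Sum>j<N. poly (map_poly of_rat (A i j)) t * (poly (map_poly of_rat (X j)) t / poly (map_poly of_rat D) t))
       = poly (map_poly of_rat (r i)) (t::real))" by blast
  show ?thesis
  proof (intro exI[of _ D] exI[of _ X] allI impI conjI)
    fix R :: real assume R: "R > 0"
    then show "poly (map_poly of_rat D) R \<noteq> 0" using DX by auto
    define x where "x = (\<lambda>j. poly (map_poly of_rat (X j)) R / poly (map_poly of_rat D) R)"
    have sys: "(\<Sum>j<N. poly (map_poly of_rat (A i j)) R * x j) = poly (map_poly of_rat (r i)) R" if "i < N" for i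
      using DX R that unfolding x_def by auto
    have "boundary_balance q R (even_poly q x) (x (Suc q))"
      unfolding boundary_balance_def
    proof (intro allI impI)
      fix k assume "k \<le> q"
      then show "poly (exp_antideriv (radial_shift q k * even_poly q x)) R = x (Suc q) * poly (radial_shift q k) R"
        using sys[of k] row[of k R x] by (simp add: N_def r_def)
    qed
    moreover have "2 * exp_moment (radial_poly q * monom 1 (2 * q)) * x q = 1"
      using sys[of "Suc q"] unfolding last by (simp add: N_def r_def)
    ultimately show "let x = (\<lambda>j. poly (map_poly of_rat (X j)) R / poly (map_poly of_rat D) R) in
       boundary_balance q R (even_poly q x) (x (Suc q)) \<and>
       2 * exp_moment (radial_poly q * monom 1 (2 * q)) * x q = (1::real)"
      unfolding x_def Let_def by blast
  qed
qed

lemma weight_mass: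
  assumes R: "R > 0"
  shows "(LINT s|weight_space R. weight_density R (even_poly q x) b s) = (\<Sum>j\<le>q. x j * (2 * R ^ (2 * j + 1) / (2 * j + 1))) + 2 * b"
proof -
  have "(LINT s|weight_space R. weight_density R (even_poly q x) b s) = (LINT s:{-R..R}|lborel. poly (even_poly q x) s) + 2 * b"
    using weight_integral[OF R, of "\<lambda>_. 1" 1 "even_poly q x" b] by simp
  also have "(LINT s:{-R..R}|lborel. poly (even_poly q x) s) = integral {-R..R} (poly (even_poly q x))"
    by (intro set_borel_integral_eq_integral borel_integrable_atLeastAtMost') (intro continuous_intros)
  also have "\<dots> = (\<Sum>j\<le>q. x j * (2 * R ^ (2 * j + 1) / (2 * j + 1)))"
  proof -
    define F where "F s = (\<Sum>j\<le>q. x j * s ^ (2 * j + 1) / (2 * j + 1))" for s :: real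
    have "(poly (even_poly q x) has_integral (F R - F (- R))) {-R..R}"
    proof (rule fundamental_theorem_of_calculus)
      fix s
      have "(F has_real_derivative (\<Sum>j\<le>q. x j * s ^ (2 * j))) (at s within {-R..R})"
        unfolding F_def
      proof (rule DERIV_sum)
        fix j
        have "((\<lambda>s. x j / (2 * j + 1) * s ^ (2 * j + 1)) has_real_derivative x j / (2 * j + 1) * (real (2 * j + 1) * s ^ (2 * j))) (at s within {-R..R})"
          by (rule derivative_eq_intros refl | simp)+
        also have "x j / (2 * j + 1) * (real (2 * j + 1) * s ^ (2 * j)) = x j * s ^ (2 * j)"
          by (simp add: field_simps)
        finally show "((\<lambda>s. x j * s ^ (2 * j + 1) / (2 * j + 1)) has_real_derivative x j * s ^ (2 * j)) (at s within {-R..R})"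
          by simp
      qed
      then show "(F has_vector_derivative poly (even_poly q x) s) (at s within {-R..R})"
        by (simp add: has_real_derivative_iff_has_vector_derivative poly_even_poly)
    qed (use R in simp)
    moreover have "F R - F (- R) = (\<Sum>j\<le>q. x j * (2 * R ^ (2 * j + 1) / (2 * j + 1)))"
      unfolding F_def sum_subtractf[symmetric]
    proof (rule sum.cong[OF refl])
      fix j
      have "y - - y = 2 * y" for y :: real by simp
      moreover have "x j * (- R) ^ (2 * j + 1) / (2 * j + 1) = - (x j * R ^ (2 * j + 1) / (2 * j + 1))" by simp
      ultimately show "x j * R ^ (2 * j + 1) / (2 * j + 1) - x j * (- R) ^ (2 * j + 1) / (2 * j + 1) = x j * (2 * R ^ (2 * j + 1) / (2 * j + 1))"
        by (simp only: mult.left_commute times_divide_eq_right)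
    qed
    ultimately show ?thesis by (simp add: integral_unique)
  qed
  finally show ?thesis .
qed

lemma rational_weight_mass:
  "\<exists>P D :: rat poly. \<forall>R>0. poly (map_poly of_rat D) R \<noteq> 0 \<and>
     (\<exists>x b. boundary_balance q R (even_poly q x) b \<and>
       2 * exp_moment (radial_poly q * monom 1 (2 * q)) * x q = (1::real) \<and>
       (LINT s|weight_space R. weight_density R (even_poly q x) b s) = poly (map_poly of_rat P) R / poly (map_poly of_rat D) R)"
proof -
  obtain D X where DX: "\<forall>R>0. poly (map_poly of_rat D) R \<noteq> 0 \<and>
     (let x = (\<lambda>j. poly (map_poly of_rat (X j)) R / poly (map_poly of_rat D) R) in
       boundary_balance q R (even_poly q x) (x (Suc q)) \<and>
       2 * exp_moment (radial_poly q * monom 1 (2 * q)) * x q = (1::real))" using rational_weight by blast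
  \<comment> \<open>The mass is linear in the unknowns with factors that are rational polynomials in
    \<open>R\<close>, so \<open>D\<close> remains the denominator.\<close>
  define P where "P = (\<Sum>j\<le>q. X j * monom (2 / of_nat (2 * j + 1)) (2 * j + 1)) + X (Suc q) * [:2:]"
  show ?thesis
  proof (rule exI[of _ P], rule exI[of _ D], intro allI impI conjI)
    fix R :: real assume R: "R > 0"
    then show "poly (map_poly of_rat D) R \<noteq> 0" using DX by auto
    define x where "x = (\<lambda>j. poly (map_poly of_rat (X j)) R / poly (map_poly of_rat D) R)"
    have x: "boundary_balance q R (even_poly q x) (x (Suc q))" "2 * exp_moment (radial_poly q * monom 1 (2 * q)) * x q = 1"
      using DX R unfolding x_def Let_def by auto
    have m: "map_poly of_rat (monom c i :: rat poly) = (monom (of_rat c) i :: real poly)" for c i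
      by (rule poly_eqI) (simp add: coeff_map_poly)
    have "poly (map_poly of_rat P) R = (\<Sum>j\<le>q. poly (map_poly of_rat (X j)) R * (2 * R ^ (2 * j + 1) / (2 * j + 1))) + 2 * poly (map_poly of_rat (X (Suc q))) R"
      unfolding P_def of_rat_poly_add of_rat_poly_sum of_rat_poly_mult m
      by (simp add: poly_monom of_rat_divide of_rat_add of_rat_mult of_rat_const mult_ac)
    then have "(LINT s|weight_space R. weight_density R (even_poly q x) (x (Suc q)) s) = poly (map_poly of_rat P) R / poly (map_poly of_rat D) R"
      unfolding weight_mass[OF R] by (simp add: x_def add_divide_distrib sum_divide_distrib mult_ac)
    with x show "\<exists>x b. boundary_balance q R (even_poly q x) b \<and>
       2 * exp_moment (radial_poly q * monom 1 (2 * q)) * x q = (1::real) \<and>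
       (LINT s|weight_space R. weight_density R (even_poly q x) b s) = poly (map_poly of_rat P) R / poly (map_poly of_rat D) R" by blast
  qed
qed

section \<open>The upper bound\<close>

lemma exp_energy_combine:
  "exp_energy A (\<lambda>x. s * c x + t * d x) = s\<^sup>2 * exp_energy A c
    + 2 * s * t * (\<Sum>x\<in>A. \<Sum>y\<in>A. c x * d y * exp (- dist x y)) + t\<^sup>2 * exp_energy A d"
proof -
  have sw: "(\<Sum>x\<in>A. \<Sum>y\<in>A. d x * c y * exp (- dist x y)) = (\<Sum>x\<in>A. \<Sum>y\<in>A. c x * d y * exp (- dist x y))"
    by (subst sum.swap) (simp add: dist_commute mult_ac)
  have "exp_energy A (\<lambda>x. s * c x + t * d x) = s\<^sup>2 * exp_energy A c
     + s * t * (\<Sum>x\<in>A. \<Sum>y\<in>A. c x * d y * exp (- dist x y)) + s * t * (\<Sum>x\<in>A. \<Sum>y\<in>A. d x * c y * exp (- dist x y))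
     + t\<^sup>2 * exp_energy A d"
    unfolding exp_energy_def sum_distrib_left sum.distrib[symmetric]
    by (intro sum.cong refl) (simp add: power2_eq_square algebra_simps)
  then show ?thesis unfolding sw by simp
qed

lemma unit_ball_volume_pos: "measure lborel (cball (0::'a::euclidean_space) 1) > 0"
  using content_cball_pos[of 1 "0::'a"] by simp

lemma abs_sgn_inner_le: "\<bar>sgn y \<bullet> x\<bar> \<le> norm (x :: 'a::real_inner)"
  using Cauchy_Schwarz_ineq2[of "sgn y" x] by (auto simp: norm_sgn split: if_splits)

lemma borel_measurable_sgn_inner [measurable]: "(\<lambda>y::'a::euclidean_space. sgn y \<bullet> x) \<in> borel_measurable borel"
  unfolding sgn_div_norm by measurable

text \<open>Nested, and with the kernel at a difference of projections, so as to match the iterated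
  integral in \<open>potential_inner\<close> over \<open>count_space\<close>.\<close>

definition directional_energy :: "nat \<Rightarrow> 'a::euclidean_space set \<Rightarrow> ('a \<Rightarrow> real) \<Rightarrow> 'a \<Rightarrow> real" where
  "directional_energy q A c y = (\<Sum>x\<in>A. c x * (\<Sum>x'\<in>A. c x' * radial_kernel q (sgn y \<bullet> x - sgn y \<bullet> x')))"

lemma integrable_kernel_direction: "integrable (ball_measure 1) (\<lambda>y. radial_kernel q (sgn y \<bullet> (z :: 'a::euclidean_space)))"
proof -
  interpret finite_measure "ball_measure 1 :: 'a measure" by (rule finite_measure_ball_measure)
  obtain C where "\<And>t. \<bar>radial_kernel q t\<bar> \<le> C" using radial_kernel_bounded by blast
  then show ?thesis by (intro integrable_const_bound[of _ C]) auto
qed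

text \<open>\<open>exp_minus_norm_eq_average\<close> at all differences \<open>x - x'\<close>.
  Positivity and Cauchy-Schwarz for the energy in space thereby reduce to the line.\<close>

lemma exp_energy_average:
  assumes n: "CARD('n::finite) = 2 * q + 1"
  shows "integrable (ball_measure 1) (directional_energy q A c)"
    "measure lborel (cball (0::real^'n) 1) * exp_energy A c = (LINT y|ball_measure 1. directional_energy q A (c :: real^'n \<Rightarrow> real) y)"
proof -
  have d: "directional_energy q A c y = (\<Sum>x\<in>A. \<Sum>x'\<in>A. c x * c x' * radial_kernel q (sgn y \<bullet> (x - x')))" for y
    by (simp add: directional_energy_def sum_distrib_left inner_diff_right mult.assoc)
  show "integrable (ball_measure 1) (directional_energy q A c)"
    unfolding d[abs_def] by (intro Bochner_Integration.integrable_sum integrable_mult_right integrable_kernel_direction)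
  have "(LINT y|ball_measure 1. directional_energy q A c y) = (\<Sum>x\<in>A. \<Sum>x'\<in>A. c x * c x' * (LINT y|ball_measure 1. radial_kernel q (sgn y \<bullet> (x - x'))))"
    unfolding d by (simp add: Bochner_Integration.integral_sum integrable_kernel_direction)
  also have "\<dots> = measure lborel (cball (0::real^'n) 1) * exp_energy A c"
    by (simp add: exp_minus_norm_eq_average[OF n] exp_energy_def dist_norm sum_distrib_left mult_ac)
  finally show "measure lborel (cball (0::real^'n) 1) * exp_energy A c = (LINT y|ball_measure 1. directional_energy q A c y)" by simp
qed

context radial_feature begin

lemma signed_density_count_space:
  assumes "finite A"
  shows "signed_density (count_space A) X c"
proof -
  have "\<bar>X s\<bar> \<le> (\<Sum>a\<in>A. \<bar>X a\<bar> + \<bar>c a\<bar>)" "\<bar>c s\<bar> \<le> (\<Sum>a\<in>A. \<bar>X a\<bar> + \<bar>c a\<bar>)" if "s \<in> A" for s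
    using member_le_sum[of s A "\<lambda>a. \<bar>X a\<bar> + \<bar>c a\<bar>"] assms that by auto
  moreover have "0 \<le> (\<Sum>a\<in>A. \<bar>X a\<bar> + \<bar>c a\<bar>)" by (intro sum_nonneg) auto
  ultimately show ?thesis
    unfolding signed_density_def using finite_measure_count_space[OF assms] by auto
qed

abbreviation direction_potential :: "'a::euclidean_space set \<Rightarrow> ('a \<Rightarrow> real) \<Rightarrow> 'a \<Rightarrow> real \<Rightarrow> real" where
  "direction_potential A c y \<equiv> potential (count_space A) (\<lambda>x. sgn y \<bullet> x) c"

lemma directional_energy_eq:
  assumes "finite A"
  shows "directional_energy q A c y = \<kappa> * (LINT u|lborel. (direction_potential A c y u)\<^sup>2)"
  unfolding power2_eq_square directional_energy_def
  by (subst potential_inner[OF signed_density_count_space[OF assms] signed_density_count_space[OF assms]])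
    (simp add: lebesgue_integral_count_space_finite assms)

lemma directional_energy_nonneg: "finite A \<Longrightarrow> directional_energy q A c y \<ge> 0"
  using kpos by (simp add: directional_energy_eq)

lemma exp_energy_nonneg:
  assumes n: "CARD('n::finite) = 2 * q + 1" and A: "finite A"
  shows "0 \<le> exp_energy A (c :: real^'n \<Rightarrow> real)"
proof -
  have "0 \<le> measure lborel (cball (0::real^'n) 1) * exp_energy A c"
    unfolding exp_energy_average(2)[OF n] by (intro integral_nonneg_AE AE_I2 directional_energy_nonneg A)
  then show ?thesis using unit_ball_volume_pos[where 'a = "real^'n"] by (simp add: zero_le_mult_iff)
qed

text \<open>If the energy of \<open>c\<close> vanished, Cauchy-Schwarz for the nonnegative form
  would make the potential of \<open>c\<close> vanish at every point of the space. At a point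
  \<open>a\<close> with \<open>c a \<noteq> 0\<close>, however, its own term has a cone singularity
  while all other terms are smooth.\<close>

lemma exp_energy_pos:
  assumes n: "CARD('n::finite) = 2 * q + 1" and A: "finite A" and c: "\<exists>x\<in>A. c x \<noteq> 0"
  shows "0 < exp_energy A (c :: real^'n \<Rightarrow> real)"
proof (rule ccontr)
  assume "\<not> 0 < exp_energy A c"
  then have E0: "exp_energy A c = 0" using exp_energy_nonneg[OF n A, of c] by simp
  have zero: "(\<Sum>x\<in>A. c x * exp (- dist x y)) = 0" for y
  proof -
    \<comment> \<open>Cauchy-Schwarz is applied against the unit mass at \<open>y\<close>, on the
      enlarged set \<open>insert y A\<close>, so that \<open>y\<close> may be any point of the
      space.\<close>
    define d where "d x = (if x \<in> A then c x else 0)" for x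
    define \<delta> where "\<delta> x = (if x = y then 1 else 0 :: real)" for x
    define B where "B = insert y A"
    have B: "finite B" "A \<subseteq> B" "y \<in> B" using A by (auto simp: B_def)
    have sA: "(\<Sum>x\<in>B. d x * f x) = (\<Sum>x\<in>A. c x * f x)" for f
      using B by (intro sum.mono_neutral_cong_right) (auto simp: d_def)
    have s\<delta>: "(\<Sum>x\<in>B. \<delta> x * f x) = f y" for f
    proof -
      have "(\<Sum>x\<in>B. \<delta> x * f x) = (\<Sum>x\<in>B. if x = y then f x else 0)"
        by (intro sum.cong) (auto simp: \<delta>_def)
      then show ?thesis using B by simp
    qed
    have e: "exp_energy B d = 0"
    proof -
      have "exp_energy B d = (\<Sum>x\<in>B. d x * (\<Sum>z\<in>B. d z * exp (- dist x z)))"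
        by (simp add: exp_energy_def sum_distrib_left mult.assoc)
      also have "\<dots> = exp_energy A c"
        unfolding sA by (simp add: exp_energy_def sum_distrib_left mult.assoc)
      finally show ?thesis using E0 by simp
    qed
    have cross: "(\<Sum>x\<in>B. \<Sum>z\<in>B. d x * \<delta> z * exp (- dist x z)) = (\<Sum>x\<in>A. c x * exp (- dist x y))"
    proof -
      have "(\<Sum>x\<in>B. \<Sum>z\<in>B. d x * \<delta> z * exp (- dist x z)) = (\<Sum>x\<in>B. d x * (\<Sum>z\<in>B. \<delta> z * exp (- dist x z)))"
        by (simp add: sum_distrib_left mult.assoc)
      then show ?thesis unfolding s\<delta> sA .
    qed
    have "(\<Sum>x\<in>A. c x * exp (- dist x y))\<^sup>2 \<le> 0 * exp_energy B \<delta>"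
    proof (rule discriminant_le)
      show "0 \<le> s\<^sup>2 * 0 + 2 * s * t * (\<Sum>x\<in>A. c x * exp (- dist x y)) + t\<^sup>2 * exp_energy B \<delta>" for s t
        using exp_energy_nonneg[OF n B(1), of "\<lambda>x. s * d x + t * \<delta> x"]
        unfolding exp_energy_combine e cross .
    qed
    then show ?thesis by simp
  qed
  obtain a where a: "a \<in> A" "c a \<noteq> 0" using c by blast
  obtain e :: "real^'n" where e: "norm e = 1" using vector_choose_size[of 1] by auto
  \<comment> \<open>The terms of the other points along the line through \<open>a\<close> in
    direction \<open>e\<close>. They are differentiable at \<open>t = 0\<close>, as the arguments of
    the square roots are positive there.\<close>
  define g where "g t = - (\<Sum>x\<in>A - {a}. c x * exp (- sqrt ((norm (a - x))\<^sup>2 + 2 * t * ((a - x) \<bullet> e) + t\<^sup>2))) / c a" for t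
  have dist_eq: "dist x (a + t *\<^sub>R e) = sqrt ((norm (a - x))\<^sup>2 + 2 * t * ((a - x) \<bullet> e) + t\<^sup>2)" for x t
  proof -
    have ee: "e \<bullet> e = 1" using e by (simp add: norm_eq_1)
    have "(norm (v + t *\<^sub>R e))\<^sup>2 = (norm v)\<^sup>2 + 2 * t * (v \<bullet> e) + t\<^sup>2" for v
      unfolding power2_norm_eq_inner
      by (simp add: inner_add_left inner_add_right inner_commute[of e v] ee power2_eq_square algebra_simps)
    from this[of "a - x"] have "(norm ((a - x) + t *\<^sub>R e))\<^sup>2 = (norm (a - x))\<^sup>2 + 2 * t * ((a - x) \<bullet> e) + t\<^sup>2" .
    moreover have "dist x (a + t *\<^sub>R e) = norm ((a - x) + t *\<^sub>R e)"
      by (simp add: dist_norm norm_minus_commute algebra_simps)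
    ultimately show ?thesis by (metis abs_norm_cancel real_sqrt_abs)
  qed
  have g_eq: "exp (- \<bar>t\<bar>) = g t" for t
  proof -
    have "0 = c a * exp (- dist a (a + t *\<^sub>R e)) + (\<Sum>x\<in>A - {a}. c x * exp (- dist x (a + t *\<^sub>R e)))"
      using zero[of "a + t *\<^sub>R e"] A a(1) by (simp add: sum.remove)
    moreover have "dist a (a + t *\<^sub>R e) = \<bar>t\<bar>" using e by (simp add: dist_norm)
    ultimately show ?thesis unfolding dist_eq g_def using a(2) by (simp add: field_simps)
  qed
  have "\<exists>D. (g has_real_derivative D) (at 0)"
  proof -
    have "\<exists>D. ((\<lambda>t. c x * exp (- sqrt ((norm (a - x))\<^sup>2 + 2 * t * ((a - x) \<bullet> e) + t\<^sup>2))) has_real_derivative D) (at 0)" if "x \<in> A - {a}" for x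
    proof -
      have "(norm (a - x))\<^sup>2 > 0" using that by auto
      then have "((\<lambda>t. c x * exp (- sqrt ((norm (a - x))\<^sup>2 + 2 * t * ((a - x) \<bullet> e) + t\<^sup>2))) has_real_derivative
        c x * (exp (- sqrt ((norm (a - x))\<^sup>2)) * - ((2 * ((a - x) \<bullet> e)) * (inverse (sqrt ((norm (a - x))\<^sup>2)) / 2)))) (at 0)"
        by (auto intro!: derivative_eq_intros)
      then show ?thesis by blast
    qed
    then have "\<forall>x\<in>A - {a}. \<exists>D. ((\<lambda>t. c x * exp (- sqrt ((norm (a - x))\<^sup>2 + 2 * t * ((a - x) \<bullet> e) + t\<^sup>2))) has_real_derivative D) (at 0)"
      by (rule ballI)
    from bchoice[OF this] obtain D where "\<forall>x\<in>A - {a}. ((\<lambda>t. c x * exp (- sqrt ((norm (a - x))\<^sup>2 + 2 * t * ((a - x) \<bullet> e) + t\<^sup>2))) has_real_derivative D x) (at 0)" ..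
    then have D: "\<And>x. x \<in> A - {a} \<Longrightarrow> ((\<lambda>t. c x * exp (- sqrt ((norm (a - x))\<^sup>2 + 2 * t * ((a - x) \<bullet> e) + t\<^sup>2))) has_real_derivative D x) (at 0)"
      by (rule bspec)
    have "(g has_real_derivative - (\<Sum>x\<in>A - {a}. D x) / c a) (at 0)"
      unfolding g_def[abs_def] by (intro DERIV_cdivide DERIV_minus DERIV_sum D)
    then show ?thesis by blast
  qed
  then obtain D where D: "(g has_real_derivative D) (at 0)" by blast
  then have D': "((\<lambda>t. exp (- \<bar>t\<bar>)) has_real_derivative D) (at 0)" unfolding g_eq .
  \<comment> \<open>The maximum at 0 forces derivative 0, but the right derivative of
    \<open>exp (- \<bar>t\<bar>)\<close> at 0 is \<open>-1\<close>.\<close>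
  have "D = 0"
    by (rule DERIV_local_max[OF D', of 1]) auto
  have "((\<lambda>h. (exp (- \<bar>0 + h\<bar>) - exp (- \<bar>0\<bar>)) / h) \<longlongrightarrow> D) (at 0)" using D' by (simp add: DERIV_def)
  then have 1: "((\<lambda>h::real. (exp (- \<bar>h\<bar>) - 1) / h) \<longlongrightarrow> D) (at_right 0)" by (simp add: filterlim_at_split)
  have "((\<lambda>t::real. exp (- t)) has_real_derivative -1) (at 0)" by (auto intro!: derivative_eq_intros)
  then have "((\<lambda>h::real. (exp (- h) - 1) / h) \<longlongrightarrow> -1) (at 0)" by (simp add: DERIV_def)
  then have "((\<lambda>h::real. (exp (- h) - 1) / h) \<longlongrightarrow> -1) (at_right 0)" by (simp add: filterlim_at_split)
  moreover have "\<forall>\<^sub>F h in at_right (0::real). (exp (- h) - 1) / h = (exp (- \<bar>h\<bar>) - 1) / h"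
    using eventually_at_right_less[of "0::real"] by eventually_elim simp
  ultimately have "((\<lambda>h::real. (exp (- \<bar>h\<bar>) - 1) / h) \<longlongrightarrow> -1) (at_right 0)" by (rule Lim_transform_eventually)
  with 1 have "D = -1" by (rule tendsto_unique[rotated]) simp
  with \<open>D = 0\<close> show False by simp
qed

lemma weighting_exists:
  assumes n: "CARD('n::finite) = 2 * q + 1" and A: "finite (A :: (real^'n) set)"
  shows "\<exists>w. weighting A w"
proof -
  have "\<exists>w. \<forall>x\<in>A. (\<Sum>y\<in>A. exp (- dist x y) * w y) = 1"
    by (rule strictly_positive_definite_solvable[OF A])
      (use exp_energy_pos[OF n A] in \<open>auto simp: exp_energy_def dist_commute\<close>)
  then show ?thesis by (simp add: weighting_def)
qed

lemma sum_square_le_weight_mass: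
  assumes n: "CARD('n::finite) = 2 * q + 1" and A: "finite A" "A \<subseteq> cball 0 R" and R: "R > 0"
    and bal: "boundary_balance q R (even_poly q x) b"
    and norm: "2 * exp_moment (radial_poly q * monom 1 (2 * q)) * x q = 1"
  shows "(sum c A)\<^sup>2 \<le> (LINT s|weight_space R. weight_density R (even_poly q x) b s) * exp_energy A (c :: real^'n \<Rightarrow> real)"
proof -
  let ?V = "LINT s|weight_space R. weight_density R (even_poly q x) b s"
  let ?W = "weight_potential R (even_poly q x) b"
  let ?vol = "measure lborel (cball (0::real^'n) 1)"
  interpret M: finite_measure "ball_measure 1 :: (real^'n) measure" by (rule finite_measure_ball_measure)
  have V: "\<kappa> * (LINT u|lborel. (?W u)\<^sup>2) = ?V" using weight_energy[OF R bal] norm by simp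
  have dir: "(sum c A)\<^sup>2 \<le> ?V * directional_energy q A c y" for y
  proof -
    have "\<kappa> * (LINT u|lborel. direction_potential A c y u * ?W u) =
      (\<Sum>a\<in>A. c a * (LINT t|weight_space R. weight_density R (even_poly q x) b t * radial_kernel q (sgn y \<bullet> a - clamp_real R t)))"
      by (subst potential_inner[OF signed_density_count_space[OF A(1)] signed_density_weight[OF R]])
        (simp add: lebesgue_integral_count_space_finite A(1))
    also have "\<dots> = (\<Sum>a\<in>A. c a * 1)"
    proof (rule sum.cong[OF refl])
      fix a assume "a \<in> A"
      \<comment> \<open>Projections of points of the ball stay where the weight has potential 1;
        this includes \<open>y = 0\<close>, where they are all 0.\<close>
      then have "\<bar>sgn y \<bullet> a\<bar> \<le> R" using A(2) abs_sgn_inner_le[of y a] by auto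
      then show "c a * (LINT t|weight_space R. weight_density R (even_poly q x) b t * radial_kernel q (sgn y \<bullet> a - clamp_real R t)) = c a * 1"
        using weight_kernel_integral[OF R _ bal] norm by simp
    qed
    finally have "(sum c A)\<^sup>2 = \<kappa>\<^sup>2 * (LINT u|lborel. direction_potential A c y u * ?W u)\<^sup>2"
      by (simp add: power_mult_distrib[symmetric])
    also have "\<dots> \<le> \<kappa>\<^sup>2 * ((LINT u|lborel. (direction_potential A c y u)\<^sup>2) * (LINT u|lborel. (?W u)\<^sup>2))"
      by (intro mult_left_mono potential_Cauchy_Schwarz signed_density_count_space[OF A(1)] signed_density_weight[OF R]) simp
    also have "\<dots> = ?V * directional_energy q A c y"
      unfolding directional_energy_eq[OF A(1)] V[symmetric] by (simp add: power2_eq_square)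
    finally show ?thesis .
  qed
  have "?vol * (sum c A)\<^sup>2 = (LINT y|(ball_measure 1 :: (real^'n) measure). (sum c A)\<^sup>2)"
    by (simp add: measure_ball_measure)
  also have "\<dots> \<le> (LINT y|ball_measure 1. ?V * directional_energy q A c y)"
    by (rule integral_mono) (use dir exp_energy_average(1)[OF n] in auto)
  also have "\<dots> = ?vol * (?V * exp_energy A c)" by (simp add: exp_energy_average(2)[OF n, symmetric] mult_ac)
  finally show ?thesis using unit_ball_volume_pos[where 'a = "real^'n"] by simp
qed

end

section \<open>The lower bound\<close>

lemma cball_real_eq: "cball (0::real) R = {-R..R}"
  by (auto simp: cball_def dist_real_def)

lemma integrable_ball_measure_bounded:
  fixes f :: "'a::euclidean_space \<Rightarrow> real"
  assumes "f \<in> borel_measurable borel" "\<And>x. norm x \<le> R \<Longrightarrow> \<bar>f x\<bar> \<le> B"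
  shows "integrable (ball_measure R) f"
proof -
  interpret finite_measure "ball_measure R :: 'a measure" by (rule finite_measure_ball_measure)
  have "AE x in ball_measure R. norm (x::'a) \<le> R" by (rule AE_ball_measure)
  then have "AE x in ball_measure R. norm (f x) \<le> B" by (rule eventually_mono) (use assms(2) in auto)
  then show ?thesis by (rule integrable_const_bound) (use assms(1) in simp)
qed

text \<open>For large \<open>N\<close> the first factor concentrates at
  \<open>\<plusminus>R\<close>, replacing the two point masses; the second is the zero of order
  \<open>q\<close> that marginals of bounded radial polynomial densities have there.\<close>

definition endpoint_bump :: "nat \<Rightarrow> real \<Rightarrow> nat \<Rightarrow> real \<Rightarrow> real" where
  "endpoint_bump q R N t = (t\<^sup>2 / R\<^sup>2) ^ N * (1 - t\<^sup>2 / R\<^sup>2) ^ q"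

lemma endpoint_bump_measurable [measurable]: "endpoint_bump q R N \<in> borel_measurable borel"
  unfolding endpoint_bump_def by (intro borel_measurable_continuous_onI) (simp add: divide_inverse, intro continuous_intros)

lemma square_ratio_bounds:
  assumes "R > 0" "\<bar>t\<bar> \<le> (r::real)" "r \<le> R"
  shows "0 \<le> t\<^sup>2 / R\<^sup>2" "t\<^sup>2 / R\<^sup>2 \<le> r\<^sup>2 / R\<^sup>2" "t\<^sup>2 / R\<^sup>2 \<le> 1"
proof -
  have "\<bar>t\<bar>\<^sup>2 \<le> r\<^sup>2" "\<bar>t\<bar>\<^sup>2 \<le> R\<^sup>2" by (rule power_mono; use assms in auto)+
  then show "0 \<le> t\<^sup>2 / R\<^sup>2" "t\<^sup>2 / R\<^sup>2 \<le> r\<^sup>2 / R\<^sup>2" "t\<^sup>2 / R\<^sup>2 \<le> 1"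
    using assms(1) by (auto intro: divide_right_mono)
qed

lemma endpoint_bump_bounds:
  assumes "R > 0" "\<bar>t\<bar> \<le> r" "r \<le> R"
  shows "0 \<le> endpoint_bump q R N t" "endpoint_bump q R N t \<le> (r\<^sup>2 / R\<^sup>2) ^ N"
proof -
  note b = square_ratio_bounds[OF assms]
  show "0 \<le> endpoint_bump q R N t" unfolding endpoint_bump_def using b by simp
  have "endpoint_bump q R N t \<le> (r\<^sup>2 / R\<^sup>2) ^ N * 1"
    unfolding endpoint_bump_def using b by (intro mult_mono power_mono power_le_one) auto
  then show "endpoint_bump q R N t \<le> (r\<^sup>2 / R\<^sup>2) ^ N" by simp
qed

definition endpoint_mass :: "nat \<Rightarrow> real \<Rightarrow> nat \<Rightarrow> real" where
  "endpoint_mass q R N = (LINT t|ball_measure R. endpoint_bump q R N t)"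

lemma integrable_endpoint_bump_mult:
  assumes R: "R > 0" and [measurable]: "h \<in> borel_measurable borel" and B: "\<And>t. \<bar>h t\<bar> \<le> B"
  shows "integrable (ball_measure R) (\<lambda>t. endpoint_bump q R N t * h t)"
proof (rule integrable_ball_measure_bounded)
  show "\<bar>endpoint_bump q R N t * h t\<bar> \<le> 1 * B" if t: "norm t \<le> R" for t
    unfolding abs_mult using endpoint_bump_bounds[OF R, of t R q N] t B R by (intro mult_mono) auto
qed measurable

text \<open>At distance at least \<open>d\<close> from the endpoints the bump is at most
  \<open>((R - d)\<^sup>2 / R\<^sup>2) ^ N\<close>. The base here is strictly larger, so that part
  is negligible relative to the total mass.\<close>

lemma endpoint_mass_lower:
  assumes R: "R > 0" and d: "0 < d" "d < R"
  shows "\<exists>\<eta>>0. \<forall>N. \<eta> * ((R - d / 2)\<^sup>2 / R\<^sup>2) ^ N \<le> endpoint_mass q R N"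
proof -
  \<comment> \<open>Close to \<open>R\<close>, but away from \<open>R\<close> itself, so that
    \<open>(1 - t\<^sup>2 / R\<^sup>2) ^ q\<close> has a positive lower bound \<eta> on it.\<close>
  define I where "I = {R - d / 2..R - d / 4}"
  define \<eta> where "\<eta> = (1 - (R - d / 4)\<^sup>2 / R\<^sup>2) ^ q"
  have "(R - d / 4)\<^sup>2 < R\<^sup>2" using d by (intro power_strict_mono) auto
  then have eta: "\<eta> > 0" unfolding \<eta>_def using R by (intro zero_less_power) simp
  have "\<eta> * (d / 4) * ((R - d / 2)\<^sup>2 / R\<^sup>2) ^ N \<le> endpoint_mass q R N" for N
  proof -
    have mI: "(LINT t|ball_measure R. indicat_real I t) = d / 4"
    proof -
      have "(LINT t|ball_measure R. indicat_real I t) = (LINT t:{-R..R}|lborel. indicat_real I t)"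
        by (subst integral_ball_measure) (auto simp: cball_real_eq I_def)
      also have "\<dots> = (LINT t|lborel. indicat_real I t)"
        unfolding set_lebesgue_integral_def
        by (rule Bochner_Integration.integral_cong) (use d in \<open>auto simp: I_def indicator_def\<close>)
      also have "\<dots> = d / 4" using d by (simp add: I_def)
      finally show ?thesis .
    qed
    have "\<eta> * ((R - d / 2)\<^sup>2 / R\<^sup>2) ^ N * indicat_real I t \<le> endpoint_bump q R N t" if t: "norm t \<le> R" for t
    proof (cases "t \<in> I")
      case True
      have t': "0 \<le> R - d / 2" "R - d / 2 \<le> t" "t \<le> R - d / 4" "0 \<le> t" using True d by (auto simp: I_def)
      have "(R - d / 2)\<^sup>2 \<le> t\<^sup>2" "t\<^sup>2 \<le> (R - d / 4)\<^sup>2" using t' by (auto intro!: power_mono)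
      then have "(R - d / 2)\<^sup>2 / R\<^sup>2 \<le> t\<^sup>2 / R\<^sup>2" "t\<^sup>2 / R\<^sup>2 \<le> (R - d / 4)\<^sup>2 / R\<^sup>2"
        by (auto intro: divide_right_mono)
      then have "((R - d / 2)\<^sup>2 / R\<^sup>2) ^ N * \<eta> \<le> endpoint_bump q R N t"
        unfolding endpoint_bump_def \<eta>_def using \<open>(R - d / 4)\<^sup>2 < R\<^sup>2\<close> R
        by (intro mult_mono power_mono) auto
      then show ?thesis using True by (simp add: mult.commute)
    next
      case False
      then show ?thesis using endpoint_bump_bounds(1)[OF R, of t R] t by simp
    qed
    note le = this
    have "(LINT t|ball_measure R. \<eta> * ((R - d / 2)\<^sup>2 / R\<^sup>2) ^ N * indicat_real I t) \<le> endpoint_mass q R N"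
      unfolding endpoint_mass_def
    proof (rule integral_mono_AE)
      show "integrable (ball_measure R) (\<lambda>t. \<eta> * ((R - d / 2)\<^sup>2 / R\<^sup>2) ^ N * indicat_real I t :: real)"
        by (intro integrable_mult_right integrable_ball_measure_bounded[where B = 1]) (auto simp: I_def indicator_def)
      show "integrable (ball_measure R) (endpoint_bump q R N)"
        using integrable_endpoint_bump_mult[OF R, of "\<lambda>_. 1" 1] by simp
      have "AE t in ball_measure R. norm (t::real) \<le> R" by (rule AE_ball_measure)
      then show "AE t in ball_measure R. \<eta> * ((R - d / 2)\<^sup>2 / R\<^sup>2) ^ N * indicat_real I t \<le> endpoint_bump q R N t"
        by (rule eventually_mono) (rule le)
    qed
    also have "(LINT t|ball_measure R. \<eta> * ((R - d / 2)\<^sup>2 / R\<^sup>2) ^ N * indicat_real I t) = \<eta> * ((R - d / 2)\<^sup>2 / R\<^sup>2) ^ N * (d / 4)"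
      by (subst integral_mult_right_zero) (simp only: mI)
    finally show ?thesis by (simp only: mult_ac)
  qed
  then show ?thesis using eta d by (intro exI[of _ "\<eta> * (d / 4)"]) auto
qed

lemma endpoint_mass_pos: "R > 0 \<Longrightarrow> endpoint_mass q R N > 0"
proof -
  assume R: "R > 0"
  then obtain \<eta> where "\<eta> > 0" "\<And>N. \<eta> * ((R - R / 2 / 2)\<^sup>2 / R\<^sup>2) ^ N \<le> endpoint_mass q R N"
    using endpoint_mass_lower[OF R, of "R / 2" q] by auto
  moreover have "0 < ((R - R / 2 / 2)\<^sup>2 / R\<^sup>2) ^ N" using R by simp
  ultimately show ?thesis by (meson mult_pos_pos order_less_le_trans)
qed

lemma reflect_ball_measure:
  assumes [measurable]: "f \<in> borel_measurable borel"
  shows "(LINT t|ball_measure R. f (- t :: real)) = (LINT t|ball_measure R. f t :: real)"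
proof -
  have "(LINT t|ball_measure R. f t) = (LINT t|lborel. indicator {-R..R} t * f t)"
    by (subst integral_ball_measure) (auto simp: cball_real_eq set_lebesgue_integral_def)
  also have "\<dots> = (LINT t|lborel. indicator {-R..R} (0 + (-1) * t) * f (0 + (-1) * t))"
    by (subst lborel_integral_real_affine[of "-1" _ 0]) auto
  also have "\<dots> = (LINT t|lborel. indicator {-R..R} t * f (- t))"
    by (rule Bochner_Integration.integral_cong) (auto simp: indicator_def)
  also have "\<dots> = (LINT t|ball_measure R. f (- t))"
    by (subst integral_ball_measure) (auto simp: cball_real_eq set_lebesgue_integral_def)
  finally show ?thesis by simp
qed

text \<open>The bump is even, so half of its mass gathers at each endpoint, and the factor 2 makes
  both limiting masses 1. Passing from \<open>h t\<close> to \<open>h t + h (- t)\<close> leaves a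
  single limit at \<open>R\<close> to establish.\<close>

lemma endpoint_concentration:
  assumes R: "R > 0" and h [measurable]: "h \<in> borel_measurable borel" and B: "\<And>t. \<bar>h t\<bar> \<le> B"
    and cont: "isCont h R" "isCont h (- R)"
  shows "(\<lambda>N. (LINT t|ball_measure R. endpoint_bump q R N t * h t) * 2 / endpoint_mass q R N) \<longlonglongrightarrow> h R + h (- R)"
proof -
  define k where "k t = h t + h (- t)" for t
  have [measurable]: "k \<in> borel_measurable borel" unfolding k_def by measurable
  have kB: "\<bar>k t\<bar> \<le> 2 * B" for t using B[of t] B[of "-t"] unfolding k_def by linarith
  have B0: "B \<ge> 0" using B[of 0] by linarith
  let ?J = "endpoint_mass q R"
  let ?b = "endpoint_bump q R"
  have J: "?J N > 0" for N by (rule endpoint_mass_pos[OF R])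
  have bi: "integrable (ball_measure R) (?b N)" for N
    using integrable_endpoint_bump_mult[OF R, of "\<lambda>_. 1" 1] by simp
  have sym: "(LINT t|ball_measure R. ?b N t * h t) * 2 = (LINT t|ball_measure R. ?b N t * k t)" for N
  proof -
    have "(LINT t|ball_measure R. ?b N t * h t) = (LINT t|ball_measure R. ?b N t * h (- t))"
      using reflect_ball_measure[of "\<lambda>t. ?b N t * h t" R] by (simp add: endpoint_bump_def)
    moreover have "(LINT t|ball_measure R. ?b N t * k t) = (LINT t|ball_measure R. ?b N t * h t) + (LINT t|ball_measure R. ?b N t * h (- t))"
      unfolding k_def distrib_left
      by (rule Bochner_Integration.integral_add; rule integrable_endpoint_bump_mult[OF R]) (use B in auto)
    ultimately show ?thesis by simp
  qed
  have "(\<lambda>N. (LINT t|ball_measure R. ?b N t * k t) / ?J N) \<longlonglongrightarrow> k R"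
  proof (rule LIMSEQ_I)
    fix r :: real assume r: "r > 0"
    have "isCont (\<lambda>x. h (- x)) R" by (rule isCont_o2[where g = h]) (use cont in auto)
    then have "isCont k R" unfolding k_def using cont by (intro continuous_intros)
    then obtain d0 where d0: "d0 > 0" "\<And>t. dist t R < d0 \<Longrightarrow> dist (k t) (k R) < r / 2"
      using r unfolding continuous_at_eps_delta by (metis half_gt_zero)
    define d where "d = min d0 R / 2"
    have d: "0 < d" "d < R" "d < d0" using d0 R by (auto simp: d_def)
    have near: "\<bar>k t - k R\<bar> \<le> r / 2" if t: "\<bar>t\<bar> \<le> R" "\<bar>t\<bar> > R - d" for t
    proof -
      have "dist \<bar>t\<bar> R < d0" using t d by (auto simp: dist_real_def)
      then have "dist (k \<bar>t\<bar>) (k R) < r / 2" by (rule d0(2))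
      moreover have "k \<bar>t\<bar> = k t" by (cases "t \<ge> 0") (auto simp: k_def)
      ultimately show ?thesis by (simp add: dist_real_def)
    qed
    obtain \<eta> where eta: "\<eta> > 0" "\<And>N. \<eta> * ((R - d / 2)\<^sup>2 / R\<^sup>2) ^ N \<le> ?J N"
      using endpoint_mass_lower[OF R d(1,2)] by blast
    \<comment> \<open>Ratio of the bases in the upper bound away from the endpoints and in the lower
      bound for the total mass.\<close>
    define \<rho> where "\<rho> = ((R - d)\<^sup>2 / R\<^sup>2) / ((R - d / 2)\<^sup>2 / R\<^sup>2)"
    define m where "m = measure (ball_measure R) (UNIV :: real set)"
    have rho: "0 \<le> \<rho>" "\<rho> < 1"
    proof -
      have "(R - d)\<^sup>2 < (R - d / 2)\<^sup>2" using d by (intro power_strict_mono) auto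
      moreover have "0 < (R - d / 2)\<^sup>2" using d by simp
      ultimately show "0 \<le> \<rho>" "\<rho> < 1" using R by (simp_all add: \<rho>_def)
    qed
    have main: "\<bar>(LINT t|ball_measure R. ?b N t * k t) / ?J N - k R\<bar> \<le> r / 2 + 4 * B * m / \<eta> * \<rho> ^ N" for N
    proof -
      interpret finite_measure "ball_measure R :: real measure" by (rule finite_measure_ball_measure)
      have pt: "\<bar>?b N t * (k t - k R)\<bar> \<le> r / 2 * ?b N t + 4 * B * ((R - d)\<^sup>2 / R\<^sup>2) ^ N" if t: "norm t \<le> R" for t
      proof (cases "\<bar>t\<bar> > R - d")
        case True
        have "\<bar>?b N t * (k t - k R)\<bar> \<le> ?b N t * (r / 2)"
          unfolding abs_mult using near[OF _ True] endpoint_bump_bounds(1)[OF R, of t R] t by (intro mult_mono) auto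
        moreover have "0 \<le> 4 * B * ((R - d)\<^sup>2 / R\<^sup>2) ^ N" using B0 by simp
        ultimately show ?thesis by (simp add: mult.commute)
      next
        case False
        have b: "0 \<le> ?b N t" "?b N t \<le> ((R - d)\<^sup>2 / R\<^sup>2) ^ N"
          using endpoint_bump_bounds[OF R, of t "R - d" q N] False d by auto
        have "\<bar>k t - k R\<bar> \<le> 4 * B" using kB[of t] kB[of R] by linarith
        then have "\<bar>?b N t * (k t - k R)\<bar> \<le> ((R - d)\<^sup>2 / R\<^sup>2) ^ N * (4 * B)"
          unfolding abs_mult using b by (intro mult_mono) auto
        moreover have "0 \<le> r / 2 * ?b N t" using b r by simp
        ultimately show ?thesis by (simp add: mult.commute)
      qed
      have i: "integrable (ball_measure R) (\<lambda>t. ?b N t * (k t - k R))"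
      proof (rule integrable_endpoint_bump_mult[OF R])
        show "\<bar>k t - k R\<bar> \<le> 4 * B" for t using kB[of t] kB[of R] by linarith
      qed measurable
      have "(LINT t|ball_measure R. ?b N t * k t) - k R * ?J N = (LINT t|ball_measure R. ?b N t * (k t - k R))"
        unfolding endpoint_mass_def right_diff_distrib
        by (subst Bochner_Integration.integral_diff) (use bi integrable_endpoint_bump_mult[OF R _ kB] in \<open>auto simp: mult.commute\<close>)
      also have "\<bar>\<dots>\<bar> \<le> (LINT t|ball_measure R. \<bar>?b N t * (k t - k R)\<bar>)" by (rule integral_abs_bound)
      also have "\<dots> \<le> (LINT t|ball_measure R. r / 2 * ?b N t + 4 * B * ((R - d)\<^sup>2 / R\<^sup>2) ^ N)"
      proof (rule integral_mono_AE)
        have "AE t in ball_measure R. norm (t::real) \<le> R" by (rule AE_ball_measure)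
        then show "AE t in ball_measure R. \<bar>?b N t * (k t - k R)\<bar> \<le> r / 2 * ?b N t + 4 * B * ((R - d)\<^sup>2 / R\<^sup>2) ^ N"
          by (rule eventually_mono) (rule pt)
      qed (use i bi in auto)
      also have "\<dots> = r / 2 * ?J N + 4 * B * m * ((R - d)\<^sup>2 / R\<^sup>2) ^ N"
        using bi by (simp add: endpoint_mass_def m_def mult_ac)
      finally have 1: "\<bar>(LINT t|ball_measure R. ?b N t * k t) - k R * ?J N\<bar> \<le> r / 2 * ?J N + 4 * B * m * ((R - d)\<^sup>2 / R\<^sup>2) ^ N" .
      have "\<bar>(LINT t|ball_measure R. ?b N t * k t) / ?J N - k R\<bar> = \<bar>(LINT t|ball_measure R. ?b N t * k t) - k R * ?J N\<bar> / ?J N"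
      proof -
        have "\<bar>x / y - z\<bar> = \<bar>x - z * y\<bar> / y" if "y > 0" for x y z :: real
        proof -
          have "x / y - z = (x - z * y) / y" using that by (simp add: field_simps)
          then show ?thesis using that by simp
        qed
        then show ?thesis using J[of N] by blast
      qed
      also have "\<dots> \<le> (r / 2 * ?J N + 4 * B * m * ((R - d)\<^sup>2 / R\<^sup>2) ^ N) / ?J N"
        using 1 J[of N] by (intro divide_right_mono) auto
      also have "\<dots> = r / 2 + 4 * B * m * ((R - d)\<^sup>2 / R\<^sup>2) ^ N / ?J N" using J[of N] by (simp add: add_divide_distrib)
      also have "4 * B * m * ((R - d)\<^sup>2 / R\<^sup>2) ^ N / ?J N \<le> 4 * B * m * ((R - d)\<^sup>2 / R\<^sup>2) ^ N / (\<eta> * ((R - d / 2)\<^sup>2 / R\<^sup>2) ^ N)"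
      proof (rule divide_left_mono[OF eta(2)])
        show "0 \<le> 4 * B * m * ((R - d)\<^sup>2 / R\<^sup>2) ^ N" using B0 by (simp add: m_def)
        have "0 < ((R - d / 2)\<^sup>2 / R\<^sup>2) ^ N" using d R by simp
        then show "0 < ?J N * (\<eta> * ((R - d / 2)\<^sup>2 / R\<^sup>2) ^ N)" using J[of N] eta(1) by (intro mult_pos_pos) auto
      qed
      also have "4 * B * m * ((R - d)\<^sup>2 / R\<^sup>2) ^ N / (\<eta> * ((R - d / 2)\<^sup>2 / R\<^sup>2) ^ N) = 4 * B * m / \<eta> * \<rho> ^ N"
        unfolding \<rho>_def power_divide[of _ "(R - d / 2)\<^sup>2 / R\<^sup>2" N] by (simp only: times_divide_eq_right times_divide_eq_left divide_divide_eq_left mult_ac)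
      finally show ?thesis by simp
    qed
    have "(\<lambda>N. 4 * B * m / \<eta> * \<rho> ^ N) \<longlonglongrightarrow> 4 * B * m / \<eta> * 0"
      by (intro tendsto_mult tendsto_const LIMSEQ_power_zero) (use rho in auto)
    then have "\<forall>\<^sub>F N in sequentially. 4 * B * m / \<eta> * \<rho> ^ N < r / 2"
      using r by (intro order_tendstoD(2)) auto
    then obtain N0 where N0: "\<And>N. N \<ge> N0 \<Longrightarrow> 4 * B * m / \<eta> * \<rho> ^ N < r / 2"
      by (auto simp: eventually_sequentially)
    then show "\<exists>no. \<forall>N\<ge>no. norm ((LINT t|ball_measure R. ?b N t * k t) / ?J N - k R) < r"
    proof (intro exI[of _ N0] allI impI)
      fix N assume "N0 \<le> N"
      with N0 main[of N] show "norm ((LINT t|ball_measure R. ?b N t * k t) / ?J N - k R) < r"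
        by fastforce
    qed
  qed
  then show ?thesis unfolding sym k_def .
qed

section \<open>Radial densities on the ball with prescribed marginal\<close>

lemma sphere_power_bounds:
  assumes "norm (x :: 'a::real_normed_vector) \<le> R"
  shows "0 \<le> R\<^sup>2 - (norm x)\<^sup>2" "\<bar>(R\<^sup>2 - (norm x)\<^sup>2) ^ a\<bar> \<le> (R\<^sup>2) ^ a"
proof -
  show 1: "0 \<le> R\<^sup>2 - (norm x)\<^sup>2" using assms by (simp add: power_mono)
  then show "\<bar>(R\<^sup>2 - (norm x)\<^sup>2) ^ a\<bar> \<le> (R\<^sup>2) ^ a" by (simp add: power_abs[symmetric] power_mono)
qed

definition radial_marginal :: "nat \<Rightarrow> real \<Rightarrow> real poly \<Rightarrow> real \<Rightarrow> real" where
  "radial_marginal q R p t = (R\<^sup>2 - t\<^sup>2) ^ q * poly p (R\<^sup>2 - t\<^sup>2)"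

lemma radial_marginal_measurable [measurable]: "radial_marginal q R p \<in> borel_measurable borel"
  unfolding radial_marginal_def by (intro borel_measurable_continuous_onI continuous_intros)

text \<open>The power \<open>a\<close> of \<open>R\<^sup>2 - (norm x)\<^sup>2\<close> has as
  marginal \<open>c a\<close> times the power \<open>a + q\<close> of
  \<open>R\<^sup>2 - t\<^sup>2\<close>. Dividing the coefficients of \<open>p\<close> by these
  constants gives the radial density.\<close>

lemma radial_profile_exists:
  assumes n: "CARD('n::finite) = 2 * q + 1" and R: "R > 0"
  shows "\<exists>g G. g \<in> borel_measurable borel \<and> (\<forall>x::real^'n. \<bar>g x\<bar> \<le> G) \<and>
    (\<forall>\<theta> h. norm \<theta> = 1 \<longrightarrow> h \<in> borel_measurable borel \<longrightarrow> (\<exists>B. \<forall>t::real. \<bar>h t\<bar> \<le> B) \<longrightarrow>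
      (LINT x|ball_measure R. g x * h (\<theta> \<bullet> x)) = (LINT t|ball_measure R. radial_marginal q R p t * h t))"
proof -
  have "\<forall>a. \<exists>c>0. \<forall>R>0. \<forall>\<theta>::real^'n. norm \<theta> = 1 \<longrightarrow> (\<forall>h::real \<Rightarrow> real. h \<in> borel_measurable borel \<longrightarrow>
    (LINT x:cball 0 R|lborel. (R\<^sup>2 - (norm x)\<^sup>2) ^ a * h (\<theta> \<bullet> x))
    = c * (LINT t:{-R..R}|lborel. (R\<^sup>2 - t\<^sup>2) ^ (a + q) * h t))"
    using ball_marginal_integral[OF n] by blast
  from choice[OF this] obtain c where c0: "\<And>a. c a > 0" and c1: "\<And>a R \<theta> h. R > 0 \<Longrightarrow> norm (\<theta>::real^'n) = 1 \<Longrightarrow> h \<in> borel_measurable borel \<Longrightarrow>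
    (LINT x:cball 0 R|lborel. (R\<^sup>2 - (norm x)\<^sup>2) ^ a * h (\<theta> \<bullet> x))
    = c a * (LINT t:{-R..R}|lborel. (R\<^sup>2 - t\<^sup>2) ^ (a + q) * (h t :: real))" by blast
  define g0 where "g0 x = (\<Sum>a\<le>degree p. coeff p a / c a * (R\<^sup>2 - (norm x)\<^sup>2) ^ a)" for x :: "real^'n"
  \<comment> \<open>The cutoff makes \<open>g\<close> bounded on the whole space and leaves its
    values on the ball as they are.\<close>
  define g where "g x = indicator (cball 0 R) x * g0 x" for x
  define G where "G = (\<Sum>a\<le>degree p. \<bar>coeff p a / c a\<bar> * (R\<^sup>2) ^ a)"
  have [measurable]: "cball (0::real^'n) R \<in> sets borel" by simp
  have [measurable]: "g0 \<in> borel_measurable borel" unfolding g0_def by measurable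
  have [measurable]: "g \<in> borel_measurable borel" unfolding g_def by measurable
  have G: "\<bar>g x\<bar> \<le> G" for x
  proof (cases "norm x \<le> R")
    case True
    have "\<bar>g0 x\<bar> \<le> G" unfolding g0_def G_def
      by (rule order_trans[OF sum_abs sum_mono], subst abs_mult, rule mult_left_mono[OF sphere_power_bounds(2)[OF True]]) simp
    then show ?thesis using True by (simp add: g_def)
  next
    case False
    have "0 \<le> G" unfolding G_def by (intro sum_nonneg) auto
    then show ?thesis using False by (simp add: g_def)
  qed
  have "(LINT x|ball_measure R. g x * h (\<theta> \<bullet> x)) = (LINT t|ball_measure R. radial_marginal q R p t * h t)"
    if th: "norm \<theta> = 1" and h [measurable]: "h \<in> borel_measurable borel" and B: "\<And>t. \<bar>h t\<bar> \<le> B" for \<theta> :: "real^'n" and h :: "real \<Rightarrow> real" and B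
  proof -
    have "(LINT x|ball_measure R. g x * h (\<theta> \<bullet> x)) = (LINT x|ball_measure R. (\<Sum>a\<le>degree p. coeff p a / c a * ((R\<^sup>2 - (norm x)\<^sup>2) ^ a * h (\<theta> \<bullet> x))))"
    proof (rule integral_cong_AE)
      show "AE x in ball_measure R. g x * h (\<theta> \<bullet> x) = (\<Sum>a\<le>degree p. coeff p a / c a * ((R\<^sup>2 - (norm x)\<^sup>2) ^ a * h (\<theta> \<bullet> x)))"
        using AE_ball_measure[of R, where 'a = "real^'n"]
        by (rule eventually_mono) (simp add: g_def g0_def sum_distrib_right mult.assoc)
    qed measurable
    also have "\<dots> = (\<Sum>a\<le>degree p. coeff p a / c a * (LINT x|ball_measure R. (R\<^sup>2 - (norm x)\<^sup>2) ^ a * h (\<theta> \<bullet> x)))"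
    proof (subst Bochner_Integration.integral_sum)
      fix a
      have "integrable (ball_measure R) (\<lambda>x. (R\<^sup>2 - (norm x)\<^sup>2) ^ a * h (\<theta> \<bullet> x))"
        by (rule integrable_ball_measure_bounded[where B = "(R\<^sup>2) ^ a * B"])
          (use sphere_power_bounds(2)[of _ R a] B in \<open>auto simp: abs_mult intro!: mult_mono\<close>)
      then show "integrable (ball_measure R) (\<lambda>x. coeff p a / c a * ((R\<^sup>2 - (norm x)\<^sup>2) ^ a * h (\<theta> \<bullet> x)))"
        by (rule integrable_mult_right)
    qed simp
    also have "\<dots> = (\<Sum>a\<le>degree p. coeff p a * (LINT t|ball_measure R. (R\<^sup>2 - t\<^sup>2) ^ (a + q) * h t))"
    proof (rule sum.cong[OF refl])
      fix a
      have "(LINT x|ball_measure R. (R\<^sup>2 - (norm x)\<^sup>2) ^ a * h (\<theta> \<bullet> x)) = c a * (LINT t:{-R..R}|lborel. (R\<^sup>2 - t\<^sup>2) ^ (a + q) * h t)"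
        using c1[OF R th h, of a] by (subst integral_ball_measure) auto
      also have "(LINT t:{-R..R}|lborel. (R\<^sup>2 - t\<^sup>2) ^ (a + q) * h t) = (LINT t|ball_measure R. (R\<^sup>2 - t\<^sup>2) ^ (a + q) * h t)"
        by (subst integral_ball_measure) (auto simp: cball_real_eq)
      finally show "coeff p a / c a * (LINT x|ball_measure R. (R\<^sup>2 - (norm x)\<^sup>2) ^ a * h (\<theta> \<bullet> x)) = coeff p a * (LINT t|ball_measure R. (R\<^sup>2 - t\<^sup>2) ^ (a + q) * h t)"
        using c0[of a] by simp
    qed
    also have "\<dots> = (LINT t|ball_measure R. (\<Sum>a\<le>degree p. coeff p a * ((R\<^sup>2 - t\<^sup>2) ^ (a + q) * h t)))"
    proof (subst Bochner_Integration.integral_sum)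
      fix a
      have "integrable (ball_measure R) (\<lambda>t. (R\<^sup>2 - t\<^sup>2) ^ (a + q) * h t)"
        by (rule integrable_ball_measure_bounded[where B = "(R\<^sup>2) ^ (a + q) * B"])
          (use sphere_power_bounds(2)[of "_::real" R "a + q"] B in \<open>auto simp: abs_mult intro!: mult_mono\<close>)
      then show "integrable (ball_measure R) (\<lambda>t. coeff p a * ((R\<^sup>2 - t\<^sup>2) ^ (a + q) * h t))"
        by (rule integrable_mult_right)
    qed simp
    also have "(\<lambda>t. \<Sum>a\<le>degree p. coeff p a * ((R\<^sup>2 - t\<^sup>2) ^ (a + q) * h t)) = (\<lambda>t. radial_marginal q R p t * h t)"
      by (rule ext) (simp add: radial_marginal_def poly_altdef sum_distrib_left sum_distrib_right power_add mult_ac)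
    finally show ?thesis .
  qed
  then show ?thesis using G by (intro exI[of _ g] exI[of _ G]) auto
qed

context radial_feature begin

definition interval_pot :: "real \<Rightarrow> (real \<Rightarrow> real) \<Rightarrow> real \<Rightarrow> real" where
  "interval_pot R w u = (LINT t|ball_measure R. w t * \<phi> (u - t))"

text \<open>The energy in space is an average of energies on lines, and a radial density projects to
  the same \<open>w\<close> in every direction, so the average is over a constant.\<close>

lemma radial_energy:
  assumes n: "CARD('n::finite) = 2 * q + 1" and R: "R > 0" and [measurable]: "g \<in> borel_measurable borel"
    and G: "\<And>x::real^'n. \<bar>g x\<bar> \<le> G"
    and marg: "\<And>\<theta> h. norm \<theta> = 1 \<Longrightarrow> h \<in> borel_measurable borel \<Longrightarrow> (\<exists>B. \<forall>t::real. \<bar>h t\<bar> \<le> B) \<Longrightarrow>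
      (LINT x|ball_measure R. g x * h (\<theta> \<bullet> x)) = (LINT t|ball_measure R. w t * h t)"
    and [measurable]: "w \<in> borel_measurable borel"
  shows "(LINT x|ball_measure R. LINT x'|ball_measure R. g x * g x' * exp (- dist x x'))
    = \<kappa> * (LINT u|lborel. (interval_pot R w u)\<^sup>2)"
proof -
  define M where "M = (ball_measure R :: (real^'n) measure)"
  define B1 where "B1 = (ball_measure 1 :: (real^'n) measure)"
  define vol where "vol = measure lborel (cball (0::real^'n) 1)"
  have vol: "vol > 0" unfolding vol_def by (rule unit_ball_volume_pos)
  have [measurable_cong, simp]: "sets M = sets borel" "sets B1 = sets borel" and [simp]: "space M = UNIV" "space B1 = UNIV"
    by (simp_all add: M_def B1_def)
  have fin: "finite_measure M" "finite_measure B1" by (simp_all add: M_def B1_def finite_measure_ball_measure)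
  interpret M: finite_measure M by fact
  interpret B1: finite_measure B1 by fact
  have G0: "G \<ge> 0" using G[of 0] by linarith
  obtain C where C: "\<And>t. \<bar>radial_kernel q t\<bar> \<le> C" using radial_kernel_bounded by blast
  obtain C' where C': "\<And>t. \<bar>\<phi> t\<bar> \<le> C'" using phi_bound by blast
  have C0: "C \<ge> 0" using C[of 0] by linarith
  define K where "K x x' y = g x * g x' * radial_kernel q (sgn y \<bullet> (x - x'))" for x x' y :: "real^'n"
  have K: "\<bar>K x x' y\<bar> \<le> G * G * C" for x x' y
    unfolding K_def abs_mult using G C G0 C0 by (intro mult_mono) auto
  have [measurable]: "(sgn :: real^'n \<Rightarrow> real^'n) \<in> borel_measurable borel"
    unfolding sgn_div_norm[abs_def] by measurable
  have "vol * (LINT x|M. LINT x'|M. g x * g x' * exp (- dist x x')) = (LINT x|M. LINT x'|M. LINT y|B1. K x x' y)"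
  proof -
    have "vol * (g x * g x' * exp (- dist x x')) = (LINT y|B1. K x x' y)" for x x'
      using exp_minus_norm_eq_average[OF n, of "x - x'"]
      by (simp add: K_def vol_def B1_def dist_norm)
    then show ?thesis by (simp add: integral_mult_right_zero[symmetric] del: integral_mult_right_zero)
  qed
  also have "\<dots> = (LINT x|M. LINT y|B1. LINT x'|M. K x x' y)"
  proof (rule Bochner_Integration.integral_cong[OF refl])
    fix x
    show "(LINT x'|M. LINT y|B1. K x x' y) = (LINT y|B1. LINT x'|M. K x x' y)"
      by (rule Fubini_bounded[OF fin, where B = "G * G * C"]) (use K in \<open>auto simp: K_def\<close>)
  qed
  also have "\<dots> = (LINT y|B1. LINT x|M. LINT x'|M. K x x' y)"
  proof (rule Fubini_bounded[OF fin, where B = "G * G * C * measure M UNIV"])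
    have [measurable]: "(\<lambda>(p, x'). K (fst p) x' (snd p)) \<in> borel_measurable ((M \<Otimes>\<^sub>M B1) \<Otimes>\<^sub>M M)"
      unfolding K_def by measurable
    show "(\<lambda>(x, y). LINT x'|M. K x x' y) \<in> borel_measurable (M \<Otimes>\<^sub>M B1)"
      unfolding case_prod_beta by measurable
    show "AE x in M. AE y in B1. \<bar>LINT x'|M. K x x' y\<bar> \<le> G * G * C * measure M UNIV"
    proof (intro AE_I2)
      fix x y
      have i: "integrable M (\<lambda>x'. K x x' y)"
        by (rule M.integrable_const_bound[of _ "G * G * C"]) (use K in \<open>auto simp: K_def\<close>)
      have "\<bar>LINT x'|M. K x x' y\<bar> \<le> (LINT x'|M. \<bar>K x x' y\<bar>)" by (rule integral_abs_bound)
      also have "\<dots> \<le> (LINT x'|M. G * G * C)" by (rule integral_mono) (use i K in auto)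
      finally show "\<bar>LINT x'|M. K x x' y\<bar> \<le> G * G * C * measure M UNIV" by (simp add: mult_ac)
    qed
  qed
  also have "\<dots> = (LINT y|B1. \<kappa> * (LINT u|lborel. (interval_pot R w u)\<^sup>2))"
  proof (rule integral_cong_AE)
    \<comment> \<open>At \<open>y = 0\<close> the vector \<open>sgn y\<close> is not a unit vector
      and the marginal formula does not apply.\<close>
    have "AE y in B1. y \<noteq> 0"
    proof -
      have [measurable]: "cball (0::real^'n) 1 \<in> sets borel" by simp
      show ?thesis unfolding B1_def ball_measure_def
        by (subst AE_density) (measurable, rule eventually_mono[OF AE_lborel_singleton[of "0::real^'n"]], simp)
    qed
    then show "AE y in B1. (LINT x|M. LINT x'|M. K x x' y) = \<kappa> * (LINT u|lborel. (interval_pot R w u)\<^sup>2)"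
    proof eventually_elim
      case (elim y)
      define \<theta> where "\<theta> = sgn y"
      have th: "norm \<theta> = 1" using elim by (simp add: \<theta>_def norm_sgn)
      \<comment> \<open>\<open>signed_density\<close> asks for bounds on the entire space, whereas
        \<open>\<theta> \<bullet> x\<close> is bounded only on the ball; clamping alters it on a
        null set of \<open>M\<close> at most.\<close>
      define X where "X x = clamp_real R (\<theta> \<bullet> x)" for x
      have Xeq: "AE x in M. X x = \<theta> \<bullet> x"
      proof -
        have "X x = \<theta> \<bullet> x" if "norm x \<le> R" for x
          using abs_sgn_inner_le[of y x] that by (auto simp: X_def clamp_real_def \<theta>_def)
        moreover have "AE x in M. norm x \<le> R" unfolding M_def by (rule AE_ball_measure)
        ultimately show ?thesis by (auto elim: eventually_mono)
      qed
      have [measurable]: "X \<in> borel_measurable borel" unfolding X_def by measurable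
      have sd: "signed_density M X g"
        unfolding signed_density_def
      proof (intro conjI)
        have "\<bar>X s\<bar> \<le> R" for s using R by (auto simp: X_def clamp_real_def)
        then show "\<exists>B\<ge>0. \<forall>s\<in>space M. \<bar>X s\<bar> \<le> B \<and> \<bar>g s\<bar> \<le> B"
          using G G0 R by (intro exI[of _ "R + G"]) (auto intro: add_increasing add_increasing2)
      qed (use fin in measurable)
      have pot: "potential M X g u = interval_pot R w u" for u
      proof -
        have "potential M X g u = (LINT x|M. g x * \<phi> (u - clamp_real R (\<theta> \<bullet> x)))"
          by (simp add: potential_def X_def)
        also have "\<dots> = (LINT t|ball_measure R. w t * \<phi> (u - clamp_real R t))"
          unfolding M_def by (rule marg[OF th]) (use C' in auto)
        also have "\<dots> = interval_pot R w u"
          unfolding interval_pot_def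
        proof (rule integral_cong_AE)
          have "AE t in ball_measure R. norm (t::real) \<le> R" by (rule AE_ball_measure)
          then show "AE t in ball_measure R. w t * \<phi> (u - clamp_real R t) = w t * \<phi> (u - t)"
            by (rule eventually_mono) (auto simp: clamp_real_def)
        qed measurable
        finally show ?thesis .
      qed
      have "(LINT x|M. LINT x'|M. K x x' y) = (LINT s|M. g s * (LINT t|M. g t * radial_kernel q (X s - X t)))"
      proof (rule integral_cong_AE)
        show "AE x in M. (LINT x'|M. K x x' y) = g x * (LINT t|M. g t * radial_kernel q (X x - X t))"
          using Xeq
        proof eventually_elim
          case (elim x)
          have "(LINT t|M. g t * radial_kernel q (X x - X t)) = (LINT t|M. g t * radial_kernel q (\<theta> \<bullet> x - \<theta> \<bullet> t))"
            by (rule integral_cong_AE) (use Xeq elim in \<open>auto elim!: eventually_mono\<close>)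
          then show ?case by (simp add: K_def \<theta>_def inner_diff_right mult.assoc)
        qed
        have [measurable]: "(\<lambda>(x, x'). K x x' y) \<in> borel_measurable (M \<Otimes>\<^sub>M M)" unfolding K_def by measurable
        show "(\<lambda>x. LINT x'|M. K x x' y) \<in> borel_measurable M" by measurable
      qed measurable
      also have "\<dots> = \<kappa> * (LINT u|lborel. (interval_pot R w u)\<^sup>2)"
        unfolding potential_inner[OF sd sd, symmetric] pot by (simp add: power2_eq_square)
      finally show ?case .
    qed
    have [measurable]: "(\<lambda>(y, x, x'). K x x' y) \<in> borel_measurable (B1 \<Otimes>\<^sub>M M \<Otimes>\<^sub>M M)" unfolding K_def by measurable
    have [measurable]: "(\<lambda>(p, x'). K (snd p) x' (fst p)) \<in> borel_measurable ((B1 \<Otimes>\<^sub>M M) \<Otimes>\<^sub>M M)" unfolding K_def by measurable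
    have [measurable]: "(\<lambda>p. LINT x'|M. K (snd p) x' (fst p)) \<in> borel_measurable (B1 \<Otimes>\<^sub>M M)" by measurable
    have "(\<lambda>y. LINT x|M. (\<lambda>p. LINT x'|M. K (snd p) x' (fst p)) (y, x)) \<in> borel_measurable B1" by measurable
    then show "(\<lambda>y. LINT x|M. LINT x'|M. K x x' y) \<in> borel_measurable B1" by simp
  qed simp
  also have "\<dots> = vol * (\<kappa> * (LINT u|lborel. (interval_pot R w u)\<^sup>2))"
    by (simp add: vol_def B1_def measure_ball_measure)
  finally show ?thesis using vol by (simp add: M_def)
qed

lemma marginal_finite_approximation:
  fixes p :: "real poly"
  assumes n: "CARD('n::finite) = 2 * q + 1" and R: "R > 0" and \<epsilon>: "\<epsilon> > 0"
  shows "\<exists>(A :: (real^'n) set) c. finite A \<and> A \<subseteq> cball 0 R \<and> sum c A = (LINT t|ball_measure R. radial_marginal q R p t) \<and>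
    exp_energy A c \<le> \<kappa> * (LINT u|lborel. (interval_pot R (radial_marginal q R p) u)\<^sup>2) + \<epsilon>"
proof -
  obtain g G where g: "g \<in> borel_measurable borel" "\<And>x::real^'n. \<bar>g x\<bar> \<le> G"
    and m: "\<And>\<theta> h. norm \<theta> = 1 \<Longrightarrow> h \<in> borel_measurable borel \<Longrightarrow> (\<exists>B. \<forall>t::real. \<bar>h t\<bar> \<le> B) \<Longrightarrow>
      (LINT x|ball_measure R. g x * h (\<theta> \<bullet> x)) = (LINT t|ball_measure R. radial_marginal q R p t * h t)"
    using radial_profile_exists[OF n R, of p] by metis
  obtain e :: "real^'n" where e: "norm e = 1" using vector_choose_size[of 1] by auto
  have "(LINT x|ball_measure R. g x) = (LINT t|ball_measure R. radial_marginal q R p t)"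
    using m[OF e, of "\<lambda>_. 1"] by (simp add: exI[of _ 1])
  moreover obtain A :: "(real^'n) set" and c where "finite A" "A \<subseteq> cball 0 R" "sum c A = (LINT x|ball_measure R. g x)"
    "exp_energy A c \<le> (LINT x|ball_measure R. LINT y|ball_measure R. g x * g y * exp (- dist x y)) + \<epsilon>"
    using energy_discretization[OF less_imp_le[OF R] g(1) g(2) \<epsilon>] by blast
  moreover have "(LINT x|ball_measure R. LINT y|ball_measure R. g x * g y * exp (- dist x y)) = \<kappa> * (LINT u|lborel. (interval_pot R (radial_marginal q R p) u)\<^sup>2)"
    by (rule radial_energy[OF n R g m]) (simp_all add: radial_marginal_measurable)
  ultimately show ?thesis by auto
qed

end

section \<open>Convergence of the approximating marginals in mass and energy\<close>

lemma tendsto_LINT_ball_measure: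
  fixes f :: "nat \<Rightarrow> 'a::euclidean_space \<Rightarrow> real"
  assumes "\<And>N. f N \<in> borel_measurable borel" "g \<in> borel_measurable borel"
    and "AE x in ball_measure R. (\<lambda>N. f N x) \<longlonglongrightarrow> g x"
    and B: "\<And>N x. norm x \<le> R \<Longrightarrow> \<bar>f N x\<bar> \<le> B"
  shows "(\<lambda>N. LINT x|ball_measure R. f N x) \<longlonglongrightarrow> (LINT x|ball_measure R. g x)"
proof (rule integral_dominated_convergence[where w = "\<lambda>_. B"])
  interpret finite_measure "ball_measure R :: 'a measure" by (rule finite_measure_ball_measure)
  show "integrable (ball_measure R :: 'a measure) (\<lambda>_. B)" by simp
  have "AE x in ball_measure R. norm (x::'a) \<le> R" by (rule AE_ball_measure)
  then show "AE x in ball_measure R. norm (f N x) \<le> B" for N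
    by (rule eventually_mono) (use B in auto)
qed (use assms in auto)

lemma AE_ball_measure_neq: "AE x in ball_measure R. x \<noteq> (c :: 'a::euclidean_space)"
proof -
  have [measurable]: "cball (0::'a) R \<in> sets borel" by simp
  show ?thesis unfolding ball_measure_def
    by (subst AE_density) (measurable, rule eventually_mono[OF AE_lborel_singleton[of c]], simp)
qed

text \<open>Damping the density by \<open>(1 - (t / R) ^ (2 * N)) ^ q\<close> and replacing the point masses by normalized bumps makes the
  weight divisible by \<open>(R\<^sup>2 - t\<^sup>2) ^ q\<close>, so that it becomes the marginal of a radial density.\<close>

definition weight_approx :: "nat \<Rightarrow> real \<Rightarrow> (nat \<Rightarrow> real) \<Rightarrow> real \<Rightarrow> nat \<Rightarrow> real poly" where
  "weight_approx q R x b N = Polynomial.smult (1 / (R\<^sup>2) ^ q)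
     ((\<Sum>j\<le>q. Polynomial.smult (x j) ([:R\<^sup>2, -1:] ^ j)) * (\<Sum>i<N. [:1, - 1 / R\<^sup>2:] ^ i) ^ q
      + Polynomial.smult (b * 2 / endpoint_mass q R N) ([:1, - 1 / R\<^sup>2:] ^ N))"

text \<open>At \<open>R\<^sup>2 - t\<^sup>2\<close> the polynomial \<open>[:R\<^sup>2, -1:]\<close>
  takes the value \<open>t\<^sup>2\<close> and \<open>[:1, - 1 / R\<^sup>2:]\<close> the value
  \<open>z = t\<^sup>2 / R\<^sup>2\<close>. The factor \<open>(1 - z) ^ q\<close> from the marginal,
  times the \<open>q\<close>-th power of the geometric sum, is
  \<open>(1 - z ^ N) ^ q\<close>.\<close>

lemma radial_marginal_weight_approx:
  assumes R: "R > 0"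
  shows "radial_marginal q R (weight_approx q R x b N) t =
    poly (even_poly q x) t * (1 - (t\<^sup>2 / R\<^sup>2) ^ N) ^ q + b * (endpoint_bump q R N t * 2 / endpoint_mass q R N)"
proof -
  define z where "z = t\<^sup>2 / R\<^sup>2"
  have z: "1 - (R\<^sup>2 - t\<^sup>2) / R\<^sup>2 = z" "(R\<^sup>2 - t\<^sup>2) / R\<^sup>2 = 1 - z" using R by (simp_all add: z_def field_simps)
  have pz: "1 + (R\<^sup>2 - t\<^sup>2) * (- 1 / R\<^sup>2) = z" using z(1) by simp
  have e: "(\<Sum>j\<le>q. x j * (t\<^sup>2) ^ j) = poly (even_poly q x) t" by (simp add: poly_even_poly power_mult)
  have "poly (weight_approx q R x b N) (R\<^sup>2 - t\<^sup>2) = 1 / (R\<^sup>2) ^ q *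
     (poly (even_poly q x) t * (\<Sum>i<N. z ^ i) ^ q + b * 2 / endpoint_mass q R N * z ^ N)"
    unfolding weight_approx_def by (simp add: poly_sum poly_power e[symmetric] pz[symmetric])
  then have "radial_marginal q R (weight_approx q R x b N) t = ((R\<^sup>2 - t\<^sup>2) / R\<^sup>2) ^ q *
     (poly (even_poly q x) t * (\<Sum>i<N. z ^ i) ^ q + b * 2 / endpoint_mass q R N * z ^ N)"
    by (simp add: radial_marginal_def power_divide)
  also have "\<dots> = poly (even_poly q x) t * ((1 - z) * (\<Sum>i<N. z ^ i)) ^ q + b * ((z ^ N * (1 - z) ^ q) * 2 / endpoint_mass q R N)"
    unfolding z power_mult_distrib by (simp add: distrib_left mult_ac)
  also have "(1 - z) * (\<Sum>i<N. z ^ i) = 1 - z ^ N" by (rule one_diff_power_eq[symmetric])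
  finally show ?thesis by (simp add: z_def endpoint_bump_def)
qed

lemma bulk_factor_bounds:
  assumes "R > 0" "\<bar>t\<bar> \<le> R"
  shows "0 \<le> (1 - (t\<^sup>2 / R\<^sup>2) ^ N) ^ q" "(1 - (t\<^sup>2 / R\<^sup>2) ^ N) ^ q \<le> (1::real)"
proof -
  note b = square_ratio_bounds[OF assms order_refl]
  have "(t\<^sup>2 / R\<^sup>2) ^ N \<le> 1" "0 \<le> (t\<^sup>2 / R\<^sup>2) ^ N" using b by (auto intro!: power_le_one simp del: power_divide)
  then show "0 \<le> (1 - (t\<^sup>2 / R\<^sup>2) ^ N) ^ q" "(1 - (t\<^sup>2 / R\<^sup>2) ^ N) ^ q \<le> (1::real)"
    by (auto intro!: power_le_one)
qed

text \<open>Continuity of \<open>h\<close> is asked only at the endpoints, where the bumps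
  concentrate, because the functions \<open>\<phi> (u - t)\<close> to be tested jump at
  \<open>t = u\<close>. The damping factor tends to 1 in the open interval, and dominated
  convergence handles the density.\<close>

lemma weight_approx_weak_limit:
  assumes R: "R > 0" and h [measurable]: "h \<in> borel_measurable borel" and B: "\<And>t. \<bar>h t\<bar> \<le> B"
    and cont: "isCont h R" "isCont h (- R)"
  shows "(\<lambda>N. LINT t|ball_measure R. radial_marginal q R (weight_approx q R x b N) t * h t)
    \<longlonglongrightarrow> (LINT t:{-R..R}|lborel. poly (even_poly q x) t * h t) + b * (h R + h (- R))"
proof -
  let ?v = "even_poly q x"
  let ?bulk = "\<lambda>N t. poly ?v t * (1 - (t\<^sup>2 / R\<^sup>2) ^ N) ^ q"
  have [measurable]: "poly ?v \<in> borel_measurable borel" by (intro borel_measurable_continuous_onI continuous_intros)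
  obtain Bv where Bv: "Bv \<ge> 0" "\<And>s. s \<in> {-R..R} \<Longrightarrow> \<bar>poly ?v s\<bar> \<le> Bv" using poly_bounded_interval by blast
  have bd: "\<bar>?bulk N t * h t\<bar> \<le> Bv * 1 * B" if "norm t \<le> R" for N t
  proof -
    have "t \<in> {-R..R}" using that by auto
    then show ?thesis
      unfolding abs_mult using Bv(2)[of t] B[of t] Bv(1) bulk_factor_bounds[OF R, of t N q] that
      by (intro mult_mono) auto
  qed
  have "(\<lambda>N. LINT t|ball_measure R. ?bulk N t * h t) \<longlonglongrightarrow> (LINT t|ball_measure R. poly ?v t * h t)"
  proof (rule tendsto_LINT_ball_measure[OF _ _ _ bd])
    have "AE t in ball_measure R. norm (t::real) \<le> R \<and> t \<noteq> R \<and> t \<noteq> - R"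
      using AE_ball_measure[of R, where 'a = real] AE_ball_measure_neq[of R R] AE_ball_measure_neq[of "-R" R] by eventually_elim auto
    then show "AE t in ball_measure R. (\<lambda>N. ?bulk N t * h t) \<longlonglongrightarrow> poly ?v t * h t"
    proof (rule eventually_mono)
      fix t assume t: "norm t \<le> R \<and> t \<noteq> R \<and> t \<noteq> - R"
      then have "\<bar>t\<bar> < R" by auto
      then have "\<bar>t\<bar>\<^sup>2 < R\<^sup>2" by (intro power_strict_mono) auto
      then have "t\<^sup>2 < R\<^sup>2" unfolding power2_abs .
      then have "t\<^sup>2 / R\<^sup>2 < 1" by (subst divide_less_eq_1_pos) (use R in auto)
      then have "norm (t\<^sup>2 / R\<^sup>2) < 1" unfolding real_norm_def by (subst abs_of_nonneg) auto
      then have "(\<lambda>N. (t\<^sup>2 / R\<^sup>2) ^ N) \<longlonglongrightarrow> 0" by (rule LIMSEQ_power_zero)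
      then have "(\<lambda>N. poly ?v t * (1 - (t\<^sup>2 / R\<^sup>2) ^ N) ^ q * h t) \<longlonglongrightarrow> poly ?v t * (1 - 0) ^ q * h t"
        by (intro tendsto_mult tendsto_power tendsto_diff tendsto_const)
      then show "(\<lambda>N. ?bulk N t * h t) \<longlonglongrightarrow> poly ?v t * h t" by simp
    qed
  qed measurable
  moreover have "(LINT t|ball_measure R. poly ?v t * h t) = (LINT t:{-R..R}|lborel. poly ?v t * h t)"
    by (subst integral_ball_measure) (auto simp: cball_real_eq)
  ultimately have lim1: "(\<lambda>N. LINT t|ball_measure R. ?bulk N t * h t) \<longlonglongrightarrow> (LINT t:{-R..R}|lborel. poly ?v t * h t)"
    by simp
  have lim2: "(\<lambda>N. b * ((LINT t|ball_measure R. endpoint_bump q R N t * h t) * 2 / endpoint_mass q R N)) \<longlonglongrightarrow> b * (h R + h (- R))"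
    by (intro tendsto_mult tendsto_const endpoint_concentration[OF R h B cont])
  note tendsto_add[OF lim1 lim2]
  moreover have "(LINT t|ball_measure R. radial_marginal q R (weight_approx q R x b N) t * h t)
    = (LINT t|ball_measure R. ?bulk N t * h t) + b * ((LINT t|ball_measure R. endpoint_bump q R N t * h t) * 2 / endpoint_mass q R N)" for N
  proof -
    have i1: "integrable (ball_measure R) (\<lambda>t. ?bulk N t * h t)"
      by (rule integrable_ball_measure_bounded[OF _ bd]) measurable
    have i2: "integrable (ball_measure R) (\<lambda>t. b * 2 / endpoint_mass q R N * (endpoint_bump q R N t * h t))"
      by (intro integrable_mult_right integrable_endpoint_bump_mult[OF R h B])
    have "(LINT t|ball_measure R. radial_marginal q R (weight_approx q R x b N) t * h t)
      = (LINT t|ball_measure R. ?bulk N t * h t + b * 2 / endpoint_mass q R N * (endpoint_bump q R N t * h t))"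
      unfolding radial_marginal_weight_approx[OF R]
      by (rule Bochner_Integration.integral_cong) (simp_all add: distrib_right)
    also have "\<dots> = (LINT t|ball_measure R. ?bulk N t * h t) + b * 2 / endpoint_mass q R N * (LINT t|ball_measure R. endpoint_bump q R N t * h t)"
      by (subst Bochner_Integration.integral_add[OF i1 i2], subst integral_mult_right_zero) (rule refl)
    finally show ?thesis by simp
  qed
  ultimately show ?thesis by simp
qed

text \<open>The bumps become high but their normalized mass stays fixed. The bound uniform in
  \<open>N\<close> provides the majorant for the energy limit.\<close>

lemma weight_approx_total_variation:
  assumes R: "R > 0"
  shows "\<exists>K\<ge>0. \<forall>N. (LINT t|ball_measure R. \<bar>radial_marginal q R (weight_approx q R x b N) t\<bar>) \<le> K"
proof -
  let ?v = "even_poly q x"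
  interpret finite_measure "ball_measure R :: real measure" by (rule finite_measure_ball_measure)
  obtain Bv where Bv: "Bv \<ge> 0" "\<And>s. s \<in> {-R..R} \<Longrightarrow> \<bar>poly ?v s\<bar> \<le> Bv" using poly_bounded_interval by blast
  define m where "m = measure (ball_measure R) (UNIV :: real set)"
  have "(LINT t|ball_measure R. \<bar>radial_marginal q R (weight_approx q R x b N) t\<bar>) \<le> Bv * m + 2 * \<bar>b\<bar>" for N
  proof -
    have J: "endpoint_mass q R N > 0" by (rule endpoint_mass_pos[OF R])
    have bi: "integrable (ball_measure R) (endpoint_bump q R N)"
      using integrable_endpoint_bump_mult[OF R, of "\<lambda>_. 1" 1] by simp
    have pt: "\<bar>radial_marginal q R (weight_approx q R x b N) t\<bar> \<le> Bv + \<bar>b\<bar> * 2 / endpoint_mass q R N * endpoint_bump q R N t" if t: "norm t \<le> R" for t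
    proof -
      have "t \<in> {-R..R}" using t by auto
      then have "\<bar>poly ?v t * (1 - (t\<^sup>2 / R\<^sup>2) ^ N) ^ q\<bar> \<le> Bv * 1"
        unfolding abs_mult using Bv(2)[of t] Bv(1) bulk_factor_bounds[OF R, of t N q] t by (intro mult_mono) auto
      moreover have "\<bar>b * (endpoint_bump q R N t * 2 / endpoint_mass q R N)\<bar> = \<bar>b\<bar> * 2 / endpoint_mass q R N * endpoint_bump q R N t"
        using endpoint_bump_bounds(1)[OF R, of t R] t J by (simp add: abs_mult)
      ultimately show ?thesis unfolding radial_marginal_weight_approx[OF R] by linarith
    qed
    have "(LINT t|ball_measure R. \<bar>radial_marginal q R (weight_approx q R x b N) t\<bar>)
      \<le> (LINT t|ball_measure R. Bv + \<bar>b\<bar> * 2 / endpoint_mass q R N * endpoint_bump q R N t)"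
    proof (rule integral_mono_AE)
      have "AE t in ball_measure R. norm (t::real) \<le> R" by (rule AE_ball_measure)
      then show ae: "AE t in ball_measure R. \<bar>radial_marginal q R (weight_approx q R x b N) t\<bar> \<le> Bv + \<bar>b\<bar> * 2 / endpoint_mass q R N * endpoint_bump q R N t"
        by (rule eventually_mono) (rule pt)
      show i: "integrable (ball_measure R) (\<lambda>t. Bv + \<bar>b\<bar> * 2 / endpoint_mass q R N * endpoint_bump q R N t)"
        using bi by simp
      show "integrable (ball_measure R) (\<lambda>t. \<bar>radial_marginal q R (weight_approx q R x b N) t\<bar>)"
        by (rule Bochner_Integration.integrable_bound[OF i]) (use ae radial_marginal_measurable in \<open>auto elim!: eventually_mono\<close>)
    qed
    also have "\<dots> = Bv * m + \<bar>b\<bar> * 2 / endpoint_mass q R N * endpoint_mass q R N"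
      using bi by (simp add: m_def endpoint_mass_def mult.commute)
    finally show ?thesis using J by simp
  qed
  moreover have "0 \<le> Bv * m + 2 * \<bar>b\<bar>" using Bv(1) by (simp add: m_def)
  ultimately show ?thesis by blast
qed

context radial_feature begin

lemma isCont_phi: "s \<noteq> 0 \<Longrightarrow> isCont \<phi> s"
proof -
  assume s: "s \<noteq> 0"
  have "continuous_on {0<..} \<phi> \<longleftrightarrow> continuous_on {0<..} (pexp l)"
    by (rule continuous_on_cong) (auto simp: \<phi>_def pexp_def)
  then have 1: "continuous_on {0<..} \<phi>" by (simp add: continuous_on_pexp)
  have "continuous_on {..<0} \<phi> \<longleftrightarrow> continuous_on {..<0::real} (\<lambda>_. 0 :: real)"
    by (rule continuous_on_cong[OF refl]) (auto simp: \<phi>_def)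
  then have 2: "continuous_on {..<0} \<phi>" by simp
  show "isCont \<phi> s"
    using s 1 2 by (cases "s > 0") (auto simp: continuous_on_eq_continuous_at)
qed

lemma interval_pot_bound:
  assumes w [measurable]: "w \<in> borel_measurable borel" and K: "(LINT t|ball_measure R. \<bar>w t\<bar>) \<le> K"
    and int: "integrable (ball_measure R) w" and C: "\<And>t. norm t \<le> R \<Longrightarrow> \<bar>\<phi> (u - t)\<bar> \<le> C"
  shows "\<bar>interval_pot R w u\<bar> \<le> K * \<bar>C\<bar>"
proof -
  have AE: "AE t in ball_measure R. norm (t::real) \<le> R" by (rule AE_ball_measure)
  have ae: "AE t in ball_measure R. \<bar>w t * \<phi> (u - t)\<bar> \<le> \<bar>w t\<bar> * \<bar>C\<bar>"
    by (rule eventually_mono[OF AE]) (use C in \<open>force simp: abs_mult intro!: mult_left_mono\<close>)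
  have iw: "integrable (ball_measure R) (\<lambda>t. \<bar>w t\<bar> * \<bar>C\<bar>)" using int by simp
  have "\<bar>interval_pot R w u\<bar> \<le> (LINT t|ball_measure R. \<bar>w t * \<phi> (u - t)\<bar>)"
    unfolding interval_pot_def by (rule integral_abs_bound)
  also have "\<dots> \<le> (LINT t|ball_measure R. \<bar>w t\<bar> * \<bar>C\<bar>)"
  proof (rule integral_mono_AE[OF _ iw ae])
    show "integrable (ball_measure R) (\<lambda>t. \<bar>w t * \<phi> (u - t)\<bar>)"
      by (rule Bochner_Integration.integrable_bound[OF iw]) (use ae in \<open>auto elim!: eventually_mono\<close>)
  qed
  also have "\<dots> \<le> K * \<bar>C\<bar>" using K by (simp add: mult_right_mono)
  finally show ?thesis .
qed

lemma interval_pot_measurable: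
  assumes [measurable]: "w \<in> borel_measurable borel"
  shows "interval_pot R w \<in> borel_measurable borel"
proof -
  interpret finite_measure "ball_measure R :: real measure" by (rule finite_measure_ball_measure)
  show ?thesis unfolding interval_pot_def[abs_def] by measurable
qed

text \<open>For \<open>u\<close> different from \<open>R\<close> and \<open>- R\<close> the jump of
  \<open>\<phi> (u - t)\<close> misses the endpoints, so the weak limit gives convergence of the
  potentials at \<open>u\<close>; dominated convergence then applies to their squares.\<close>

lemma weight_approx_energy_limit:
  assumes R: "R > 0"
  shows "(\<lambda>N. LINT u|lborel. (interval_pot R (radial_marginal q R (weight_approx q R x b N)) u)\<^sup>2)
    \<longlonglongrightarrow> (LINT u|lborel. (weight_potential R (even_poly q x) b u)\<^sup>2)"
proof -
  let ?w = "\<lambda>N. radial_marginal q R (weight_approx q R x b N)"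
  obtain K where K: "K \<ge> 0" "\<And>N. (LINT t|ball_measure R. \<bar>?w N t\<bar>) \<le> K"
    using weight_approx_total_variation[OF R] by blast
  obtain C where C: "C \<ge> 0" "\<And>t. \<bar>\<phi> t\<bar> \<le> C * exp (- (t / 2))" "\<And>t. \<bar>\<phi> t\<bar> \<le> C" using phi_bound by blast
  have int: "integrable (ball_measure R) (?w N)" for N
  proof -
    have "bounded (?w N ` {-R..R})"
      unfolding radial_marginal_def by (intro compact_imp_bounded compact_continuous_image continuous_intros) auto
    then obtain E where "\<forall>t\<in>{-R..R}. \<bar>?w N t\<bar> \<le> E" by (auto simp: bounded_iff)
    then show ?thesis by (intro integrable_ball_measure_bounded[where B = E]) (auto simp: radial_marginal_measurable abs_le_iff)
  qed
  define T where "T u = exp (- (u / 2)) * indicator {- R..} u" for u :: real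
  have T0: "T u \<ge> 0" for u by (simp add: T_def)
  have b1: "\<bar>interval_pot R (?w N) u\<bar> \<le> K * C" for N u
    using interval_pot_bound[OF radial_marginal_measurable K(2) int, of u C N] C by simp
  have b2: "\<bar>interval_pot R (?w N) u\<bar> \<le> K * (C * exp (R / 2) * T u)" for N u
    using interval_pot_bound[OF radial_marginal_measurable K(2) int, of u "C * exp (R / 2) * T u" N]
      phi_translate_bound[OF C(2) _ C(1), of _ R u] C(1) T0[of u] by (simp add: T_def[symmetric])
  show ?thesis
  \<comment> \<open>The majorant of the square is the product of the uniform bound \<open>b1\<close>
    and the decaying bound \<open>b2\<close>.\<close>
  proof (rule integral_dominated_convergence[where w = "\<lambda>u. K * C * (K * (C * exp (R / 2))) * T u"])
    show "integrable lborel (\<lambda>u. K * C * (K * (C * exp (R / 2))) * T u)"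
      unfolding T_def by (rule integrable_mult_right[OF integrable_exp_tail])
    show "AE u in lborel. norm ((interval_pot R (?w N) u)\<^sup>2) \<le> K * C * (K * (C * exp (R / 2))) * T u" for N
    proof (rule AE_I2)
      fix u
      have "\<bar>interval_pot R (?w N) u\<bar> * \<bar>interval_pot R (?w N) u\<bar> \<le> (K * C) * (K * (C * exp (R / 2) * T u))"
        using b1 b2 K(1) C(1) by (intro mult_mono) auto
      then show "norm ((interval_pot R (?w N) u)\<^sup>2) \<le> K * C * (K * (C * exp (R / 2))) * T u"
        by (simp add: power2_eq_square abs_mult mult_ac)
    qed
    have "AE u in lborel. u \<noteq> R \<and> u \<noteq> - R"
      using AE_lborel_singleton[of R] AE_lborel_singleton[of "-R"] by eventually_elim auto
    then show "AE u in lborel. (\<lambda>N. (interval_pot R (?w N) u)\<^sup>2) \<longlonglongrightarrow> (weight_potential R (even_poly q x) b u)\<^sup>2"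
    proof (rule eventually_mono)
      fix u assume u: "u \<noteq> R \<and> u \<noteq> - R"
      have c: "isCont (\<lambda>t. \<phi> (u - t)) s" if "u - s \<noteq> 0" for s
        by (rule isCont_o2[where g = \<phi>]) (use isCont_phi[OF that] in \<open>auto intro!: continuous_intros\<close>)
      have "(\<lambda>N. LINT t|ball_measure R. ?w N t * \<phi> (u - t)) \<longlonglongrightarrow>
        (LINT t:{-R..R}|lborel. poly (even_poly q x) t * \<phi> (u - t)) + b * (\<phi> (u - R) + \<phi> (u - - R))"
        by (rule weight_approx_weak_limit[OF R _ C(3)]) (use c u in auto)
      then have "(\<lambda>N. interval_pot R (?w N) u) \<longlonglongrightarrow> weight_potential R (even_poly q x) b u"
        by (simp add: interval_pot_def weight_potential_eq[OF R])
      then show "(\<lambda>N. (interval_pot R (?w N) u)\<^sup>2) \<longlonglongrightarrow> (weight_potential R (even_poly q x) b u)\<^sup>2"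
        by (rule tendsto_power)
    qed
  qed (use interval_pot_measurable[OF radial_marginal_measurable] potential_measurable[OF signed_density_weight[OF R]] in \<open>auto intro!: borel_measurable_power\<close>)
qed

lemma magnitude_ball_eq:
  assumes n: "CARD('n::finite) = 2 * q + 1" and R: "R > 0"
    and bal: "boundary_balance q R (even_poly q x) b"
    and norm: "2 * exp_moment (radial_poly q * monom 1 (2 * q)) * x q = 1"
  shows "magnitude (cball (0::real^'n) R) = ereal (LINT s|weight_space R. weight_density R (even_poly q x) b s)"
proof -
  define V where "V = (LINT s|weight_space R. weight_density R (even_poly q x) b s)"
  let ?w = "\<lambda>N. radial_marginal q R (weight_approx q R x b N)"
  have V_energy: "V = \<kappa> * (LINT u|lborel. (weight_potential R (even_poly q x) b u)\<^sup>2)"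
    using weight_energy[OF R bal] norm by (simp add: V_def)
  have V0: "V \<ge> 0" unfolding V_energy using kpos by simp
  have upper: "finite_magnitude A \<le> V" if A: "finite A" "A \<subseteq> cball 0 R" for A :: "(real^'n) set"
  proof -
    obtain w where w: "weighting A w" using weighting_exists[OF n A(1)] by blast
    show ?thesis
      by (rule finite_magnitude_le[OF w V0]) (use sum_square_le_weight_mass[OF n A R bal norm] in \<open>simp add: V_def\<close>)
  qed
  \<comment> \<open>A single point has magnitude 1; strict positivity permits cancelling
    \<open>V\<close> in \<open>V\<^sup>2 \<le> V * T\<close> below.\<close>
  have V_pos: "V > 0"
  proof -
    have "weighting {0::real^'n} (\<lambda>_. 1)" by (simp add: weighting_def)
    then have "finite_magnitude {0::real^'n} = 1" by (simp add: finite_magnitude_eq)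
    then show ?thesis using upper[of "{0}"] R by simp
  qed
  \<comment> \<open>The trial coefficients have total mass and energy both tending to
    \<open>V\<close>, so in the limit the inequality for finite sets reads
    \<open>V\<^sup>2 \<le> V * T\<close>.\<close>
  have lower: "V \<le> T" if T: "\<And>A :: (real^'n) set. finite A \<Longrightarrow> A \<subseteq> cball 0 R \<Longrightarrow> finite_magnitude A \<le> T" for T
  proof -
    have "finite_magnitude ({} :: (real^'n) set) = 0"
      using finite_magnitude_eq[of "{}" "\<lambda>_. 0"] by (simp add: weighting_def)
    then have T0: "T \<ge> 0" using T[of "{}"] by simp
    define E where "E N = \<kappa> * (LINT u|lborel. (interval_pot R (?w N) u)\<^sup>2)" for N
    have step: "(LINT t|ball_measure R. ?w N t)\<^sup>2 \<le> (E N + \<epsilon>) * T" if eps: "\<epsilon> > 0" for N \<epsilon>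
    proof -
      obtain A :: "(real^'n) set" and c where A: "finite A" "A \<subseteq> cball 0 R" "sum c A = (LINT t|ball_measure R. ?w N t)" "exp_energy A c \<le> E N + \<epsilon>"
        using marginal_finite_approximation[OF n R eps, of "weight_approx q R x b N"] unfolding E_def by blast
      obtain w where w: "weighting A w" using weighting_exists[OF n A(1)] by blast
      have "(sum c A)\<^sup>2 \<le> exp_energy A c * finite_magnitude A"
        by (rule sum_square_le_energy_magnitude[OF w exp_energy_nonneg[OF n A(1)]])
      also have "\<dots> \<le> exp_energy A c * T"
        by (intro mult_left_mono T A exp_energy_nonneg[OF n])
      also have "\<dots> \<le> (E N + \<epsilon>) * T" by (intro mult_right_mono A T0)
      finally show ?thesis unfolding A(3) .
    qed
    have "(\<lambda>N. LINT t|ball_measure R. ?w N t * 1) \<longlonglongrightarrow> (LINT t:{-R..R}|lborel. poly (even_poly q x) t * 1) + b * (1 + 1)"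
      by (rule weight_approx_weak_limit[OF R, where B = 1]) auto
    moreover have "V = (LINT t:{-R..R}|lborel. poly (even_poly q x) t * 1) + b * (1 + 1)"
      using weight_integral[OF R, of "\<lambda>_. 1" 1 "even_poly q x" b] by (simp add: V_def)
    ultimately have mass: "(\<lambda>N. (LINT t|ball_measure R. ?w N t)\<^sup>2) \<longlonglongrightarrow> V\<^sup>2" by (intro tendsto_power) simp
    have energy: "E \<longlonglongrightarrow> V"
      unfolding E_def[abs_def] V_energy by (intro tendsto_mult tendsto_const weight_approx_energy_limit R)
    have "V\<^sup>2 \<le> (V + \<epsilon>) * T" if "\<epsilon> > 0" for \<epsilon>
      by (rule LIMSEQ_le[OF mass tendsto_mult[OF tendsto_add[OF energy tendsto_const] tendsto_const]])
        (use step[OF that] in auto)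
    then have "V\<^sup>2 \<le> V * T"
      using T0
    proof -
      assume a: "\<And>\<epsilon>. \<epsilon> > 0 \<Longrightarrow> V\<^sup>2 \<le> (V + \<epsilon>) * T"
      have "(\<lambda>n. (V + inverse (real (Suc n))) * T) \<longlonglongrightarrow> (V + 0) * T"
        by (intro tendsto_intros LIMSEQ_inverse_real_of_nat)
      then have "V\<^sup>2 \<le> (V + 0) * T"
        by (rule LIMSEQ_le_const) (use a in auto)
      then show ?thesis by simp
    qed
    then show "V \<le> T" using V_pos by (simp add: power2_eq_square)
  qed
  have "magnitude (cball (0::real^'n) R) = ereal V"
  proof (rule antisym)
    show "magnitude (cball (0::real^'n) R) \<le> ereal V"
      unfolding magnitude_def by (rule SUP_least) (use upper in auto)
    show "ereal V \<le> magnitude (cball (0::real^'n) R)"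
    proof (rule ccontr)
      assume "\<not> ?thesis"
      then have lt: "magnitude (cball (0::real^'n) R) < ereal V" by simp
      have le: "ereal (finite_magnitude A) \<le> magnitude (cball (0::real^'n) R)" if "finite A" "A \<subseteq> cball 0 R" for A :: "(real^'n) set"
        unfolding magnitude_def by (rule SUP_upper) (use that in auto)
      \<comment> \<open>The strict bound by \<open>V\<close> excludes \<open>\<infinity>\<close>,
        and the empty set excludes \<open>-\<infinity>\<close>, so the supremum is a real
        number.\<close>
      obtain T where T: "magnitude (cball (0::real^'n) R) = ereal T"
        using lt le[of "{}"] by (cases "magnitude (cball (0::real^'n) R)") auto
      have "V \<le> T" by (rule lower) (use le T in auto)
      then show False using lt T by simp
    qed
  qed
  then show ?thesis by (simp add: V_def)
qed

end

theorem theorem4: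
  assumes "odd CARD('n::finite)"
  shows "\<exists>P Q :: rat poly. \<forall>(c :: real ^ 'n) R. R > 0 \<longrightarrow>
           poly (map_poly of_rat Q) R \<noteq> 0 \<and>
           magnitude (cball c R)
             = ereal (poly (map_poly of_rat P) R / poly (map_poly of_rat Q) R)"
proof -
  obtain q where n: "CARD('n) = 2 * q + 1" using assms by (elim oddE) auto
  obtain l \<kappa> where "\<kappa> > 0" "coeff l 0 = 1" "Polynomial.smult \<kappa> (laplace_corr l l) = (radial_poly q :: real poly)"
    using radial_poly_factorization by blast
  then interpret radial_feature q l \<kappa> by unfold_locales
  obtain P Q :: "rat poly" where PQ: "\<forall>R>0. poly (map_poly of_rat Q) R \<noteq> 0 \<and>
     (\<exists>x b. boundary_balance q R (even_poly q x) b \<and>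
       2 * exp_moment (radial_poly q * monom 1 (2 * q)) * x q = (1::real) \<and>
       (LINT s|weight_space R. weight_density R (even_poly q x) b s) = poly (map_poly of_rat P) R / poly (map_poly of_rat Q) R)"
    using rational_weight_mass by blast
  show ?thesis
  proof (rule exI[of _ P], rule exI[of _ Q], intro allI impI)
    fix c :: "real^'n" and R :: real assume R: "R > 0"
    then obtain x b where Q0: "poly (map_poly of_rat Q) R \<noteq> 0"
      and xb: "boundary_balance q R (even_poly q x) b" "2 * exp_moment (radial_poly q * monom 1 (2 * q)) * x q = 1"
      and V: "(LINT s|weight_space R. weight_density R (even_poly q x) b s) = poly (map_poly of_rat P) R / poly (map_poly of_rat Q) R"
      using PQ by blast
    have "magnitude (cball c R) = magnitude ((+) c ` cball 0 R)" by simp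
    also have "\<dots> = magnitude (cball (0::real^'n) R)" by (rule magnitude_translation)
    finally show "poly (map_poly of_rat Q) R \<noteq> 0 \<and> magnitude (cball c R) = ereal (poly (map_poly of_rat P) R / poly (map_poly of_rat Q) R)"
      using Q0 magnitude_ball_eq[OF n R xb] V by simp
  qed
qed

end
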